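(* Let $F_2=\langle a,b\rangle$ be the free group of rank two. For irreducible representations $\rho\colon F_2\to SL(2,\mathbb C)$: if $\rho$ satisfies the $BQ$-conditions then $\rho$ satisfies the bounded intersection property $BIP$; if $\rho$ is primitive stable then $\rho$ satisfies $BIP$; and conversely $BIP$ implies neither of these two conditions, i.e. there exist irreducible representations which satisfy $BIP$ but do not satisfy the $BQ$-conditions, and irreducible representations which satisfy $BIP$ but are not primitive stable.
   Context: Notation. An element $u\in F_2$ is primitive if there is $v\in F_2$ such that $(u,v)$ is a generating pair (i.e. a free basis) of $F_2$; $\mathcal P$ is the set of primitive elements. $SL(2,\mathbb C)$ acts on hyperbolic $3$-space $\mathbb H^3$ by orientation-preserving isometries in the usual way, and $d$ is the hyperbolic distance. Two primitive elements $u,v$ are in the same extended conjugacy class if $v=gug^{-1}$ or $v=gu^{-1}g^{-1}$ for some $g\in F_2$. $BQ$-conditions. An irreducible representation $\rho\colon F_2\to SL(2,\mathbb C)$ satisfies the $BQ$-conditions if (i) $\mathrm{Tr}\,\rho(g)\notin[-2,2]$ for all $g\in\mathcal P$, and (ii) there are only finitely many extended conjugacy classes of elements $g\in\mathcal P$ with $|\mathrm{Tr}\,\rho(g)|\le 2$. Quasigeodesics. A path $\gamma\colon I\to\mathbb H^3$ ($I\subset\mathbb R$ a possibly infinite interval) is a $(K,\epsilon)$-quasigeodesic, with $K,\epsilon>0$, if $K^{-1}|s-t|-\epsilon\le d(\gamma(s),\gamma(t))\le K|s-t|+\epsilon$ for all $s,t\in I$. Broken geodesics and primitive stability. Fix a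 basepoint $O\in\mathbb H^3$ and a generating pair $(u,v)$ of $F_2$. Let $w=e_1e_2\cdots e_n$ with $e_k\in\{u^{\pm1},v^{\pm1}\}$ be a cyclically shortest word in $(u,v)$ (the word and all its cyclic permutations are reduced). Extend $e_k$ to all $k\in\mathbb Z$ periodically with period $n$ and put $E_k=\rho(e_k)$. The broken geodesic $\mathrm{br}_\rho(w;(u,v))$ is the bi-infinite path of geodesic segments joining in order the points $P_m$, $m\in\mathbb Z$, where $P_0=O$, $P_m=E_1E_2\cdots E_mO$ for $m>0$ and $P_{-m}=E_0^{-1}E_{-1}^{-1}\cdots E_{-m+1}^{-1}O$ for $m>0$; it is parametrised so that $P_m$ is the point at time $m$ and each segment is traversed at constant speed. The representation $\rho$ is primitive stable if there are constants $K,\epsilon>0$ such that for every cyclically shortest word $w$ in $(u,v)$ representing a primitive element, $\mathrm{br}_\rho(w;(u,v))$ is a $(K,\epsilon)$-quasigeodesic. This condition does not depend on the choice of $O$ or of $(u,v)$. Bounded intersection property. The basic generator pairs are $(a,b)$, $(a,ab)$, $(b,ab)$. Write $A=\rho(a)$, $B=\rho(b)$. For a loxodromic or elliptic isometry, its axis is its invariant (respectively fixed) geodesic line in $\mathbb H^3$; for a parabolic isometry its fixed point on $\partial\mathbb H^3$ is regarded as a degenerate axis at infinity. The special hyperelliptic axes are the three complete geodesics $\mathcal E(A,B)$, $\mathcal E(A,AB)$, $\mathcal E(B,AB)$, where $\mathcal E(U,V)$ denotes the extended common perpendicular of the axes of $U$ and $V$ (if the axes cross, it is the line through the crossing point orthogonal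 to both). An element is palindromic with respect to a generating pair $(u,v)$ if the reduced word $e_1e_2\cdots e_n$ in $u^{\pm1},v^{\pm1}$ representing it reads the same forwards and backwards; if $w$ is palindromic with respect to $(u,v)$ then the axis of $\rho(w)$ meets $\mathcal E(\rho(u),\rho(v))$ orthogonally. The representation $\rho$ satisfies $BIP$ if there exists $D>0$ such that whenever $w\in\mathcal P$ is palindromic with respect to one of the three basic generator pairs, the axis of $\rho(w)$ intersects the corresponding special hyperelliptic axis in a point at distance at most $D$ from $O$. (When $\rho(w)$ is parabolic the intersection is at infinity, so the condition fails.) This is independent of the choice of $O$ and of $(a,b)$. *)

theory Defs
  imports "HOL-Analysis.Analysis" "HOL-Algebra.Group"
begin

section \<open>The free group of rank two\<close>

text \<open>
  A letter is a formal generator with a sign (\<open>True\<close> for the generator, \<open>False\<close> for its inverse).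
  The free group is the set of reduced words, multiplied by concatenation and cancellation.
  Formal words are also used to write group elements in terms of an arbitrary pair \<open>(u, v)\<close>,
  with \<open>X\<close> standing for \<open>u\<close> and \<open>Y\<close> for \<open>v\<close>.
\<close>

datatype gen = X | Y

type_synonym letter = "gen \<times> bool"

definition inv_letter :: "letter \<Rightarrow> letter" where
  "inv_letter l = (fst l, \<not> snd l)"

definition reduced :: "letter list \<Rightarrow> bool" where
  "reduced w \<longleftrightarrow> successively (\<lambda>x y. y \<noteq> inv_letter x) w"

fun push :: "letter \<Rightarrow> letter list \<Rightarrow> letter list" where
  "push x [] = [x]"
| "push x (y # ys) = (if y = inv_letter x then ys else x # y # ys)"

definition reduce :: "letter list \<Rightarrow> letter list" where
  "reduce w = foldr push w []"

definition F2 :: "letter list monoid" where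
  "F2 = \<lparr>carrier = {w. reduced w}, monoid.mult = (\<lambda>x y. reduce (x @ y)), one = []\<rparr>"

definition gen_a :: "letter list" where "gen_a = [(X, True)]"
definition gen_b :: "letter list" where "gen_b = [(Y, True)]"

lemma inv_letter_inv [simp]: "inv_letter (inv_letter x) = x"
  by (simp add: inv_letter_def)

lemma reduced_Nil [simp]: "reduced []"
  by (simp add: reduced_def)

lemma reduced_Cons: "reduced (x # w) \<longleftrightarrow> reduced w \<and> (\<forall>y ys. w = y # ys \<longrightarrow> y \<noteq> inv_letter x)"
  by (cases w) (auto simp: reduced_def)

lemma reduced_push: "reduced w \<Longrightarrow> reduced (push x w)"
  by (cases w) (auto simp: reduced_Cons)

lemma push_eq_Cons: "reduced (x # w) \<Longrightarrow> push x w = x # w"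
  by (cases w) (auto simp: reduced_Cons)

lemma push_push_inv: "reduced w \<Longrightarrow> push x (push (inv_letter x) w) = w"
  by (cases w) (auto simp: push_eq_Cons)

lemma reduced_foldr_push: "reduced w \<Longrightarrow> reduced (foldr push u w)"
  by (induction u) (auto intro: reduced_push)

lemma reduced_reduce [simp]: "reduced (reduce w)"
  by (simp add: reduce_def reduced_foldr_push)

lemma reduce_reduced: "reduced w \<Longrightarrow> reduce w = w"
  by (induction w) (auto simp: reduce_def reduced_Cons push_eq_Cons)

lemma reduce_append: "reduce (u @ v) = foldr push u (reduce v)"
  by (simp add: reduce_def)

lemma foldr_push_push:
  assumes "reduced x"
  shows "foldr push (push l r) x = push l (foldr push r x)"
proof (cases r)
  case (Cons y ys)
  then show ?thesis
    using push_push_inv[OF reduced_foldr_push[OF assms], of l ys] by auto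
qed simp

lemma foldr_push_reduce: "reduced x \<Longrightarrow> foldr push (reduce u) x = foldr push u x"
  by (induction u) (auto simp: reduce_def foldr_push_push)

lemma reduce_inverse_append: "reduced w \<Longrightarrow> foldr push (map inv_letter (rev u)) (foldr push u w) = w"
proof (induction u arbitrary: w)
  case (Cons x u)
  then show ?case
    using push_push_inv[of "foldr push u w" "inv_letter x"] by (simp add: reduced_foldr_push)
qed simp

lemma group_F2: "group F2"
proof (rule groupI)
  fix x y z
  show "x \<otimes>\<^bsub>F2\<^esub> y \<otimes>\<^bsub>F2\<^esub> z = x \<otimes>\<^bsub>F2\<^esub> (y \<otimes>\<^bsub>F2\<^esub> z)"
    using foldr_push_reduce[of "reduce z" "x @ y"]
    by (simp add: F2_def reduce_append reduce_reduced reduced_foldr_push)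
next
  fix x assume "x \<in> carrier F2"
  moreover have "reduce (map inv_letter (rev x)) \<otimes>\<^bsub>F2\<^esub> x = \<one>\<^bsub>F2\<^esub>"
    using reduce_inverse_append[of "[]" x] by (simp add: F2_def reduce_append foldr_push_reduce reduce_def[of x])
  ultimately show "\<exists>y\<in>carrier F2. y \<otimes>\<^bsub>F2\<^esub> x = \<one>\<^bsub>F2\<^esub>"
    by (intro bexI[of _ "reduce (map inv_letter (rev x))"]) (auto simp: F2_def)
qed (auto simp: F2_def reduce_reduced)


subsection \<open>Generating pairs, primitive elements, palindromes\<close>

definition letter_val :: "letter list \<Rightarrow> letter list \<Rightarrow> letter \<Rightarrow> letter list" where
  "letter_val u v l =
     (let x = (case fst l of X \<Rightarrow> u | Y \<Rightarrow> v) in if snd l then x else inv\<^bsub>F2\<^esub> x)"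

definition word_val :: "letter list \<Rightarrow> letter list \<Rightarrow> letter list \<Rightarrow> letter list" where
  "word_val u v w = foldr (\<lambda>l g. letter_val u v l \<otimes>\<^bsub>F2\<^esub> g) w \<one>\<^bsub>F2\<^esub>"

text \<open>A generating pair is a free basis: every element is the value of a unique reduced word.\<close>

definition generating_pair :: "letter list \<Rightarrow> letter list \<Rightarrow> bool" where
  "generating_pair u v \<longleftrightarrow> u \<in> carrier F2 \<and> v \<in> carrier F2 \<and>
     bij_betw (word_val u v) {w. reduced w} (carrier F2)"

definition primitives :: "letter list set" where
  "primitives = {u. \<exists>v. generating_pair u v}"

definition palindromic :: "letter list \<Rightarrow> letter list \<Rightarrow> letter list \<Rightarrow> bool" where
  "palindromic u v g \<longleftrightarrow> (\<exists>w. reduced w \<and> word_val u v w = g \<and> rev w = w)"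

definition cyclically_shortest :: "letter list \<Rightarrow> bool" where
  "cyclically_shortest w \<longleftrightarrow> (\<forall>n. reduced (rotate n w))"

definition ext_conj :: "(letter list \<times> letter list) set" where
  "ext_conj = {(u, v). u \<in> primitives \<and> v \<in> primitives \<and>
     (\<exists>g\<in>carrier F2. v = g \<otimes>\<^bsub>F2\<^esub> u \<otimes>\<^bsub>F2\<^esub> inv\<^bsub>F2\<^esub> g \<or>
                      v = g \<otimes>\<^bsub>F2\<^esub> inv\<^bsub>F2\<^esub> u \<otimes>\<^bsub>F2\<^esub> inv\<^bsub>F2\<^esub> g)}"


section \<open>Representations into SL(2,C)\<close>

type_synonym mat2 = "complex^2^2"

definition SL2C :: "mat2 monoid" where
  "SL2C = \<lparr>carrier = {A. det A = 1}, monoid.mult = (**), one = mat 1\<rparr>"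

lemma group_SL2C: "group SL2C"
proof (rule groupI)
  fix A assume "A \<in> carrier SL2C"
  then have A: "det A = 1" by (simp add: SL2C_def)
  then obtain B where B: "A ** B = mat 1" "B ** A = mat 1"
    using invertible_det_nz[of A] by (auto simp: invertible_def)
  have "det B = 1"
    using det_mul[of A B] A B by simp
  then show "\<exists>B\<in>carrier SL2C. B \<otimes>\<^bsub>SL2C\<^esub> A = \<one>\<^bsub>SL2C\<^esub>"
    using B by (auto simp: SL2C_def)
qed (auto simp: SL2C_def det_mul matrix_mul_assoc)

definition irreducible_rep :: "(letter list \<Rightarrow> mat2) \<Rightarrow> bool" where
  "irreducible_rep \<rho> \<longleftrightarrow>
     (\<forall>W. vec.subspace W \<and> (\<forall>g\<in>carrier F2. \<forall>x\<in>W. \<rho> g *v x \<in> W) \<longrightarrow> W = {0} \<or> W = UNIV)"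

definition BQ_conditions :: "(letter list \<Rightarrow> mat2) \<Rightarrow> bool" where
  "BQ_conditions \<rho> \<longleftrightarrow>
     (\<forall>g\<in>primitives. trace (\<rho> g) \<notin> complex_of_real ` {-2..2}) \<and>
     finite ({g \<in> primitives. cmod (trace (\<rho> g)) \<le> 2} // ext_conj)"


section \<open>Hyperbolic 3-space (upper half-space model)\<close>

type_synonym point = "complex \<times> real"

definition H3 :: "point set" where
  "H3 = {p. snd p > 0}"

text \<open>\<open>dist\<close> on \<open>complex \<times> real\<close> is the Euclidean distance.\<close>

definition hdist :: "point \<Rightarrow> point \<Rightarrow> real" where
  "hdist p q = arcosh (1 + (dist p q)\<^sup>2 / (2 * snd p * snd q))"

text \<open>The Poincare extension to upper half-space of the Moebius transformation of a matrix.\<close>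

definition act :: "mat2 \<Rightarrow> point \<Rightarrow> point" where
  "act M p =
     (let a = M$1$1; b = M$1$2; c = M$2$1; d = M$2$2; z = fst p; t = snd p;
          N = (cmod (c * z + d))\<^sup>2 + (cmod c)\<^sup>2 * t\<^sup>2
      in (((a * z + b) * cnj (c * z + d) + a * cnj c * of_real (t\<^sup>2)) / of_real N, t / N))"

datatype ideal_point = Fin complex | Infty

fun mobius :: "mat2 \<Rightarrow> ideal_point \<Rightarrow> ideal_point" where
  "mobius M Infty = (if M$2$1 = 0 then Infty else Fin (M$1$1 / M$2$1))"
| "mobius M (Fin z) = (if M$2$1 * z + M$2$2 = 0 then Infty
     else Fin ((M$1$1 * z + M$1$2) / (M$2$1 * z + M$2$2)))"

definition unit_speed_geodesic :: "(real \<Rightarrow> point) \<Rightarrow> bool" where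
  "unit_speed_geodesic \<gamma> \<longleftrightarrow> (\<forall>t. \<gamma> t \<in> H3) \<and> (\<forall>s t. hdist (\<gamma> s) (\<gamma> t) = \<bar>s - t\<bar>)"

definition geodesic_line :: "point set \<Rightarrow> bool" where
  "geodesic_line L \<longleftrightarrow> (\<exists>\<gamma>. unit_speed_geodesic \<gamma> \<and> L = range \<gamma>)"

fun tends_to_ideal :: "(real \<Rightarrow> point) \<Rightarrow> ideal_point \<Rightarrow> bool" where
  "tends_to_ideal \<gamma> (Fin z) \<longleftrightarrow> (\<gamma> \<longlongrightarrow> (z, 0)) at_top"
| "tends_to_ideal \<gamma> Infty \<longleftrightarrow> filterlim \<gamma> at_infinity at_top"

definition has_end :: "point set \<Rightarrow> ideal_point \<Rightarrow> bool" where
  "has_end L \<xi> \<longleftrightarrow> (\<exists>\<gamma>. unit_speed_geodesic \<gamma> \<and> L = range \<gamma> \<and> tends_to_ideal \<gamma> \<xi>)"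

text \<open>
  The model is conformal, so the hyperbolic angle between two curves is the Euclidean angle
  between their tangent vectors.
\<close>

definition meet_orthogonally :: "point set \<Rightarrow> point set \<Rightarrow> bool" where
  "meet_orthogonally L M \<longleftrightarrow>
     (\<exists>\<gamma> \<delta> x y. unit_speed_geodesic \<gamma> \<and> L = range \<gamma> \<and> unit_speed_geodesic \<delta> \<and> M = range \<delta> \<and>
        \<gamma> 0 = \<delta> 0 \<and> (\<gamma> has_vector_derivative x) (at 0) \<and> (\<delta> has_vector_derivative y) (at 0) \<and>
        inner x y = 0)"


subsection \<open>Axes\<close>

definition parabolic :: "mat2 \<Rightarrow> bool" where
  "parabolic M \<longleftrightarrow> M \<noteq> mat 1 \<and> M \<noteq> - mat 1 \<and> trace M \<in> {2, -2}"

definition elliptic :: "mat2 \<Rightarrow> bool" where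
  "elliptic M \<longleftrightarrow> trace M \<in> complex_of_real ` {-2<..<2}"

definition loxodromic :: "mat2 \<Rightarrow> bool" where
  "loxodromic M \<longleftrightarrow> trace M \<notin> complex_of_real ` {-2..2}"

datatype axis = Line "point set" | Degenerate ideal_point

text \<open>There is no axis for \<open>M = \<plusminus>1\<close>.\<close>

fun is_axis :: "mat2 \<Rightarrow> axis \<Rightarrow> bool" where
  "is_axis M (Line L) \<longleftrightarrow> geodesic_line L \<and>
     (loxodromic M \<and> act M ` L = L \<or> elliptic M \<and> (\<forall>p\<in>L. act M p = p))"
| "is_axis M (Degenerate \<xi>) \<longleftrightarrow> parabolic M \<and> mobius M \<xi> = \<xi>"

fun axis_points :: "axis \<Rightarrow> point set" where
  "axis_points (Line L) = L"
| "axis_points (Degenerate \<xi>) = {}"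

fun perpendicular_to_axis :: "point set \<Rightarrow> axis \<Rightarrow> bool" where
  "perpendicular_to_axis E (Line L) \<longleftrightarrow> meet_orthogonally E L"
| "perpendicular_to_axis E (Degenerate \<xi>) \<longleftrightarrow> has_end E \<xi>"

text \<open>
  The last conjunct is the case of crossing axes: \<open>E\<close> is then the line through the crossing point
  orthogonal to both.
\<close>

definition is_hyperelliptic_axis :: "mat2 \<Rightarrow> mat2 \<Rightarrow> point set \<Rightarrow> bool" where
  "is_hyperelliptic_axis U V E \<longleftrightarrow> geodesic_line E \<and>
     (\<exists>S T. is_axis U S \<and> is_axis V T \<and>
        perpendicular_to_axis E S \<and> perpendicular_to_axis E T \<and>
        axis_points S \<inter> axis_points T \<subseteq> E)"


section \<open>Bounded intersection property\<close>

definition basic_pairs :: "(letter list \<times> letter list) set" where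
  "basic_pairs = {(gen_a, gen_b), (gen_a, gen_a \<otimes>\<^bsub>F2\<^esub> gen_b), (gen_b, gen_a \<otimes>\<^bsub>F2\<^esub> gen_b)}"

definition BIP :: "point \<Rightarrow> (letter list \<Rightarrow> mat2) \<Rightarrow> bool" where
  "BIP p0 \<rho> \<longleftrightarrow>
     (\<exists>D>0. \<forall>(u, v)\<in>basic_pairs. \<forall>w\<in>primitives. palindromic u v w \<longrightarrow>
        (\<exists>L E. is_axis (\<rho> w) (Line L) \<and> is_hyperelliptic_axis (\<rho> u) (\<rho> v) E \<and>
               (\<exists>p\<in>L \<inter> E. hdist p p0 \<le> D)))"


section \<open>Primitive stability\<close>

definition quasigeodesic :: "real \<Rightarrow> real \<Rightarrow> real set \<Rightarrow> (real \<Rightarrow> point) \<Rightarrow> bool" where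
  "quasigeodesic K \<epsilon> I \<gamma> \<longleftrightarrow> (\<forall>t\<in>I. \<gamma> t \<in> H3) \<and>
     (\<forall>s\<in>I. \<forall>t\<in>I. \<bar>s - t\<bar> / K - \<epsilon> \<le> hdist (\<gamma> s) (\<gamma> t) \<and> hdist (\<gamma> s) (\<gamma> t) \<le> K * \<bar>s - t\<bar> + \<epsilon>)"

text \<open>
  For a word \<open>w = e\<^sub>1 \<dots> e\<^sub>n\<close> the matrix \<open>br_letter \<rho> u v w k\<close> is the image of the periodically
  extended letter \<open>e\<^sub>k\<close>; list positions start at 0, hence the shift.
\<close>

definition br_letter ::
    "(letter list \<Rightarrow> mat2) \<Rightarrow> letter list \<Rightarrow> letter list \<Rightarrow> letter list \<Rightarrow> int \<Rightarrow> mat2" where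
  "br_letter \<rho> u v w k = \<rho> (letter_val u v (w ! nat ((k - 1) mod int (length w))))"

definition matrix_list_prod :: "mat2 list \<Rightarrow> mat2" where
  "matrix_list_prod Ms = foldr (**) Ms (mat 1)"

definition br_vertex ::
    "(letter list \<Rightarrow> mat2) \<Rightarrow> letter list \<Rightarrow> letter list \<Rightarrow> point \<Rightarrow> letter list \<Rightarrow> int \<Rightarrow> point" where
  "br_vertex \<rho> u v p0 w m =
     (if m \<ge> 0
      then act (matrix_list_prod (map (\<lambda>k. br_letter \<rho> u v w (int k)) [1..<Suc (nat m)])) p0
      else act (matrix_list_prod
             (map (\<lambda>k. inv\<^bsub>SL2C\<^esub> (br_letter \<rho> u v w (- int k))) [0..<nat (- m)])) p0)"

definition is_br ::
    "(letter list \<Rightarrow> mat2) \<Rightarrow> letter list \<Rightarrow> letter list \<Rightarrow> point \<Rightarrow> letter list \<Rightarrow> (real \<Rightarrow> point) \<Rightarrow> bool"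
  where
  "is_br \<rho> u v p0 w \<gamma> \<longleftrightarrow> (\<forall>t. \<gamma> t \<in> H3) \<and>
     (\<forall>m::int. \<gamma> (of_int m) = br_vertex \<rho> u v p0 w m) \<and>
     (\<forall>m::int. \<forall>s\<in>{of_int m..of_int m + 1}. \<forall>t\<in>{of_int m..of_int m + 1}.
        hdist (\<gamma> s) (\<gamma> t) =
          \<bar>s - t\<bar> * hdist (br_vertex \<rho> u v p0 w m) (br_vertex \<rho> u v p0 w (m + 1)))"

text \<open>The broken geodesic is unique, since hyperbolic space is uniquely geodesic.\<close>

definition primitive_stable ::
    "point \<Rightarrow> letter list \<Rightarrow> letter list \<Rightarrow> (letter list \<Rightarrow> mat2) \<Rightarrow> bool" where
  "primitive_stable p0 u v \<rho> \<longleftrightarrow>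
     (\<exists>K>0. \<exists>\<epsilon>>0. \<forall>w. cyclically_shortest w \<and> word_val u v w \<in> primitives \<longrightarrow>
        (\<exists>\<gamma>. is_br \<rho> u v p0 w \<gamma> \<and> quasigeodesic K \<epsilon> UNIV \<gamma>))"

end

theory Submission
  imports Defs
begin

text \<open>
  For a palindrome \<open>W\<close> in a basis \<open>(U, V)\<close> the half turn about \<open>\<E>(U, V)\<close>, which is given by the
  traceless matrix \<open>U V - V U\<close>, conjugates \<open>W\<close> to its inverse. Normalising this matrix to be diagonal,
  \<open>W\<close> has equal diagonal entries, and its axis is a half circle around the origin that crosses the
  vertical line \<open>\<E>(U, V)\<close> at the height given by the quotient of the off-diagonal entries. For two
  palindromes that form a basis the bracket is again the fixed diagonal matrix up to sign, so that the
  logarithms of these heights differ by at most a constant times the inverse geometric mean of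
  \<open>\<bar>x\<^sup>2 - 4\<bar>\<close> and \<open>\<bar>y\<^sup>2 - 4\<bar>\<close>, where \<open>x\<close> and \<open>y\<close> are the two traces. Under the BQ-conditions
  these differences are summable along the Farey tree, uniformly over all branches: away from the
  finitely many regions with small trace the traces grow exponentially, since an infinite branch with
  decreasing traces of modulus greater than 2 would force the trace of the commutator to be 2.

  Every palindromic primitive element occurs in the tree by Nielsen reduction, and because a conjugate
  palindrome is the same palindrome. Primitive stability implies the BQ-conditions because the powers
  of a matrix whose trace has modulus at most 2 grow at a bounded exponential rate. Finally, the
  representation onto the quaternion group satisfies BIP: the axes of all primitive elements pass
  through one point.
\<close>

text \<open>In a given basis only two of the three parity classes of primitive elements contain
  palindromes: the product \<open>P R\<close> of the two palindromes of a pair has both exponent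
  sums odd. Hence the tree carries a flag for the edges at which one region has no palindromic
  representative.

  The geometry is done for the pair \<open>(a, b)\<close> alone. Any other generating pair
  \<open>(c, d)\<close> is reached by composing the representation with the automorphism
  \<open>a -> c\<close>, \<open>b -> d\<close>, which preserves irreducibility and the
  BQ-conditions.

  Irreducibility enters through one fact, \<open>det (U V - V U) \<noteq> 0\<close>, equivalent by
  Fricke's identity to the commutator not having trace 2. It makes the bracket an invertible half
  turn, and it rules out the branch with decreasing traces.

  The delicate branches are those that wind forever around one region with trace of modulus at most
  2. There growth cannot come from the size of that trace; it comes from the trace lying outside
  \<open>[-2, 2]\<close>, which gives a multiplier off the unit circle.

  The quaternion representation violates the BQ-conditions because its traces on primitive elements
  vanish, and it is not primitive stable because primitive stability implies the
  BQ-conditions.\<close>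

definition winv :: "letter list \<Rightarrow> letter list" where
  "winv w = map inv_letter (rev w)"

text \<open>Equality of arbitrary words in the free group, stated through the left action on reduced words
  so that simplification decides it.\<close>

definition weq :: "letter list \<Rightarrow> letter list \<Rightarrow> bool" (infix "\<doteq>" 50) where
  "u \<doteq> v \<longleftrightarrow> (\<forall>y. reduced y \<longrightarrow> foldr push u y = foldr push v y)"

definition subst_letter :: "letter list \<Rightarrow> letter list \<Rightarrow> letter \<Rightarrow> letter list" where
  "subst_letter u v l = (let x = (case fst l of X \<Rightarrow> u | Y \<Rightarrow> v) in if snd l then x else winv x)"

text \<open>No reduction takes place, so substitution is strictly multiplicative and composes
  strictly; \<open>word_val\<close> is recovered by reducing at the end.\<close>

definition subst :: "letter list \<Rightarrow> letter list \<Rightarrow> letter list \<Rightarrow> letter list" where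
  "subst u v w = concat (map (subst_letter u v) w)"

lemma inv_letter_neq [simp]: "inv_letter x \<noteq> x" "x \<noteq> inv_letter x"
  by (auto simp: inv_letter_def prod_eq_iff)

lemma inv_letter_eq_iff [simp]: "inv_letter x = inv_letter y \<longleftrightarrow> x = y"
  by (metis inv_letter_inv)

lemma inv_letter_simps [simp]: "inv_letter (g, b) = (g, \<not> b)" "fst (inv_letter l) = fst l"
  by (auto simp: inv_letter_def)

lemma winv_simps [simp]:
  "winv [] = []" "winv (x # w) = winv w @ [inv_letter x]" "winv (u @ v) = winv v @ winv u"
  "winv (winv w) = w" "length (winv w) = length w" "winv w = [] \<longleftrightarrow> w = []"
  by (simp_all add: winv_def rev_map comp_def)

lemma winv_inject [simp]: "winv u = winv v \<longleftrightarrow> u = v"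
  by (metis winv_simps(4))

lemma rev_winv: "rev (winv w) = winv (rev w)"
  by (simp add: winv_def rev_map)

lemma reduced_append_iff:
  "reduced (u @ v) \<longleftrightarrow> reduced u \<and> reduced v \<and> (u = [] \<or> v = [] \<or> hd v \<noteq> inv_letter (last u))"
  by (simp add: reduced_def successively_append_iff)

lemma reduced_overlap: "reduced (a @ b) \<Longrightarrow> reduced (b @ c) \<Longrightarrow> b \<noteq> [] \<Longrightarrow> reduced (a @ b @ c)"
  by (auto simp: reduced_append_iff)

lemma inv_letter_commute: "inv_letter x = y \<longleftrightarrow> x = inv_letter y"
  by (metis inv_letter_inv)

lemma reduced_rev [simp]: "reduced (rev w) \<longleftrightarrow> reduced w"
  by (induction w rule: induct_list012)
    (auto simp: reduced_def successively_append_iff inv_letter_commute)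

lemma reduced_map_inv [simp]: "reduced (map inv_letter w) \<longleftrightarrow> reduced w"
  by (induction w rule: induct_list012) (auto simp: reduced_def)

lemma reduced_winv [simp]: "reduced (winv w) \<longleftrightarrow> reduced w"
  by (simp add: winv_def)

lemma reduced_single [simp]: "reduced [x]"
  by (simp add: reduced_def)

lemma foldr_push_winv [simp]:
  assumes "reduced y"
  shows "foldr push (winv u) (foldr push u y) = y" "foldr push u (foldr push (winv u) y) = y"
  using reduce_inverse_append[OF assms, of u] reduce_inverse_append[OF assms, of "winv u"]
  by (simp_all add: winv_def rev_map comp_def)

lemma reduced_pair [simp]: "reduced [x, y] \<longleftrightarrow> y \<noteq> inv_letter x"
  by (simp add: reduced_def)

lemma weq_iff_reduce: "u \<doteq> v \<longleftrightarrow> reduce u = reduce v"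
proof
  assume "u \<doteq> v" then show "reduce u = reduce v" by (simp add: weq_def reduce_def)
next
  assume "reduce u = reduce v" then show "u \<doteq> v"
    unfolding weq_def by (metis foldr_push_reduce)
qed

lemma weq_refl [simp]: "u \<doteq> u" and weq_sym: "u \<doteq> v \<Longrightarrow> v \<doteq> u"
  and weq_trans [trans]: "u \<doteq> v \<Longrightarrow> v \<doteq> w \<Longrightarrow> u \<doteq> w"
  by (simp_all add: weq_def)

lemma reduce_weq [simp]: "reduce u \<doteq> u" "u \<doteq> reduce u"
  by (simp_all add: weq_iff_reduce reduce_reduced)

lemma weq_append: "u \<doteq> u' \<Longrightarrow> v \<doteq> v' \<Longrightarrow> u @ v \<doteq> u' @ v'"
  by (simp add: weq_def reduced_foldr_push)

lemma weq_winv: assumes "u \<doteq> u'" shows "winv u \<doteq> winv u'"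
  unfolding weq_def
proof (intro allI impI)
  fix y :: "letter list" assume y: "reduced y"
  have "foldr push u (foldr push (winv u') y) = y"
    using assms y by (simp add: weq_def reduced_foldr_push)
  then show "foldr push (winv u) y = foldr push (winv u') y"
    using foldr_push_winv(1)[of "foldr push (winv u') y" u] y by (simp add: reduced_foldr_push)
qed

lemmas weq_simps = weq_def reduced_foldr_push

lemma weq_reduced: "reduced u \<Longrightarrow> reduced v \<Longrightarrow> u \<doteq> v \<longleftrightarrow> u = v"
  by (simp add: weq_iff_reduce reduce_reduced)

lemma weq_conj_cancel:
  assumes "g @ u @ winv g \<doteq> g @ v @ winv g" shows "u \<doteq> v"
proof -
  have "u \<doteq> winv g @ (g @ u @ winv g) @ g" by (simp add: weq_simps)
  also have "\<dots> \<doteq> winv g @ (g @ v @ winv g) @ g" by (intro weq_append weq_refl assms)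
  also have "\<dots> \<doteq> v" by (simp add: weq_simps)
  finally show ?thesis .
qed

lemma map_inv_push: "map inv_letter (push x w) = push (inv_letter x) (map inv_letter w)"
  by (cases w) auto

lemma map_inv_reduce: "map inv_letter (reduce w) = reduce (map inv_letter w)"
  by (induction w) (auto simp: reduce_def map_inv_push)

lemma reduce_winv: "reduce (winv w) = winv (reduce w)"
  using weq_winv[of w "reduce w"] by (simp add: weq_iff_reduce reduce_reduced)

text \<open>Reversal is inversion followed by inverting every letter, and both commute with
  reduction.\<close>

lemma reduce_rev: "reduce (rev w) = rev (reduce w)"
  using map_inv_reduce[of "winv w"] reduce_winv[of w]
  by (simp add: winv_def rev_map comp_def)

lemma weq_rev: "u \<doteq> v \<Longrightarrow> rev u \<doteq> rev v"
  by (simp add: weq_iff_reduce reduce_rev)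

text \<open>The automorphism inverting both generators fixes only the identity; this ends the proof
  that conjugate palindromes coincide.\<close>

lemma map_inv_fixed: "map inv_letter w = w \<Longrightarrow> w = []"
  by (cases w) auto

section \<open>The group\<close>

interpretation F2: group F2 by (rule group_F2)

lemma F2_simps: "carrier F2 = {w. reduced w}" "x \<otimes>\<^bsub>F2\<^esub> y = reduce (x @ y)" "\<one>\<^bsub>F2\<^esub> = []"
  by (simp_all add: F2_def)

lemma inv_F2: "reduced x \<Longrightarrow> inv\<^bsub>F2\<^esub> x = winv x"
  by (rule F2.inv_equality)
    (simp_all add: F2_simps reduce_def)

lemma letter_val_subst: "reduced u \<Longrightarrow> reduced v \<Longrightarrow> letter_val u v l = subst_letter u v l"
  by (simp add: letter_val_def subst_letter_def inv_F2 Let_def split: gen.split)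

lemma subst_simps [simp]:
  "subst u v [] = []" "subst u v (l # w) = subst_letter u v l @ subst u v w"
  "subst u v (w @ w') = subst u v w @ subst u v w'"
  by (simp_all add: subst_def)

lemma subst_letter_simps [simp]:
  "subst_letter u v (X, True) = u" "subst_letter u v (Y, True) = v"
  "subst_letter u v (X, False) = winv u" "subst_letter u v (Y, False) = winv v"
  by (simp_all add: subst_letter_def)

lemma subst_letter_inv: "subst_letter u v (inv_letter l) = winv (subst_letter u v l)"
  by (cases l rule: prod.exhaust; cases "fst l") (auto simp: subst_letter_def Let_def)

lemma subst_winv: "subst u v (winv w) = winv (subst u v w)"
  by (induction w) (auto simp: subst_letter_inv)

lemma subst_subst_letter: "subst u v (subst_letter s t l) = subst_letter (subst u v s) (subst u v t) l"
  by (simp add: subst_letter_def Let_def subst_winv split: gen.split)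

lemma subst_subst: "subst u v (subst s t w) = subst (subst u v s) (subst u v t) w"
  by (induction w) (auto simp: subst_subst_letter)

lemma subst_id: "subst [(X, True)] [(Y, True)] w = w"
proof (induction w)
  case (Cons l w)
  then show ?case by (cases l; cases "fst l"; cases "snd l") (auto simp: subst_letter_def)
qed simp

lemma weq_subst_letter: "u \<doteq> u' \<Longrightarrow> v \<doteq> v' \<Longrightarrow> subst_letter u v l \<doteq> subst_letter u' v' l"
  by (simp add: subst_letter_def Let_def weq_winv split: gen.split)

lemma weq_subst_pair: "u \<doteq> u' \<Longrightarrow> v \<doteq> v' \<Longrightarrow> subst u v w \<doteq> subst u' v' w"
  by (induction w) (auto intro: weq_append weq_subst_letter)

text \<open>A cancelling pair of letters is substituted by a word and its inverse, so reducing
  before the substitution does not change the element.\<close>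

lemma weq_subst: assumes "w \<doteq> w'" shows "subst u v w \<doteq> subst u v w'"
proof -
  have push: "foldr push (subst u v (push x w)) y = foldr push (subst_letter u v x) (foldr push (subst u v w) y)"
    if "reduced y" for x w y
    using that by (cases w) (auto simp: subst_letter_inv reduced_foldr_push)
  have "foldr push (subst u v (reduce w)) y = foldr push (subst u v w) y" if "reduced y" for w y
    using that by (induction w) (auto simp: reduce_def push)
  then show ?thesis using assms by (metis weq_def weq_iff_reduce)
qed

lemma word_val_eq: "reduced u \<Longrightarrow> reduced v \<Longrightarrow> word_val u v w = reduce (subst u v w)"
proof (induction w)
  case (Cons l w)
  have "word_val u v (l # w) = letter_val u v l \<otimes>\<^bsub>F2\<^esub> word_val u v w"
    by (simp add: word_val_def)
  also have "\<dots> = reduce (subst_letter u v l @ reduce (subst u v w))"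
    using Cons by (simp add: F2_simps letter_val_subst)
  also have "\<dots> = reduce (subst u v (l # w))"
    using weq_append[OF weq_refl reduce_weq(1)] by (simp add: weq_iff_reduce)
  finally show ?case .
qed (simp add: word_val_def F2_simps reduce_def)

section \<open>Free bases of words modulo cancellation\<close>

definition basis :: "letter list \<Rightarrow> letter list \<Rightarrow> bool" where
  "basis u v \<longleftrightarrow> generating_pair (reduce u) (reduce v)"

lemma word_val_reduce: "word_val (reduce u) (reduce v) w = reduce (subst u v w)"
proof -
  have "subst (reduce u) (reduce v) w \<doteq> subst u v w" by (intro weq_subst_pair) auto
  then show ?thesis by (simp add: word_val_eq weq_iff_reduce)
qed

text \<open>Bijectivity on reduced words, rephrased for arbitrary words; pairs such as
  \<open>(P, P @ R @ P)\<close> can then be treated without reducing them.\<close>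

lemma basis_altdef:
  "basis u v \<longleftrightarrow> (\<forall>w. \<exists>s. subst u v s \<doteq> w) \<and> (\<forall>s t. subst u v s \<doteq> subst u v t \<longrightarrow> s \<doteq> t)"
proof
  assume "basis u v"
  then have b: "bij_betw (\<lambda>w. reduce (subst u v w)) {w. reduced w} {w. reduced w}"
    by (simp add: basis_def generating_pair_def word_val_reduce[abs_def] F2_simps)
  have "\<exists>s. subst u v s \<doteq> w" for w
  proof -
    have "reduce w \<in> (\<lambda>w. reduce (subst u v w)) ` {w. reduced w}"
      using b by (simp add: bij_betw_def)
    then show ?thesis by (auto simp: weq_iff_reduce)
  qed
  moreover have "s \<doteq> t" if "subst u v s \<doteq> subst u v t" for s t
  proof -
    have "reduce (subst u v (reduce s)) = reduce (subst u v (reduce t))"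
      using that weq_subst[OF reduce_weq(1)] by (metis weq_iff_reduce)
    then have "reduce s = reduce t"
      using b by (auto simp: bij_betw_def inj_on_def)
    then show ?thesis by (simp add: weq_iff_reduce)
  qed
  ultimately show "(\<forall>w. \<exists>s. subst u v s \<doteq> w) \<and> (\<forall>s t. subst u v s \<doteq> subst u v t \<longrightarrow> s \<doteq> t)" by blast
next
  assume *: "(\<forall>w. \<exists>s. subst u v s \<doteq> w) \<and> (\<forall>s t. subst u v s \<doteq> subst u v t \<longrightarrow> s \<doteq> t)"
  have "bij_betw (\<lambda>w. reduce (subst u v w)) {w. reduced w} {w. reduced w}"
    unfolding bij_betw_def
  proof
    show "inj_on (\<lambda>w. reduce (subst u v w)) {w. reduced w}"
      using * by (auto simp: inj_on_def weq_iff_reduce[symmetric]) (metis weq_reduced)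
    show "(\<lambda>w. reduce (subst u v w)) ` {w. reduced w} = {w. reduced w}"
    proof (intro equalityI subsetI)
      fix w assume "w \<in> {w. reduced w}"
      then obtain s where "subst u v s \<doteq> w" "reduced w" using * by blast
      then have "reduce (subst u v (reduce s)) = w"
        using weq_subst[OF reduce_weq(1)] by (metis weq_iff_reduce reduce_reduced)
      then show "w \<in> (\<lambda>w. reduce (subst u v w)) ` {w. reduced w}" by (intro image_eqI[of _ _ "reduce s"]) auto
    qed auto
  qed
  then show "basis u v"
    by (simp add: basis_def generating_pair_def word_val_reduce[abs_def] F2_simps)
qed

lemma basis_surj: "basis u v \<Longrightarrow> \<exists>s. subst u v s \<doteq> w"
  and basis_inj: "basis u v \<Longrightarrow> subst u v s \<doteq> subst u v t \<Longrightarrow> s \<doteq> t"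
  unfolding basis_altdef by blast+

lemma generating_pair_basis: "generating_pair u v \<longleftrightarrow> reduced u \<and> reduced v \<and> basis u v"
  by (auto simp: basis_def reduce_reduced generating_pair_def F2_simps)

lemma basis_subst: assumes "basis u v" "basis s t" shows "basis (subst u v s) (subst u v t)"
  unfolding basis_altdef subst_subst[symmetric]
proof safe
  fix w
  obtain r where r: "subst u v r \<doteq> w" using basis_surj[OF assms(1)] by blast
  obtain q where "subst s t q \<doteq> r" using basis_surj[OF assms(2)] by blast
  then have "subst u v (subst s t q) \<doteq> w" using weq_subst r weq_trans by blast
  then show "\<exists>q. subst u v (subst s t q) \<doteq> w" by blast
next
  fix p q assume "subst u v (subst s t p) \<doteq> subst u v (subst s t q)"
  then show "p \<doteq> q" using assms basis_inj by blast
qed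

text \<open>The hypotheses say that the endomorphisms given by \<open>(s, t)\<close> and
  \<open>(s', t')\<close> are inverse to each other on the generators, hence everywhere.\<close>

lemma basisI_inverse:
  assumes "subst s t s' \<doteq> [(X, True)]" "subst s t t' \<doteq> [(Y, True)]"
    "subst s' t' s \<doteq> [(X, True)]" "subst s' t' t \<doteq> [(Y, True)]"
  shows "basis s t"
proof -
  have 1: "subst s t (subst s' t' w) \<doteq> w" for w
    using weq_subst_pair[OF assms(1,2), of w] by (simp add: subst_subst subst_id)
  have 2: "subst s' t' (subst s t w) \<doteq> w" for w
    using weq_subst_pair[OF assms(3,4), of w] by (simp add: subst_subst subst_id)
  show ?thesis unfolding basis_altdef
    using 1 2 weq_subst by (metis weq_sym weq_trans)
qed

lemma basis_weq: "u \<doteq> u' \<Longrightarrow> v \<doteq> v' \<Longrightarrow> basis u v \<longleftrightarrow> basis u' v'"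
  by (simp add: basis_def weq_iff_reduce)

lemma basis_std: "basis [(X, True)] [(Y, True)]"
  unfolding basis_altdef subst_id using weq_refl by blast

lemma basis_moves:
  assumes "basis u v"
  shows "basis v u" "basis (winv u) v" "basis u (u @ v)"
proof -
  have "basis [(Y, True)] [(X, True)]"
    by (rule basisI_inverse[of _ _ "[(Y, True)]" "[(X, True)]"]) auto
  from basis_subst[OF assms this] show "basis v u" by simp
  have "basis [(X, False)] [(Y, True)]"
    by (rule basisI_inverse[of _ _ "[(X, False)]" "[(Y, True)]"]) auto
  from basis_subst[OF assms this] show "basis (winv u) v" by simp
  have "basis [(X, True)] [(X, True), (Y, True)]"
    by (rule basisI_inverse[of _ _ "[(X, True)]" "[(X, False), (Y, True)]"]) (auto simp: weq_iff_reduce reduce_def)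
  from basis_subst[OF assms this] show "basis u (u @ v)" by simp
qed

lemma subst_conj: "subst (g @ u @ winv g) (g @ v @ winv g) w \<doteq> g @ subst u v w @ winv g"
proof (induction w)
  case Nil
  then show ?case by (simp add: weq_simps)
next
  case (Cons l w)
  have "subst_letter (g @ u @ winv g) (g @ v @ winv g) l = g @ subst_letter u v l @ winv g"
    by (simp add: subst_letter_def Let_def split: gen.split)
  then show ?case using Cons by (simp add: weq_simps)
qed

lemma basis_conj: assumes "basis u v" shows "basis (g @ u @ winv g) (g @ v @ winv g)"
  unfolding basis_altdef
proof safe
  fix w
  obtain s where s: "subst u v s \<doteq> winv g @ w @ g" using basis_surj[OF assms] by blast
  have "subst (g @ u @ winv g) (g @ v @ winv g) s \<doteq> w"
    using subst_conj[of g u v s] s by (simp add: weq_simps)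
  then show "\<exists>s. subst (g @ u @ winv g) (g @ v @ winv g) s \<doteq> w" by blast
next
  fix s t assume "subst (g @ u @ winv g) (g @ v @ winv g) s \<doteq> subst (g @ u @ winv g) (g @ v @ winv g) t"
  then have "g @ subst u v s @ winv g \<doteq> g @ subst u v t @ winv g"
    using subst_conj weq_sym weq_trans by meson
  then have "subst u v s \<doteq> subst u v t" by (rule weq_conj_cancel)
  then show "s \<doteq> t" using assms basis_inj by blast
qed

lemma primitives_altdef: "w \<in> primitives \<longleftrightarrow> reduced w \<and> (\<exists>v. basis w v)"
proof
  assume "reduced w \<and> (\<exists>v. basis w v)"
  then obtain v where "reduced w" "basis w v" by auto
  then have "generating_pair w (reduce v)"
    by (simp add: basis_def reduce_reduced)
  then show "w \<in> primitives" by (auto simp: primitives_def)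
qed (auto simp: primitives_def generating_pair_basis)

lemma basis_primitives:
  assumes "basis u v"
  shows "reduce u \<in> primitives" "reduce v \<in> primitives"
  using assms basis_moves(1)[OF assms] by (auto simp: basis_def primitives_def)

section \<open>Abelianization\<close>

text \<open>The homomorphism to the integers with \<open>X\<close> mapped to \<open>i\<close> and
  \<open>Y\<close> to \<open>j\<close>. \<open>wt 1 0\<close> and \<open>wt 0 1\<close> are the
  exponent sums; \<open>wt 1 1\<close> and \<open>wt 1 (-1)\<close> later measure the depth in the
  two halves of the tree.\<close>

definition wt :: "int \<Rightarrow> int \<Rightarrow> letter list \<Rightarrow> int" where
  "wt i j w = sum_list (map (\<lambda>l. (if snd l then 1 else - 1) * (case fst l of X \<Rightarrow> i | Y \<Rightarrow> j)) w)"

lemma wt_simps [simp]: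
  "wt i j [] = 0" "wt i j (l # w) = (if snd l then 1 else - 1) * (case fst l of X \<Rightarrow> i | Y \<Rightarrow> j) + wt i j w"
  "wt i j (u @ v) = wt i j u + wt i j v"
  by (simp_all add: wt_def)

lemma wt_winv [simp]: "wt i j (winv w) = - wt i j w"
  by (induction w) (auto simp: inv_letter_def)

lemma wt_rev [simp]: "wt i j (rev w) = wt i j w"
  by (induction w) auto

lemma wt_push: "wt i j (push x w) = wt i j (x # w)"
  by (cases w) (auto simp: inv_letter_def)

lemma wt_reduce [simp]: "wt i j (reduce w) = wt i j w"
  by (induction w) (auto simp: reduce_def wt_push)

lemma weq_wt: "u \<doteq> v \<Longrightarrow> wt i j u = wt i j v"
  by (metis wt_reduce weq_iff_reduce)

lemma wt_subst: "wt i j (subst u v s) = wt 1 0 s * wt i j u + wt 0 1 s * wt i j v"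
proof (induction s)
  case (Cons l s)
  have "wt i j (subst_letter u v l) = wt 1 0 [l] * wt i j u + wt 0 1 [l] * wt i j v"
    by (auto simp: subst_letter_def split: gen.split)
  then show ?case using Cons by (simp add: algebra_simps)
qed simp

text \<open>Modulo 2 the images of \<open>u\<close> and \<open>v\<close> span a plane over the field
  with two elements, so the image of \<open>u\<close> is not zero.\<close>

lemma generates_parity:
  assumes "\<forall>w. \<exists>s. subst u v s \<doteq> w"
  shows "odd (wt 1 0 u) \<or> odd (wt 0 1 u)"
proof -
  obtain s t where s: "subst u v s \<doteq> [(X, True)]" and t: "subst u v t \<doteq> [(Y, True)]"
    using assms by meson
  have e: "1 = wt 1 0 s * wt 1 0 u + wt 0 1 s * wt 1 0 v" "0 = wt 1 0 s * wt 0 1 u + wt 0 1 s * wt 0 1 v"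
    "1 = wt 1 0 t * wt 0 1 u + wt 0 1 t * wt 0 1 v"
    using weq_wt[OF s, of 1 0] weq_wt[OF s, of 0 1] weq_wt[OF t, of 0 1]
    by (simp_all add: wt_subst)
  show ?thesis
  proof (rule ccontr)
    assume "\<not> ?thesis"
    then have u: "even (wt 1 0 u)" "even (wt 0 1 u)" by auto
    have "odd (wt 1 0 s * wt 1 0 u + wt 0 1 s * wt 1 0 v)" "odd (wt 1 0 t * wt 0 1 u + wt 0 1 t * wt 0 1 v)"
      "even (wt 1 0 s * wt 0 1 u + wt 0 1 s * wt 0 1 v)"
      unfolding e[symmetric] by simp_all
    then show False using u by simp
  qed
qed

lemma basis_parity: "basis u v \<Longrightarrow> odd (wt 1 0 u) \<or> odd (wt 0 1 u)"
  using generates_parity[of u v] basis_surj[of u v] by blast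

section \<open>Cancellation and Nielsen reduction\<close>

text \<open>Stripping mutually inverse end letters leaves the cyclically reduced core
  \<open>m\<close>.\<close>

lemma cyclic_decomposition:
  assumes "reduced x" "x \<noteq> []"
  shows "\<exists>c m. x = c @ m @ winv c \<and> m \<noteq> [] \<and> reduced (m @ m)"
  using assms
proof (induction "length x" arbitrary: x rule: less_induct)
  case less
  show ?case
  proof (cases "reduced (x @ x)")
    case True
    then show ?thesis using less.prems by (intro exI[of _ "[]"] exI[of _ x]) simp
  next
    case False
    then have l: "hd x = inv_letter (last x)" using less.prems by (auto simp: reduced_append_iff)
    then have "length x \<noteq> 1" by (cases x) auto
    then obtain a y b where x: "x = a # y @ [b]"
      using less.prems(2) by (cases x; cases "tl x" rule: rev_cases) auto
    with l have b: "b = inv_letter a" by (simp add: inv_letter_commute)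
    have "y \<noteq> []" using less.prems(1) unfolding x b by auto
    moreover have "reduced y" using less.prems(1) unfolding x by (metis append_Cons append_Nil reduced_append_iff)
    ultimately obtain c m where "y = c @ m @ winv c" "m \<noteq> []" "reduced (m @ m)"
      using less.hyps[of y] x by auto
    then show ?thesis using x b by (intro exI[of _ "a # c"] exI[of _ m]) auto
  qed
qed

text \<open>The number of letters that each of the two factors loses in the product.\<close>

definition canc :: "letter list \<Rightarrow> letter list \<Rightarrow> nat" where
  "canc x y = (length x + length y - length (reduce (x @ y))) div 2"

lemma canc_decomposition:
  assumes "reduced x" "reduced y"
  shows "\<exists>p r q. x = p @ r \<and> y = winv r @ q \<and> reduced (p @ q) \<and> length r = canc x y"
proof -
  have "\<exists>p r q. x = p @ r \<and> y = winv r @ q \<and> reduced (p @ q)"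
    using assms
  proof (induction x arbitrary: y rule: rev_induct)
    case (snoc l x)
    show ?case
    proof (cases "y \<noteq> [] \<and> hd y = inv_letter l")
      case True
      then obtain y' where y: "y = inv_letter l # y'" by (cases y) auto
      with snoc.IH[of y'] snoc.prems obtain p r q where "x = p @ r" "y' = winv r @ q" "reduced (p @ q)"
        by (auto simp: reduced_append_iff reduced_Cons)
      then show ?thesis using y by (intro exI[of _ p] exI[of _ "r @ [l]"] exI[of _ q]) auto
    next
      case False
      then have "reduced ((x @ [l]) @ y)" using snoc.prems by (subst reduced_append_iff) auto
      then have "x @ [l] = (x @ [l]) @ [] \<and> y = winv [] @ y \<and> reduced ((x @ [l]) @ y)" by simp
      then show ?thesis by blast
    qed
  qed (auto intro!: exI[of _ "[]"])
  then obtain p r q where *: "x = p @ r" "y = winv r @ q" "reduced (p @ q)" by blast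
  have "x @ y \<doteq> p @ q" unfolding * by (simp add: weq_simps)
  then have "reduce (x @ y) = p @ q" using * by (simp add: weq_iff_reduce reduce_reduced)
  then have "length r = canc x y" using * by (simp add: canc_def)
  with * show ?thesis by blast
qed

lemma length_reduce_append:
  assumes "reduced x" "reduced y"
  shows "length (reduce (x @ y)) + 2 * canc x y = length x + length y" "canc x y \<le> length x" "canc x y \<le> length y"
proof -
  obtain p r q where *: "x = p @ r" "y = winv r @ q" "reduced (p @ q)" "length r = canc x y"
    using canc_decomposition[OF assms] by blast
  have "x @ y \<doteq> p @ q" unfolding *(1,2) by (simp add: weq_simps)
  then have "reduce (x @ y) = p @ q" using * by (simp add: weq_iff_reduce reduce_reduced)
  then show "length (reduce (x @ y)) + 2 * canc x y = length x + length y"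
    "canc x y \<le> length x" "canc x y \<le> length y" using * by auto
qed

text \<open>In \<open>x x\<close> only the conjugators of the cyclic decomposition meet and cancel,
  and the nonempty core survives twice.\<close>

lemma canc_self: assumes "reduced x" "x \<noteq> []" shows "2 * canc x x < length x"
proof -
  obtain c m where cm: "x = c @ m @ winv c" "m \<noteq> []" "reduced (m @ m)"
    using cyclic_decomposition[OF assms] by blast
  have "reduced (c @ m)" "reduced (m @ winv c)" using assms(1) unfolding cm(1)
    by (metis append.assoc reduced_append_iff)+
  then have "reduced ((c @ m) @ m @ winv c)"
    using reduced_overlap[of c m m] reduced_overlap[of "c @ m" m "winv c"] cm by simp
  moreover have "x @ x \<doteq> (c @ m) @ m @ winv c" unfolding cm(1) by (simp add: weq_simps)
  ultimately have "reduce (x @ x) = (c @ m) @ m @ winv c"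
    by (metis weq_iff_reduce reduce_reduced)
  then show ?thesis using length_reduce_append(1)[OF assms(1) assms(1)] cm by simp
qed

lemma reduced_subst_letter: "reduced u \<Longrightarrow> reduced v \<Longrightarrow> reduced (subst_letter u v l)"
  by (simp add: subst_letter_def Let_def split: gen.split)

text \<open>Nielsen's condition says that no factor is cancelled completely by its two neighbours.\<close>

lemma length_subst_ge:
  assumes C: "\<And>l m n. m \<noteq> inv_letter l \<Longrightarrow> n \<noteq> inv_letter m \<Longrightarrow>
      canc (subst_letter u v l) (subst_letter u v m) + canc (subst_letter u v m) (subst_letter u v n)
        < length (subst_letter u v m)"
    and uv: "reduced u" "reduced v" and s: "reduced s"
  shows "length s \<le> length (reduce (subst u v s))"
proof -
  let ?L = "subst_letter u v"
  note red = reduced_subst_letter[OF uv]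
  \<comment> \<open>Invariant for the induction: the last factor has lost only an initial piece of
    \<open>k\<close> letters to its predecessor, and every earlier factor has left at least one
    letter in \<open>h\<close>.\<close>
  have claim: "\<exists>h k. reduce (subst u v (s @ [m])) = h @ drop k (?L m) \<and> length s \<le> length h \<and>
      k = (if s = [] then 0 else canc (?L (last s)) (?L m))" if "reduced (s @ [m])" for s m
    using that
  proof (induction s arbitrary: m rule: rev_induct)
    case Nil
    then show ?case using red by (auto simp: reduce_reduced)
  next
    case (snoc l s)
    have sl: "reduced (s @ [l])" using snoc.prems by (metis append.assoc reduced_append_iff)
    have lm: "m \<noteq> inv_letter l"
      using snoc.prems reduced_append_iff[of "s @ [l]" "[m]"] by simp
    obtain h k where hk: "reduce (subst u v (s @ [l])) = h @ drop k (?L l)" "length s \<le> length h"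
      "k = (if s = [] then 0 else canc (?L (last s)) (?L l))" using snoc.IH[OF sl] by blast
    have kc: "k + canc (?L l) (?L m) < length (?L l)"
    proof (cases "s = []")
      case True
      \<comment> \<open>Without a predecessor the triple \<open>l, l, m\<close> is used; it is
        admissible since no letter is its own inverse.\<close>
      then show ?thesis using hk(3) C[of l l m] lm by auto
    next
      case False
      then have "l \<noteq> inv_letter (last s)" using sl by (auto simp: reduced_append_iff)
      then show ?thesis using hk(3) C[of l "last s" m] lm False by auto
    qed
    obtain p r q where d: "?L l = p @ r" "?L m = winv r @ q" "reduced (p @ q)"
      "length r = canc (?L l) (?L m)" using canc_decomposition[OF red red] by blast
    have kp: "k < length p" using kc d by auto
    have "reduced (h @ drop k (?L l))" using hk(1) by (metis reduced_reduce)
    then have "reduced (h @ drop k p)" using kp unfolding d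
      by (simp only: drop_append append.assoc[symmetric]) (meson reduced_append_iff)
    moreover have "reduced (drop k p @ q)"
      using d(3) by (metis append.assoc append_take_drop_id reduced_append_iff)
    ultimately have r: "reduced (h @ drop k p @ q)" using kp by (intro reduced_overlap) auto
    have "subst u v ((s @ [l]) @ [m]) \<doteq> (h @ drop k (?L l)) @ ?L m"
      unfolding hk(1)[symmetric] subst_simps append_Nil2 by (intro weq_append) auto
    also have "\<dots> \<doteq> h @ drop k p @ q" using kp d by (simp add: weq_simps)
    finally have "reduce (subst u v ((s @ [l]) @ [m])) = h @ drop k p @ q"
      using r by (simp add: weq_iff_reduce reduce_reduced)
    moreover have "q = drop (canc (?L l) (?L m)) (?L m)" using d by simp
    ultimately show ?case using kp hk(2)
      by (intro exI[of _ "h @ drop k p"] exI[of _ "canc (?L l) (?L m)"]) auto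
  qed
  show ?thesis
  proof (cases s rule: rev_cases)
    case (snoc t m)
    then obtain h k where hk: "reduce (subst u v s) = h @ drop k (?L m)" "length t \<le> length h"
      "k = (if t = [] then 0 else canc (?L (last t)) (?L m))" using claim[of t m] s by blast
    have "k < length (?L m)"
    proof (cases "t = []")
      case True
      then show ?thesis using hk(3) C[of m m m] by auto
    next
      case False
      then have "m \<noteq> inv_letter (last t)" using s snoc by (auto simp: reduced_append_iff)
      then show ?thesis using hk(3) C[of m "last t" m] False by auto
    qed
    then show ?thesis using hk snoc by simp
  qed simp
qed

section \<open>The tree of palindromic generating pairs\<close>

text \<open>A state \<open>(False, P, R)\<close> stands for the edge of the Farey tree between the regions \<open>P\<close> and
  \<open>R\<close>, a state \<open>(True, P, R)\<close> for the edge between \<open>P\<close> and \<open>P R\<close>; here \<open>P\<close> and \<open>R\<close> are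
  palindromes. The new region below such an edge is \<open>P R\<close>, respectively \<open>P (P R)\<close>, which is
  conjugate to the palindrome \<open>P R P\<close>. The two functions give the two edges below it.\<close>

type_synonym state = "bool \<times> letter list \<times> letter list"

fun left :: "state \<Rightarrow> state" where
  "left (False, P, R) = (True, P, R)"
| "left (True, P, R) = (False, P, P @ R @ P)"

fun right :: "state \<Rightarrow> state" where
  "right (False, P, R) = (True, R, P)"
| "right (True, P, R) = (True, P @ R @ P, winv P)"

inductive below :: "state \<Rightarrow> state \<Rightarrow> bool" for s where
  refl: "below s s"
| left: "below s t \<Longrightarrow> below s (left t)"
| right: "below s t \<Longrightarrow> below s (right t)"

text \<open>The edge between \<open>a\<close> and \<open>b\<close> cuts the Farey tree into the
  halves of positive and of negative slopes; the sign selects one of them.\<close>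

definition farey_root :: "bool \<Rightarrow> state" where
  "farey_root b = (False, [(X, True)], [(Y, b)])"

definition tree :: "state \<Rightarrow> bool" where
  "tree s \<longleftrightarrow> (\<exists>b. below (farey_root b) s)"

lemma tree_intros:
  "tree (farey_root b)" "tree s \<Longrightarrow> tree (left s)" "tree s \<Longrightarrow> tree (right s)"
  by (auto simp: tree_def intro: below.intros)

lemma tree_cases:
  assumes "tree s"
  obtains b where "s = farey_root b" | t where "tree t" "s = left t" | t where "tree t" "s = right t"
proof -
  from assms obtain b where "below (farey_root b) s" by (auto simp: tree_def)
  then show ?thesis
  proof (cases rule: below.cases)
    case (left t)
    then show ?thesis using that(2)[of t] by (auto simp: tree_def)
  next
    case (right t)
    then show ?thesis using that(3)[of t] by (auto simp: tree_def)
  qed (use that(1) in simp)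
qed

lemma tree_induct [consumes 1, case_names root left right]:
  assumes "tree s" "\<And>b. Q (farey_root b)" "\<And>t. tree t \<Longrightarrow> Q t \<Longrightarrow> Q (left t)"
    "\<And>t. tree t \<Longrightarrow> Q t \<Longrightarrow> Q (right t)"
  shows "Q s"
proof -
  from assms(1) obtain b where "below (farey_root b) s" by (auto simp: tree_def)
  then show ?thesis
  proof (induction rule: below.induct)
    case refl then show ?case by (rule assms(2))
  next
    case (left t) then show ?case using assms(3)[of t] by (auto simp: tree_def)
  next
    case (right t) then show ?case using assms(4)[of t] by (auto simp: tree_def)
  qed
qed

definition pm :: "letter list \<Rightarrow> letter list \<Rightarrow> bool" where
  "pm u v \<longleftrightarrow> u \<doteq> v \<or> u \<doteq> winv v"

text \<open>Order and signs are forgotten, which makes the relation closed also under moves towards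
  the root and across it.\<close>

definition pal_edge :: "letter list \<Rightarrow> letter list \<Rightarrow> bool" where
  "pal_edge P R \<longleftrightarrow> (\<exists>P' R'. tree (False, P', R') \<and> (pm P P' \<and> pm R R' \<or> pm P R' \<and> pm R P'))"

lemma pm_winv: "pm u v \<Longrightarrow> pm (winv u) v"
  unfolding pm_def using weq_winv[of u v] weq_winv[of u "winv v"] by auto

lemma pal_edge_swap: "pal_edge P R \<Longrightarrow> pal_edge R P"
  and pal_edge_winv: "pal_edge P R \<Longrightarrow> pal_edge (winv P) R" "pal_edge P R \<Longrightarrow> pal_edge P (winv R)"
  unfolding pal_edge_def using pm_winv by blast+

lemma pm_refl [simp]: "pm u u" by (simp add: pm_def)

lemma pal_edge_tree: "tree (False, P, R) \<Longrightarrow> pal_edge P R"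
  unfolding pal_edge_def using pm_refl by blast

lemma pal_edge_weq: "pal_edge P R \<Longrightarrow> P' \<doteq> P \<Longrightarrow> R' \<doteq> R \<Longrightarrow> pal_edge P' R'"
  unfolding pal_edge_def pm_def by (meson weq_trans)

lemma tree_False_cases:
  assumes "tree (False, P, R)"
  obtains b where "P = [(X, True)]" "R = [(Y, b)]" | R0 where "tree (True, P, R0)" "R = P @ R0 @ P"
  using assms
proof (cases rule: tree_cases)
  case (2 t)
  then show ?thesis using that by (cases t rule: left.cases) auto
next
  case (3 t)
  then show ?thesis by (cases t rule: right.cases) auto
qed (use that in \<open>auto simp: farey_root_def\<close>)

lemma pal_edge_tree_True: assumes "tree (True, P, R)" shows "pal_edge P R"
  using assms
proof (cases rule: tree_cases)
  case (2 t)
  then show ?thesis by (cases t rule: left.cases) (auto intro: pal_edge_tree)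
next
  case (3 t)
  show ?thesis
  proof (cases t rule: right.cases)
    case (1 P' R')
    then show ?thesis using 3 by (auto intro: pal_edge_swap pal_edge_tree)
  next
    case (2 P' R')
    then have "tree (False, P', P' @ R' @ P')" using 3 tree_intros(2)[of t] by simp
    then have "pal_edge (P' @ R' @ P') (winv P')"
      by (rule pal_edge_winv(2)[OF pal_edge_swap[OF pal_edge_tree]])
    then show ?thesis using 2 3 by simp
  qed
qed (auto simp: farey_root_def)

lemma tree_PRP: "tree (False, P, R) \<Longrightarrow> tree (False, P, P @ R @ P)"
  using tree_intros(2)[of "(False, P, R)"] tree_intros(2)[of "(True, P, R)"] by auto

lemma tree_RPR: "tree (False, P, R) \<Longrightarrow> tree (False, R, R @ P @ R)"
  using tree_intros(3)[of "(False, P, R)"] tree_intros(2)[of "(True, R, P)"] by auto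

text \<open>If \<open>R = P R0 P\<close>, then \<open>P^-1 R P^-1\<close> is the parent
  \<open>R0\<close>, and \<open>R^-1 P R^-1\<close> is the inverse of \<open>R P^-1 R\<close>, which
  lies below the sibling edge. At a root both words belong to the other half of the tree.\<close>

lemma pal_edge_up:
  assumes "tree (False, P, R)"
  shows "pal_edge P (winv P @ R @ winv P)" "pal_edge R (winv R @ P @ winv R)"
proof -
  have "pal_edge P (winv P @ R @ winv P) \<and> pal_edge R (winv R @ P @ winv R)"
    using assms
  proof (cases rule: tree_False_cases)
    case (1 b)
    have t: "tree (False, P, winv R)" using tree_intros(1)[of "\<not> b"] 1 by (simp add: farey_root_def)
    have "pal_edge P (winv (P @ winv R @ P))" by (intro pal_edge_winv(2) pal_edge_tree tree_PRP t)
    moreover have "pal_edge (winv (winv R)) (winv (winv R @ P @ winv R))"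
      by (intro pal_edge_winv pal_edge_tree tree_RPR t)
    moreover have "pal_edge R (winv R @ P @ winv R)"
      using pal_edge_winv(1)[OF pal_edge_tree[OF tree_RPR[OF t]]] by simp
    ultimately show ?thesis by simp
  next
    case (2 R0)
    have "pal_edge P (winv P @ R @ winv P)"
      by (rule pal_edge_weq[OF pal_edge_tree_True[OF 2(1)]]) (simp_all add: 2(2) weq_simps)
    moreover
    have "tree (True, R, winv P)" using tree_intros(3)[OF 2(1)] 2(2) by simp
    then have "pal_edge R (winv (R @ winv P @ R))"
      using tree_intros(2) by (fastforce intro: pal_edge_winv pal_edge_tree)
    then have "pal_edge R (winv R @ P @ winv R)" by simp
    ultimately show ?thesis by simp
  qed
  then show "pal_edge P (winv P @ R @ winv P)" "pal_edge R (winv R @ P @ winv R)" by auto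
qed

text \<open>After replacing \<open>P\<close> and \<open>R\<close> by the palindromes of a state up
  to sign, equal signs give the downward move and opposite signs the move of
  \<open>pal_edge_up\<close>.\<close>

lemma pal_edge_PRP: assumes "pal_edge P R" shows "pal_edge P (P @ R @ P)"
proof -
  have *: "pal_edge P (P @ R @ P)" if t: "pal_edge A (A @ B @ A)" "pal_edge A (winv A @ B @ winv A)"
    "pm P A" "pm R B" for A B
  proof -
    have "pal_edge (winv A) (winv A @ B @ winv A)" "pal_edge A (A @ winv B @ A)" 
      "pal_edge (winv A) (winv A @ winv B @ winv A)"
      using t(1,2) pal_edge_winv pal_edge_winv(2)[OF t(1)] pal_edge_winv(2)[OF t(2)] by auto
    moreover have "P @ R @ P \<doteq> A' @ B' @ A'" if "P \<doteq> A'" "R \<doteq> B'" for A' B'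
      using that by (intro weq_append)
    ultimately show ?thesis
      using t unfolding pm_def by (meson pal_edge_weq)
  qed
  show ?thesis
    using assms pal_edge_up tree_PRP tree_RPR unfolding pal_edge_def[of P R]
    by (metis * pal_edge_tree)
qed

text \<open>Up to simultaneous conjugation a pair of neighbouring regions consists of two
  palindromes, or of a palindrome \<open>P\<close> and \<open>P R\<close> or its inverse. Further
  sign changes and the exchange of \<open>P\<close> and \<open>R\<close> are absorbed by
  \<open>pal_edge\<close>, as \<open>(R, P R)\<close> is conjugate by \<open>R\<close> to
  \<open>(R, R P)\<close>. The list is made to be closed under Nielsen moves.\<close>

definition farey_pair :: "letter list \<Rightarrow> letter list \<Rightarrow> bool" where
  "farey_pair u v \<longleftrightarrow> (\<exists>g p q P R. pal_edge P R \<and>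
     (p, q) \<in> {(P, R), (P, P @ R), (P, winv (P @ R)), (P @ R, P), (winv (P @ R), P)} \<and>
     u \<doteq> g @ p @ winv g \<and> v \<doteq> g @ q @ winv g)"

lemma farey_pairI:
  assumes "pal_edge P R" "(p, q) \<in> {(P, R), (P, P @ R), (P, winv (P @ R)), (P @ R, P), (winv (P @ R), P)}"
    "u \<doteq> g @ p @ winv g" "v \<doteq> g @ q @ winv g"
  shows "farey_pair u v"
  using assms unfolding farey_pair_def by blast

lemma farey_pair_conj:
  assumes "farey_pair u v" "u' \<doteq> h @ u @ winv h" "v' \<doteq> h @ v @ winv h" shows "farey_pair u' v'"
proof -
  from assms(1) obtain g p q P R where *: "pal_edge P R"
    "(p, q) \<in> {(P, R), (P, P @ R), (P, winv (P @ R)), (P @ R, P), (winv (P @ R), P)}"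
    "u \<doteq> g @ p @ winv g" "v \<doteq> g @ q @ winv g" unfolding farey_pair_def by blast
  show ?thesis
    by (rule farey_pairI[OF *(1,2), of _ "h @ g"]) (use *(3,4) assms in \<open>simp_all add: weq_simps\<close>)
qed

lemma farey_pair_weq: "farey_pair u v \<Longrightarrow> u' \<doteq> u \<Longrightarrow> v' \<doteq> v \<Longrightarrow> farey_pair u' v'"
  using farey_pair_conj[of u v u' "[]" v'] by simp

lemma farey_pair_swap: assumes "farey_pair u v" shows "farey_pair v u"
proof -
  from assms obtain g p q P R where *: "pal_edge P R"
    "(p, q) \<in> {(P, R), (P, P @ R), (P, winv (P @ R)), (P @ R, P), (winv (P @ R), P)}"
    "u \<doteq> g @ p @ winv g" "v \<doteq> g @ q @ winv g" unfolding farey_pair_def by blast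
  show ?thesis
  proof (cases "(p, q) = (P, R)")
    case True
    then show ?thesis using * by (intro farey_pairI[OF pal_edge_swap[OF *(1)], of q p _ g]) auto
  next
    case False
    then show ?thesis using * by (intro farey_pairI[OF *(1), of q p _ g]) auto
  qed
qed

lemma farey_pair_winv: assumes "farey_pair u v" shows "farey_pair (winv u) v"
proof -
  from assms obtain g p q P R where *: "pal_edge P R"
    "(p, q) \<in> {(P, R), (P, P @ R), (P, winv (P @ R)), (P @ R, P), (winv (P @ R), P)}"
    "u \<doteq> g @ p @ winv g" "v \<doteq> g @ q @ winv g" unfolding farey_pair_def by blast
  note u = weq_winv[OF *(3)]
  have i: "pal_edge (winv P) (winv R)" using *(1) pal_edge_winv by blast
  from *(2) consider "p = P" "q = R" | "p = P" "q = P @ R" | "p = P" "q = winv (P @ R)"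
    | "p = P @ R" "q = P" | "p = winv (P @ R)" "q = P" by auto
  then show ?thesis
  proof cases
    case 1
    then show ?thesis
      by (intro farey_pairI[OF pal_edge_winv(1)[OF *(1)], of "winv P" R _ g]) (use * u in auto)
  next
    case 2
    show ?thesis
      by (rule farey_pairI[OF i, of "winv P" "winv (winv P @ winv R)" _ "g @ P"])
        (use * u 2 in \<open>simp_all add: weq_simps\<close>)
  next
    case 3
    show ?thesis
      by (rule farey_pairI[OF i, of "winv P" "winv P @ winv R" _ "g @ P"])
        (use * u 3 in \<open>simp_all add: weq_simps\<close>)
  next
    case 4
    show ?thesis
      by (rule farey_pairI[OF *(1), of "winv (P @ R)" P _ g]) (use * u 4 in \<open>simp_all add: weq_simps\<close>)
  next
    case 5
    show ?thesis
      by (rule farey_pairI[OF *(1), of "P @ R" P _ g]) (use * u 5 in \<open>simp_all add: weq_simps\<close>)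
  qed
qed

text \<open>Each case is a change of the palindromic pair. For instance \<open>(P, P P R)\<close> is
  conjugate by \<open>P\<close> to \<open>(P, P R P)\<close>, two palindromes again.\<close>

lemma farey_pair_mult: assumes "farey_pair u v" shows "farey_pair u (u @ v)"
proof -
  from assms obtain g p q P R where *: "pal_edge P R"
    "(p, q) \<in> {(P, R), (P, P @ R), (P, winv (P @ R)), (P @ R, P), (winv (P @ R), P)}"
    "u \<doteq> g @ p @ winv g" "v \<doteq> g @ q @ winv g" unfolding farey_pair_def by blast
  from *(2) consider "p = P" "q = R" | "p = P" "q = P @ R" | "p = P" "q = winv (P @ R)"
    | "p = P @ R" "q = P" | "p = winv (P @ R)" "q = P" by auto
  then show ?thesis
  proof cases
    case 1
    show ?thesis
      by (rule farey_pairI[OF *(1), of P "P @ R" _ g]) (use * 1 in \<open>simp_all add: weq_simps\<close>)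
  next
    case 2
    show ?thesis
      by (rule farey_pairI[OF pal_edge_PRP[OF *(1)], of P "P @ R @ P" _ "g @ P"])
        (use * 2 in \<open>simp_all add: weq_simps\<close>)
  next
    case 3
    show ?thesis
      by (rule farey_pairI[OF pal_edge_winv(2)[OF *(1)], of P "winv R" _ "g @ P"])
        (use * 3 in \<open>simp_all add: weq_simps\<close>)
  next
    case 4
    have "pal_edge (P @ R @ P) (winv P)"
      by (rule pal_edge_winv(2)[OF pal_edge_swap[OF pal_edge_PRP[OF *(1)]]])
    then show ?thesis
      by (rule farey_pairI[of "P @ R @ P" "winv P" "(P @ R @ P) @ winv P" "P @ R @ P" _ g])
        (use * 4 in \<open>simp_all add: weq_simps\<close>)
  next
    case 5
    have "pal_edge (winv R) (winv P)"
      by (rule pal_edge_winv(1)[OF pal_edge_winv(2)[OF pal_edge_swap[OF *(1)]]])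
    then show ?thesis
      by (rule farey_pairI[of "winv R" "winv P" "winv R @ winv P" "winv R" _ g])
        (use * 5 in \<open>simp_all add: weq_simps\<close>)
  qed
qed

lemma farey_pair_mult_iff: "farey_pair u (u @ v) \<longleftrightarrow> farey_pair u v"
proof
  assume "farey_pair u (u @ v)"
  then have "farey_pair (winv u) (winv u @ u @ v)" by (rule farey_pair_mult[OF farey_pair_winv])
  then have "farey_pair (winv u) v" by (rule farey_pair_weq) (simp_all add: weq_simps)
  then have "farey_pair (winv (winv u)) v" by (rule farey_pair_winv)
  then show "farey_pair u v" by simp
qed (rule farey_pair_mult)

lemma farey_pair_letter:
  assumes "fst l \<noteq> fst m"
  shows "farey_pair (subst_letter u v l) (subst_letter u v m) \<longleftrightarrow> farey_pair u v"
proof -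
  have w1: "farey_pair (winv u) v \<longleftrightarrow> farey_pair u v" for u v
    using farey_pair_winv[of "winv u" v] farey_pair_winv[of u v] by auto
  have sw: "farey_pair v u \<longleftrightarrow> farey_pair u v" for u v using farey_pair_swap by blast
  have w2: "farey_pair u (winv v) \<longleftrightarrow> farey_pair u v" for u v using w1 sw by blast
  show ?thesis using assms w1 w2 sw
    by (cases l; cases m; cases "fst l"; cases "fst m"; cases "snd l"; cases "snd m") auto
qed

lemma farey_pair_mult_right_iff: "farey_pair (u @ v) v \<longleftrightarrow> farey_pair u v"
proof -
  have "farey_pair (u @ v) v \<longleftrightarrow> farey_pair (winv v) (winv v @ winv u)"
    using farey_pair_letter[of "(Y, False)" "(X, False)" "u @ v" v] by simp
  also have "\<dots> \<longleftrightarrow> farey_pair u v"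
    using farey_pair_mult_iff[of "winv v" "winv u"] farey_pair_letter[of "(Y, False)" "(X, False)" u v]
    by simp
  finally show ?thesis .
qed

section \<open>Nielsen reduction of generating pairs\<close>

definition generates :: "letter list \<Rightarrow> letter list \<Rightarrow> bool" where
  "generates u v \<longleftrightarrow> (\<forall>w. \<exists>s. subst u v s \<doteq> w)"

lemma generates_mono:
  assumes "generates u v" "subst u' v' s \<doteq> u" "subst u' v' t \<doteq> v" shows "generates u' v'"
  unfolding generates_def
proof
  fix w
  obtain r where "subst u v r \<doteq> w" using assms(1) unfolding generates_def by blast
  moreover have "subst u' v' (subst s t r) \<doteq> subst u v r"
    unfolding subst_subst using assms(2,3) by (rule weq_subst_pair)
  ultimately show "\<exists>s. subst u' v' s \<doteq> w" using weq_trans by blast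
qed

lemma generates_letter:
  assumes "generates u v" "fst l \<noteq> fst m"
  shows "generates (subst_letter u v l) (subst_letter u v m)"
proof (rule generates_mono[OF assms(1)])
  let ?f = "\<lambda>g. if fst l = g then [(X, snd l)] else [(Y, snd m)]"
  show "subst (subst_letter u v l) (subst_letter u v m) (?f X) \<doteq> u"
    "subst (subst_letter u v l) (subst_letter u v m) (?f Y) \<doteq> v"
    using assms(2) by (cases l; cases m; cases "fst l"; cases "fst m"; cases "snd l"; cases "snd m"; simp)+
qed

lemma generates_nonempty: assumes "generates u v" shows "subst_letter u v l \<noteq> []"
proof -
  have "u \<noteq> []" using generates_parity[of u v] assms by (auto simp: generates_def)
  moreover have "generates v u" using generates_letter[OF assms, of "(Y, True)" "(X, True)"] by simp
  then have "v \<noteq> []" using generates_parity[of v u] by (auto simp: generates_def)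
  ultimately show ?thesis by (simp add: subst_letter_def Let_def split: gen.split)
qed

lemma length_subst_letters:
  "fst l \<noteq> fst m \<Longrightarrow> length (subst_letter u v l) + length (subst_letter u v m) = length u + length v"
  by (cases "fst l"; cases "fst m") (auto simp: subst_letter_def)

lemma farey_pair_std: "farey_pair [(X, True)] [(Y, True)]"
proof (rule farey_pairI[of "[(X, True)]" "[(Y, True)]" "[(X, True)]" "[(Y, True)]" _ "[]"])
  show "pal_edge [(X, True)] [(Y, True)]"
    using tree_intros(1)[of True] by (intro pal_edge_tree) (simp add: farey_root_def)
qed simp_all

text \<open>Induction on the total length. A pair that some product shortens is replaced; a pair
  satisfying Nielsen's condition consists of the two generators up to sign and order. What remains
  is a factor cancelled exactly half by each neighbour, and a conjugation shortens the pair
  there.\<close>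

theorem generates_farey_pair:
  assumes "generates u v" "reduced u" "reduced v"
  shows "farey_pair u v"
  using assms
proof (induction "length u + length v" arbitrary: u v rule: less_induct)
  case less
  let ?L = "subst_letter u v"
  note red [simp] = reduced_subst_letter[OF less.prems(2,3)]
  have IH: "farey_pair p q" if "length (reduce p) + length (reduce q) < length u + length v" "generates p q" for p q
  proof -
    have "generates (reduce p) (reduce q)"
      by (rule generates_mono[OF that(2), of _ _ "[(X, True)]" "[(Y, True)]"]) simp_all
    then have "farey_pair (reduce p) (reduce q)" using less.hyps[of "reduce p" "reduce q"] that by simp
    then show ?thesis by (rule farey_pair_weq) simp_all
  qed
  \<comment> \<open>If more than half of one factor cancels, the product is shorter than the other
    factor and may replace it.\<close>
  have half: "farey_pair u v \<or> 2 * canc (?L l) (?L m) \<le> length (?L l) \<and> 2 * canc (?L l) (?L m) \<le> length (?L m)"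
    if "fst l \<noteq> fst m" for l m
  proof -
    let ?x = "?L l" and ?y = "?L m"
    have gen: "generates ?x ?y" using generates_letter[OF less.prems(1) that] .
    note len = length_reduce_append(1)[of ?x ?y] length_subst_letters[OF that, of u v]
    have "farey_pair u v" if "2 * canc ?x ?y > length ?x"
    proof -
      have "generates ?x (?x @ ?y)"
        by (rule generates_mono[OF gen, of _ _ "[(X, True)]" "[(X, False), (Y, True)]"])
          (simp_all add: weq_simps)
      then have "farey_pair ?x (?x @ ?y)" using that len by (intro IH) (simp_all add: reduce_reduced)
      then show ?thesis using farey_pair_mult_iff farey_pair_letter[OF \<open>fst l \<noteq> fst m\<close>] by blast
    qed
    moreover have "farey_pair u v" if "2 * canc ?x ?y > length ?y"
    proof -
      have "generates (?x @ ?y) ?y"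
        by (rule generates_mono[OF gen, of _ _ "[(X, True), (Y, False)]" "[(Y, True)]"])
          (simp_all add: weq_simps)
      then have "farey_pair (?x @ ?y) ?y" using that len by (intro IH) (simp_all add: reduce_reduced)
      then show ?thesis using farey_pair_mult_right_iff farey_pair_letter[OF \<open>fst l \<noteq> fst m\<close>] by blast
    qed
    ultimately show ?thesis by linarith
  qed
  show ?case
  proof (cases "\<forall>l m n. m \<noteq> inv_letter l \<longrightarrow> n \<noteq> inv_letter m \<longrightarrow> canc (?L l) (?L m) + canc (?L m) (?L n) < length (?L m)")
    case True
    \<comment> \<open>Under Nielsen's condition an element of length 1 can only be the value of a
      word of at most one letter.\<close>
    have single: "\<exists>l. ?L l = [a]" for a
    proof -
      obtain s where "subst u v s \<doteq> [a]" using less.prems(1) unfolding generates_def by blast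
      then have s: "subst u v (reduce s) \<doteq> [a]" using weq_subst[OF reduce_weq(1)] weq_trans by blast
      then have r: "reduce (subst u v (reduce s)) = [a]" by (simp add: weq_iff_reduce reduce_reduced)
      have "length (reduce s) \<le> length (reduce (subst u v (reduce s)))"
        by (rule length_subst_ge) (use True less.prems in auto)
      then consider "reduce s = []" | l where "reduce s = [l]"
        using r by (cases "reduce s") auto
      then show ?thesis
      proof cases
        case 1
        then show ?thesis using r by (simp add: reduce_def)
      next
        case (2 l)
        then show ?thesis using r by (intro exI[of _ l]) (simp add: reduce_reduced)
      qed
    qed
    obtain l m where lm: "?L l = [(X, True)]" "?L m = [(Y, True)]" using single by meson
    have "fst l \<noteq> fst m"
    proof
      assume "fst l = fst m"
      then have "m = l \<or> m = inv_letter l" by (auto simp: inv_letter_def prod_eq_iff)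
      then show False using lm by (auto simp: subst_letter_inv)
    qed
    then show ?thesis using farey_pair_letter[of l m u v] lm farey_pair_std by simp
  next
    case False
    then obtain l m n where lmn: "m \<noteq> inv_letter l" "n \<noteq> inv_letter m"
      "canc (?L l) (?L m) + canc (?L m) (?L n) \<ge> length (?L m)" unfolding not_all not_imp not_less by blast
    let ?x = "?L l" and ?y = "?L m" and ?z = "?L n"
    show ?thesis
    proof (rule ccontr)
      assume nf: "\<not> farey_pair u v"
      have ne: "?y \<noteq> []" using generates_nonempty[OF less.prems(1)] .
      have same: "fst k = fst k' \<Longrightarrow> k' \<noteq> inv_letter k \<Longrightarrow> k = k'" for k k'
        by (auto simp: inv_letter_def prod_eq_iff)
      have lm: "2 * canc ?x ?y \<le> length ?y \<and> (fst l = fst m \<longrightarrow> 2 * canc ?x ?y < length ?y)"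
        using half[of l m] nf same[of l m] lmn canc_self[of ?y] ne by (cases "fst l = fst m") auto
      have mn: "2 * canc ?y ?z \<le> length ?y \<and> (fst m = fst n \<longrightarrow> 2 * canc ?y ?z < length ?y)"
        using half[of m n] nf same[of m n] lmn canc_self[of ?y] ne by (cases "fst m = fst n") auto
      \<comment> \<open>Neither neighbour cancels more than half, yet together they cancel
        everything; so both cancel exactly half, and neither equals the middle factor.\<close>
      have c: "2 * canc ?x ?y = length ?y" "2 * canc ?y ?z = length ?y"
        using lm mn lmn(3) by linarith+
      then have f: "fst l \<noteq> fst m" "fst m \<noteq> fst n" using lm mn by (metis less_irrefl)+
      have x2: "length ?y \<le> length ?x" using half[OF f(1)] nf c by auto
      obtain p r q where d1: "?x = p @ r" "?y = winv r @ q" "length r = canc ?x ?y"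
        using canc_decomposition[of ?x ?y] by auto
      obtain p' r' q' where d2: "?y = p' @ r'" "?z = winv r' @ q'" "length r' = canc ?y ?z"
        using canc_decomposition[of ?y ?z] by auto
      have len: "length ?y = length p' + length r'" "length ?y = length r + length q"
        using arg_cong[OF d2(1), of length] arg_cong[OF d1(2), of length] by simp_all
      have lr: "length r = length r'" using d1(3) d2(3) c by simp
      have "length p' = length (winv r)" using len d1(3) d2(3) c by simp
      moreover have "winv r @ q = p' @ r'" using d1(2) d2(1) by simp
      ultimately have y: "q = r'" by simp
      have "fst l = fst n" using f by (metis gen.exhaust)
      then consider "n = inv_letter l" | "n = l" using same[of l n] by auto
      then show False
      proof cases
        case 1
        then have "?z = winv ?x" by (simp add: subst_letter_inv)
        then have "winv r' @ q' = winv r @ winv p" using d1(1) d2(2) by simp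
        then have "r' = r" using lr by simp
        then have "?y \<doteq> []" using d1(2) y by (simp add: weq_simps)
        then show False using ne weq_reduced[of ?y "[]"] by simp
      next
        case 2
        then have e: "p @ r = winv r' @ q'" using d1 d2 by simp
        have "length p \<ge> length (winv r')" using d1 x2 c d2 by (simp add: lr[symmetric])
        then obtain k where k: "p = winv r' @ k" using e by (metis append_eq_append_conv_if append_eq_conv_conj)
        \<comment> \<open>Conjugation by \<open>r\<close> turns \<open>y\<close> into
          \<open>r' r^-1\<close> and \<open>y x\<close> into \<open>k\<close>. This pair still
          generates and is shorter by \<open>length r + length r'\<close>.\<close>
        have x: "?x = winv r' @ k @ r" using d1 k by simp
        have yy: "?y = winv r @ r'" using d1 y by simp
        have gen: "generates ?y ?x" using generates_letter[OF less.prems(1), of m l] f by auto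
        have "generates (r' @ winv r) k"
        proof (unfold generates_def, intro allI)
          fix w
          obtain s where s: "subst ?y ?x s \<doteq> winv r @ w @ r" using gen unfolding generates_def by blast
          have "subst (r' @ winv r) k (subst [(X, True)] [(X, False), (Y, True)] s) \<doteq> subst (r @ ?y @ winv r) (r @ ?x @ winv r) s"
            unfolding subst_subst by (intro weq_subst_pair) (simp_all add: x yy weq_simps)
          also have "\<dots> \<doteq> r @ subst ?y ?x s @ winv r" by (rule subst_conj)
          also have "\<dots> \<doteq> w" using s by (simp add: weq_simps)
          finally show "\<exists>s. subst (r' @ winv r) k s \<doteq> w" by blast
        qed
        moreover have "length (reduce (r' @ winv r)) + length (reduce k) < length u + length v"
        proof -
          have le: "length (reduce w) \<le> length w" for w
          proof (induction w)
            case (Cons a w)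
            have "length (push a z) \<le> Suc (length z)" for z by (cases z) auto
            then show ?case using Cons le_trans by (fastforce simp: reduce_def)
          qed (simp add: reduce_def)
          have "length u + length v = length ?x + length ?y" using length_subst_letters[OF f(1)] by simp
          also have "\<dots> = length r' + length k + length r + (length r + length r')" by (simp add: x yy)
          finally have "length u + length v = length r' + length k + length r + (length r + length r')" .
          moreover have "length r' > 0" using ne yy lr by auto
          moreover have "length (reduce (r' @ winv r)) \<le> length r' + length r" using le[of "r' @ winv r"] by simp
          ultimately show ?thesis using le[of k] lr by linarith
        qed
        ultimately have "farey_pair (r' @ winv r) k" by (intro IH)
        then have "farey_pair ?y (?y @ ?x)"
          by (rule farey_pair_conj[of _ _ _ "winv r"]) (simp_all add: x yy weq_simps)
        then show False using farey_pair_mult_iff farey_pair_letter[of m l u v] f nf by metis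
      qed
    qed
  qed
qed

section \<open>Palindromic primitive elements\<close>

lemma tree_pal: "tree (k, P, R) \<Longrightarrow> rev P = P \<and> rev R = R"
proof -
  have "case s of (k, P, R) \<Rightarrow> rev P = P \<and> rev R = R" if "tree s" for s
    using that
  proof (induction rule: tree_induct)
    case (left t) then show ?case by (cases t rule: left.cases) auto
  next
    case (right t) then show ?case by (cases t rule: right.cases) (auto simp: rev_winv)
  qed (simp add: farey_root_def)
  then show "tree (k, P, R) \<Longrightarrow> rev P = P \<and> rev R = R" by force
qed

text \<open>The palindromes of a state occupy the parity classes (1,0) and (0,1) in some order, as
  the moves change exponent sums of one member only by even amounts.\<close>

lemma tree_parity:
  "tree (k, P, R) \<Longrightarrow> odd (wt 1 0 P) \<and> even (wt 0 1 P) \<and> even (wt 1 0 R) \<and> odd (wt 0 1 R) \<or>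
     even (wt 1 0 P) \<and> odd (wt 0 1 P) \<and> odd (wt 1 0 R) \<and> even (wt 0 1 R)"
proof -
  have "case s of (k, P, R) \<Rightarrow> odd (wt 1 0 P) \<and> even (wt 0 1 P) \<and> even (wt 1 0 R) \<and> odd (wt 0 1 R) \<or>
     even (wt 1 0 P) \<and> odd (wt 0 1 P) \<and> odd (wt 1 0 R) \<and> even (wt 0 1 R)" if "tree s" for s
    using that
  proof (induction rule: tree_induct)
    case (left t) then show ?case by (cases t rule: left.cases) auto
  next
    case (right t) then show ?case by (cases t rule: right.cases) auto
  qed (simp add: farey_root_def)
  then show "tree (k, P, R) \<Longrightarrow> odd (wt 1 0 P) \<and> even (wt 0 1 P) \<and> even (wt 1 0 R) \<and> odd (wt 0 1 R) \<or>
     even (wt 1 0 P) \<and> odd (wt 0 1 P) \<and> odd (wt 1 0 R) \<and> even (wt 0 1 R)" by force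
qed

lemma basis_PRP: assumes "basis P R" shows "basis P (P @ R @ P)" "basis (P @ R @ P) (winv P)"
proof -
  have "basis [(X, True)] [(X, True), (Y, True), (X, True)]"
    by (rule basisI_inverse[of _ _ "[(X, True)]" "[(X, False), (Y, True), (X, False)]"])
      (auto simp: weq_iff_reduce reduce_def)
  from basis_subst[OF assms this] show *: "basis P (P @ R @ P)" by simp
  show "basis (P @ R @ P) (winv P)" by (rule basis_moves(1)[OF basis_moves(2)[OF *]])
qed

lemma tree_basis: "tree (k, P, R) \<Longrightarrow> basis P R"
proof -
  have "case s of (k, P, R) \<Rightarrow> basis P R" if "tree s" for s
    using that
  proof (induction rule: tree_induct)
    case (root b)
    have "basis [(Y, True)] [(X, True)]" "basis [(Y, False)] [(X, True)]"
      using basis_moves(1)[OF basis_std] basis_moves(2)[OF basis_moves(1)[OF basis_std]] by simp_all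
    then have "basis [(Y, b)] [(X, True)]" by (cases b) simp_all
    then show ?case by (simp add: farey_root_def basis_moves(1))
  next
    case (left t) then show ?case by (cases t rule: left.cases) (auto intro: basis_PRP)
  next
    case (right t) then show ?case by (cases t rule: right.cases) (auto intro: basis_PRP(2) basis_moves(1))
  qed
  then show "tree (k, P, R) \<Longrightarrow> basis P R" by force
qed

text \<open>In even length both exponent sums are even, the two halves contributing equally; in odd
  length their sum is odd.\<close>

lemma palindrome_parity: assumes "rev w = w" shows "\<not> (odd (wt 1 0 w) \<and> odd (wt 0 1 w))"
proof (cases "even (length w)")
  case True
  let ?n = "length w div 2"
  have "w = take ?n w @ drop ?n w" by simp
  moreover have "drop ?n w = rev (take ?n w)"
  proof -
    have "rev (take ?n w) = drop (length w - ?n) w" using assms by (simp add: rev_take)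
    moreover have "length w - ?n = ?n" using True by auto
    ultimately show ?thesis by simp
  qed
  ultimately have "w = take ?n w @ rev (take ?n w)" by simp
  then have "wt i j w = 2 * wt i j (take ?n w)" for i j by (metis mult_2 wt_rev wt_simps(3))
  then show ?thesis by simp
next
  case False
  have "even (wt 1 0 w + wt 0 1 w) = even (length w)" for w
    by (induction w) (auto split: gen.split)
  then show ?thesis using False by (metis even_add)
qed

lemma weq_cancel_letter: "l # inv_letter l # z \<doteq> z"
  by (simp add: weq_simps push_push_inv)

text \<open>The centraliser of a generator consists of its powers. If \<open>s\<close> starts with a
  letter other than \<open>l\<close> and its inverse, then \<open>l s\<close> is reduced and its
  first letter contradicts that of \<open>s l\<close>.\<close>

lemma commute_letter:
  assumes "reduced s" "l # s \<doteq> s @ [l]"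
  shows "\<exists>n. s = replicate n l \<or> s = replicate n (inv_letter l)"
  using assms
proof (induction s)
  case (Cons c t)
  have t: "reduced t" using Cons.prems(1) by (simp add: reduced_Cons)
  show ?case
  proof (cases "c = l \<or> c = inv_letter l")
    case True
    have "l # t \<doteq> [inv_letter c] @ (l # c # t)"
      using True push_push_inv[OF reduced_foldr_push] push_push_inv[of _ "inv_letter l"]
      by (auto simp: weq_simps push_push_inv reduced_push)
    also have "\<dots> \<doteq> [inv_letter c] @ ((c # t) @ [l])"
      using Cons.prems(2) by (intro weq_append weq_refl)
    also have "\<dots> \<doteq> t @ [l]"
      using push_push_inv[of _ "inv_letter c"] by (auto simp: weq_simps reduced_push)
    finally obtain n where n: "t = replicate n l \<or> t = replicate n (inv_letter l)"
      using Cons.IH t by blast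
    show ?thesis
    proof (cases n)
      case 0
      then show ?thesis using True n by (intro exI[of _ 1]) auto
    next
      case (Suc m)
      then have "t \<noteq> []" using n by auto
      then have "hd t \<noteq> inv_letter c" using Cons.prems(1) reduced_append_iff[of "[c]" t] by simp
      then have "t = replicate n c" using True n Suc by (auto simp: inv_letter_commute)
      then have "c # t = replicate (Suc n) c" by simp
      then show ?thesis using True by blast
    qed
  next
    case False
    then have "reduced (l # c # t)" using Cons.prems(1) by (simp add: reduced_Cons)
    then have r: "reduce ((c # t) @ [l]) = l # c # t"
      using Cons.prems(2) by (simp add: weq_iff_reduce reduce_reduced)
    obtain p r q where d: "c # t = p @ r" "[l] = winv r @ q" "reduced (p @ q)"
      using canc_decomposition[OF Cons.prems(1), of "[l]"] by auto
    have "(c # t) @ [l] \<doteq> p @ q" unfolding d(1,2) by (simp add: weq_simps)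
    then have "p @ q = l # c # t" using r d(3) by (simp add: weq_iff_reduce reduce_reduced)
    moreover have "length (p @ q) + 2 * length r = length (c # t) + 1"
    proof -
      have "length (c # t) = length p + length r" using arg_cong[OF d(1), of length] by simp
      moreover have "1 = length r + length q" using arg_cong[OF d(2), of length] by simp
      ultimately show ?thesis unfolding length_append by linarith
    qed
    ultimately have "r = []" by (cases r) auto
    then have "c # t @ [l] = l # c # t" using d \<open>p @ q = l # c # t\<close> by auto
    then show ?thesis using False by simp
  qed
qed (auto intro: exI[of _ 0])

text \<open>Reversing \<open>w = g M g^-1\<close> gives a second conjugation, and comparing the two
  shows that \<open>g (rev g)\<close> commutes with \<open>w\<close>. Being primitive,
  \<open>w\<close> generates its centraliser, and parity makes the exponent even, so
  \<open>g (rev g) = h^2\<close> with a palindromic power \<open>h\<close> of \<open>w\<close>.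
  Dividing \<open>g\<close> by \<open>h\<close> leaves a conjugator equal to its letterwise inverse,
  hence trivial.\<close>

lemma palindrome_conj:
  assumes "basis w v" "rev w = w" "rev M = M" "w \<doteq> g @ M @ winv g"
  shows "w \<doteq> M"
proof -
  \<comment> \<open>As an element of the group this is \<open>g (rev g)\<close>.\<close>
  let ?k = "g @ (rev g @ g) @ winv g"
  have wr: "w \<doteq> winv (rev g) @ M @ rev g"
    using weq_rev[OF assms(4)] assms(2,3) by (simp add: rev_winv)
  have Mw: "M \<doteq> winv g @ w @ g" using assms(4) by (simp add: weq_simps)
  have "w @ ?k \<doteq> ?k @ w"
  proof -
    have "rev g @ w \<doteq> M @ rev g" using wr by (simp add: weq_simps)
    then have "(rev g @ w) @ winv (rev g) @ rev g @ g @ winv g \<doteq> (M @ rev g) @ winv (rev g) @ rev g @ g @ winv g"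
      by (rule weq_append) (rule weq_refl)
    then have 1: "g @ (rev g @ w) @ winv (rev g) @ rev g @ g @ winv g \<doteq> g @ (M @ rev g) @ winv (rev g) @ rev g @ g @ winv g"
      by (rule weq_append[OF weq_refl])
    have "w @ ?k \<doteq> g @ M @ rev g @ g @ winv g" using assms(4) by (simp add: weq_simps)
    also have "\<dots> \<doteq> g @ (rev g @ w) @ winv (rev g) @ rev g @ g @ winv g"
      using 1 by (simp add: weq_simps)
    also have "\<dots> \<doteq> ?k @ w" by (simp add: weq_simps)
    finally show ?thesis .
  qed
  obtain s where "subst w v s \<doteq> ?k" using basis_surj[OF assms(1)] by blast
  then have s: "subst w v (reduce s) \<doteq> ?k" using weq_subst[OF reduce_weq(1)] weq_trans by blast
  have "subst w v ((X, True) # reduce s) \<doteq> w @ ?k" using s by (simp add: weq_append)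
  also have "\<dots> \<doteq> ?k @ w" by fact
  also have "\<dots> \<doteq> subst w v (reduce s) @ w" by (intro weq_append weq_sym[OF s] weq_refl)
  also have "\<dots> = subst w v (reduce s @ [(X, True)])" by simp
  finally have "(X, True) # reduce s \<doteq> reduce s @ [(X, True)]" by (rule basis_inj[OF assms(1)])
  from commute_letter[OF _ this] obtain n b where n: "reduce s = replicate n (X, b)" by auto
  have "even (int n * wt i j w)" for i j
  proof -
    have "wt 1 0 (replicate n (X, b)) = (if b then int n else - int n)" "wt 0 1 (replicate n (X, b)) = 0"
      by (induction n) auto
    then have "wt i j (subst w v (reduce s)) = (if b then int n else - int n) * wt i j w"
      by (simp add: wt_subst n)
    moreover have "wt i j (subst w v (reduce s)) = 2 * wt i j g" using weq_wt[OF s, of i j] by simp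
    ultimately have "(if b then int n else - int n) * wt i j w = 2 * wt i j g" by simp
    then have "even ((if b then int n else - int n) * wt i j w)" by simp
    then show ?thesis by (cases b) auto
  qed
  \<comment> \<open>The exponent sums of \<open>g (rev g)\<close> are even while one exponent sum of
    \<open>w\<close> is odd.\<close>
  then have "even n" using basis_parity[OF assms(1)] by auto
  then obtain m where m: "n = m + m" by (metis evenE mult_2)
  define h where "h = subst w v (replicate m (X, b))"
  have hh: "?k \<doteq> h @ h" using weq_sym[OF s] unfolding n m replicate_add h_def by simp
  have "subst w v (rev t) = rev (subst w v t)" if "set t \<subseteq> {(X, b)}" for t
    using that assms(2) by (induction t) (auto simp: subst_letter_def rev_winv)
  from this[of "replicate m (X, b)"] have rh: "rev h = h" by (simp add: h_def set_replicate_conv_if)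
  have "subst w v (replicate m (X, b) @ [(X, True)]) \<doteq> subst w v ((X, True) # replicate m (X, b))"
  proof (rule weq_subst)
    show "replicate m (X, b) @ [(X, True)] \<doteq> (X, True) # replicate m (X, b)"
    proof (induction m)
      case (Suc m)
      have "replicate (Suc m) (X, b) @ [(X, True)] = [(X, b)] @ (replicate m (X, b) @ [(X, True)])" by simp
      also have "\<dots> \<doteq> [(X, b)] @ (X, True) # replicate m (X, b)" by (intro weq_append weq_refl Suc)
      also have "\<dots> \<doteq> [(X, True)] @ (X, b) # replicate m (X, b)"
        using weq_cancel_letter[of "(X, True)"] weq_trans[OF weq_cancel_letter[of "(X, False)"] weq_sym]
        by (cases b) auto
      finally show ?case by simp
    qed simp
  qed
  then have hw: "h @ w \<doteq> w @ h" by (simp add: h_def)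
  define f where "f = winv h @ g"
  have wf: "w \<doteq> f @ M @ winv f"
  proof -
    have "w \<doteq> winv h @ (h @ w)" by (simp add: weq_simps)
    also have "\<dots> \<doteq> winv h @ (w @ h)" by (intro weq_append weq_refl hw)
    also have "\<dots> \<doteq> f @ M @ winv f" using assms(4) by (simp add: f_def weq_simps)
    finally show ?thesis .
  qed
  \<comment> \<open>Since \<open>h\<close> is a palindrome, \<open>rev f\<close> is
    \<open>(rev g) h^-1\<close>, and the product telescopes by
    \<open>h^2 = g (rev g)\<close>.\<close>
  have "rev f @ f \<doteq> rev g @ winv (h @ h) @ g" using rh by (simp add: f_def rev_winv)
  also have "\<dots> \<doteq> rev g @ winv ?k @ g" by (intro weq_append weq_refl weq_winv weq_sym[OF hh])
  also have "\<dots> \<doteq> []" by (simp add: weq_simps)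
  finally have "winv (rev f) @ (rev f @ f) \<doteq> winv (rev f) @ []" by (intro weq_append weq_refl)
  then have "f \<doteq> winv (rev f)" by (simp add: weq_simps)
  then have "f \<doteq> map inv_letter f" by (simp add: winv_def)
  then have "reduce f = map inv_letter (reduce f)"
    unfolding map_inv_reduce by (simp add: weq_iff_reduce)
  then have "f \<doteq> []" using map_inv_fixed[of "reduce f"] by (simp add: weq_iff_reduce reduce_reduced)
  then have "f @ M @ winv f \<doteq> [] @ M @ winv []" by (intro weq_append weq_winv weq_refl)
  then show ?thesis using wf weq_trans by auto
qed

text \<open>Nielsen reduction places a conjugate of \<open>w\<close> in the list of
  \<open>farey_pair\<close>; parity excludes \<open>P R\<close>, so \<open>w\<close> is conjugate to
  a palindrome of the tree and therefore equal to it up to inversion.\<close>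

theorem palindromic_primitive_in_tree:
  assumes "w \<in> primitives" "rev w = w"
  shows "\<exists>k P R. tree (k, P, R) \<and> pm w P"
proof -
  from assms(1) obtain v where b: "basis w v" and r: "reduced w" by (auto simp: primitives_altdef)
  have b': "basis w (reduce v)" using b basis_weq by (meson reduce_weq(2) weq_refl)
  then have "farey_pair w (reduce v)"
    using r basis_surj by (intro generates_farey_pair) (auto simp: generates_def)
  then obtain g p q P R where *: "pal_edge P R"
    "(p, q) \<in> {(P, R), (P, P @ R), (P, winv (P @ R)), (P @ R, P), (winv (P @ R), P)}"
    "w \<doteq> g @ p @ winv g" unfolding farey_pair_def by blast
  from *(1) obtain P' R' where t: "tree (False, P', R')" and pm: "pm P P' \<and> pm R R' \<or> pm P R' \<and> pm R P'"
    by (auto simp: pal_edge_def)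
  have pmwt: "even (wt i j u) = even (wt i j v)" if "pm u v" for u v i j
    using that weq_wt[of u v i j] weq_wt[of u "winv v" i j] by (auto simp: pm_def)
  have "odd (wt 1 0 (P @ R)) \<and> odd (wt 0 1 (P @ R))"
    using tree_parity[OF t] pm pmwt by auto
  moreover have "wt i j w = wt i j p" for i j using weq_wt[OF *(3), of i j] by simp
  ultimately have "p = P" using palindrome_parity[OF assms(2)] *(2) by auto
  moreover have "\<exists>k P1 R1. tree (k, P1, R1) \<and> pm P P1"
    using pm t tree_intros(3)[OF t] by auto
  then obtain k P1 R1 where P1: "tree (k, P1, R1)" "pm P P1" by blast
  moreover obtain M where M: "M = P1 \<or> M = winv P1" "P \<doteq> M" using P1(2) by (auto simp: pm_def)
  ultimately have "w \<doteq> g @ M @ winv g" using *(3) by (simp add: weq_simps)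
  moreover have "rev M = M" using M(1) tree_pal[OF P1(1)] rev_winv[of P1] by metis
  ultimately have "w \<doteq> M" using palindrome_conj[OF b assms(2)] by blast
  then have "pm w P1" using M(1) by (auto simp: pm_def)
  then show ?thesis using P1(1) by blast
qed

section \<open>Second order recurrences with loxodromic multiplier\<close>

text \<open>A root of modulus 1 would give the real trace \<open>2 Re l\<close> in
  \<open>[-2, 2]\<close>; the two roots have product 1, so one lies outside the unit circle.\<close>

lemma loxodromic_multiplier:
  fixes t :: complex
  assumes "t \<notin> complex_of_real ` {-2..2}"
  obtains l where "cmod l > 1" "l + inverse l = t"
proof -
  define l where "l = (t + csqrt (t\<^sup>2 - 4)) / 2"
  define k where "k = (t - csqrt (t\<^sup>2 - 4)) / 2"
  have "(csqrt (t\<^sup>2 - 4))\<^sup>2 = t\<^sup>2 - 4" by simp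
  then have lk: "l * k = 1" "l + k = t"
    unfolding l_def k_def by (simp_all add: power2_eq_square field_simps)
  then have k: "k = inverse l" "l = inverse k"
    by (metis inverse_unique, metis inverse_unique mult.commute)
  have "cmod l \<noteq> 1"
  proof
    assume 1: "cmod l = 1"
    then have "l * cnj l = 1" using complex_norm_square[of l] by simp
    then have "inverse l = cnj l" by (rule inverse_unique)
    then have "t = complex_of_real (2 * Re l)" using lk k(1) complex_add_cnj[of l] by simp
    moreover have "2 * Re l \<in> {-2..2}" using abs_Re_le_cmod[of l] 1 by (simp add: abs_le_iff)
    ultimately show False using assms by blast
  qed
  moreover have "cmod l * cmod k = 1" using lk(1) by (metis norm_mult norm_one)
  moreover have "cmod l < 1 \<Longrightarrow> cmod k \<le> 1 \<Longrightarrow> cmod l * cmod k < 1"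
    using mult_left_mono[of "cmod k" 1 "cmod l"] by simp
  ultimately have "cmod l > 1 \<or> cmod k > 1" by linarith
  moreover have "l + inverse l = t" using lk(2) k(1) by metis
  moreover have "k + inverse k = t" using lk(2) k(2) by (metis add.commute)
  ultimately show ?thesis using that by blast
qed

text \<open>The solution is a combination of \<open>l^n\<close> and \<open>l^-n\<close>. If the
  growing part were absent, the sequence would tend to 0 against the lower bound 2.\<close>

lemma recurrence_growth:
  fixes a :: "nat \<Rightarrow> complex"
  assumes rec: "\<And>n. n \<ge> N \<Longrightarrow> a (n + 2) = t * a (n + 1) - a n"
    and t: "t \<notin> complex_of_real ` {-2..2}" and big: "\<And>n. n \<ge> N \<Longrightarrow> cmod (a n) > 2"
  shows "\<exists>c>0. \<exists>q>1. \<exists>N'\<ge>N. \<forall>n\<ge>N'. cmod (a n) \<ge> c * q ^ n"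
proof -
  obtain l where l: "cmod l > 1" "l + inverse l = t" using loxodromic_multiplier[OF t] .
  then have l0: "l \<noteq> 0" by auto
  \<comment> \<open>The eigencoordinates of the recurrence: the shift multiplies \<open>d\<close> by
    \<open>l\<close> and \<open>e\<close> by its inverse.\<close>
  define d where "d k = a (N + k + 1) - inverse l * a (N + k)" for k
  define e where "e k = a (N + k + 1) - l * a (N + k)" for k
  have r: "a (N + k + 2) = (l + inverse l) * a (N + k + 1) - a (N + k)" for k
    using rec[of "N + k"] l(2) by simp
  have "d (Suc k) = l * d k" "e (Suc k) = inverse l * e k" for k
    using r[of k] l0 by (simp_all add: d_def e_def field_simps)
  then have d: "d k = l ^ k * d 0" and e: "e k = inverse l ^ k * e 0" for k
    by (induction k) (simp_all add: algebra_simps)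
  have de: "d k - e k = (l - inverse l) * a (N + k)" for k
    by (simp add: d_def e_def algebra_simps)
  have d0: "d 0 \<noteq> 0"
  proof
    assume z: "d 0 = 0"
    have s: "a (N + Suc k) = inverse l * a (N + k)" for k
    proof -
      have "d k = 0" using d[of k] z by simp
      then show ?thesis unfolding d_def by simp
    qed
    have a: "a (N + k) = inverse l ^ k * a N" for k
    proof (induction k)
      case (Suc k)
      then show ?case using s[of k] by simp
    qed simp
    have "(\<lambda>k. inverse l ^ k * a N) \<longlonglongrightarrow> 0 * a N"
      by (intro tendsto_mult LIMSEQ_power_zero tendsto_const) (use l in \<open>simp add: norm_inverse inverse_less_1_iff\<close>)
    then have "(\<lambda>k. cmod (a (N + k))) \<longlonglongrightarrow> 0" unfolding a using tendsto_norm_zero by fastforce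
    then have "\<forall>\<^sub>F k in sequentially. cmod (a (N + k)) < 2" by (rule order_tendstoD) simp
    then obtain k where "cmod (a (N + k)) < 2" by (auto simp: eventually_sequentially)
    then show False using big[of "N + k"] by simp
  qed
  define b where "b = cmod (l - inverse l)"
  have "l \<noteq> inverse l"
  proof
    assume "l = inverse l"
    then have "l * l = 1" using l0 right_inverse by metis
    then have "cmod l * cmod l = 1" by (metis norm_mult norm_one)
    then show False using less_1_mult[OF l(1) l(1)] by simp
  qed
  then have b: "b > 0" by (simp add: b_def)
  have low: "b * cmod (a (N + k)) \<ge> cmod l ^ k * cmod (d 0) - cmod (e 0)" for k
  proof -
    have "cmod (inverse l ^ k * e 0) \<le> 1 * cmod (e 0)"
      unfolding norm_mult norm_power norm_inverse
      by (intro mult_right_mono power_le_one) (use l in \<open>auto simp: inverse_le_1_iff\<close>)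
    then have "cmod (e k) \<le> cmod (e 0)" using e[of k] by simp
    moreover have "cmod (d k) - cmod (e k) \<le> b * cmod (a (N + k))"
      unfolding b_def norm_mult[symmetric] de[symmetric] by (rule norm_triangle_ineq2)
    moreover have "cmod (d k) = cmod l ^ k * cmod (d 0)" using d[of k] by (simp add: norm_mult norm_power)
    ultimately show ?thesis by linarith
  qed
  obtain k0 where k0: "cmod l ^ k0 > 2 * cmod (e 0) / cmod (d 0)"
    using real_arch_pow[OF l(1)] by blast
  \<comment> \<open>From \<open>k0\<close> on the decaying part is at most half of the growing one;
    \<open>cmod l ^ N\<close> undoes the shift of the index.\<close>
  define c where "c = cmod (d 0) / (2 * b * cmod l ^ N)"
  have "cmod (a n) \<ge> c * cmod l ^ n" if "n \<ge> N + k0" for n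
  proof -
    define k where "k = n - N"
    have n: "n = N + k" "k \<ge> k0" using that by (auto simp: k_def)
    have "cmod l ^ k0 \<le> cmod l ^ k" using n l by (intro power_increasing) auto
    then have "2 * cmod (e 0) / cmod (d 0) \<le> cmod l ^ k" using k0 by linarith
    then have "2 * cmod (e 0) \<le> cmod l ^ k * cmod (d 0)" using d0 by (simp add: field_simps)
    then have "b * cmod (a (N + k)) \<ge> cmod l ^ k * cmod (d 0) / 2" using low[of k] by linarith
    then show ?thesis using b l0 by (simp add: c_def n power_add field_simps)
  qed
  moreover have "c > 0" using d0 b l0 by (simp add: c_def)
  ultimately show ?thesis using l(1) by (intro exI[of _ c] conjI exI[of _ "cmod l"] exI[of _ "N + k0"]) auto
qed

section \<open>Traces along the Farey tree\<close>

lemma parallelogram_defect: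
  fixes z w :: complex
  shows "(cmod (z - w))\<^sup>2 = 2 * (cmod z)\<^sup>2 + 2 * (cmod w)\<^sup>2 - (cmod (z + w))\<^sup>2"
  unfolding cmod_power2 minus_complex.sel plus_complex.sel by (simp add: power2_eq_square algebra_simps)

text \<open>Two consecutive edges at the vertex with regions \<open>p, u, w\<close>, both pointing
  to the root. For \<open>e = 0\<close> equality in the triangle inequality forces
  \<open>p u = 2 w\<close> and \<open>u w = 2 p\<close>, hence \<open>u^2 = 4\<close>, and the
  vertex polynomial is 4. The parallelogram law makes this quantitative.\<close>

lemma inward_edges_estimate:
  fixes p u w z z' :: complex
  assumes zw: "z + w = p * u" and zp: "p + z' = u * w"
    and big: "cmod p \<ge> 2" "cmod u \<ge> 2" "cmod w \<ge> 2"
    and S: "cmod p \<le> S" "cmod u \<le> S" "cmod w \<le> S"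
    and e: "cmod z \<le> cmod w + e" "cmod z' \<le> cmod p" "e \<ge> 0" "e \<le> 1"
  shows "cmod (p\<^sup>2 + u\<^sup>2 + w\<^sup>2 - p * u * w - 4) \<le> (2 * S + 1) * sqrt (8 * S * e)"
proof -
  \<comment> \<open>The common bound for the moduli of \<open>z - w\<close> and
    \<open>p - z'\<close>, whose squares are of order \<open>S e\<close>.\<close>
  define eta where "eta = sqrt (8 * S * e)"
  have S2: "S \<ge> 2" using big S by linarith
  have pu: "cmod (p * u) \<ge> 2 * cmod p" and uw: "cmod (u * w) \<ge> 2 * cmod w"
    using big mult_left_mono[of 2 "cmod u" "cmod p"] mult_right_mono[of 2 "cmod u" "cmod w"]
    by (simp_all add: norm_mult)
  have uw': "cmod (u * w) \<le> 2 * cmod p" unfolding zp[symmetric] using norm_triangle_ineq[of p z'] e by linarith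
  have pu': "cmod (p * u) \<le> 2 * cmod w + e" unfolding zw[symmetric] using norm_triangle_ineq[of z w] e by linarith
  have "(cmod (z - w))\<^sup>2 \<le> 2 * (cmod w + e)\<^sup>2 + 2 * (cmod w)\<^sup>2 - (2 * cmod w)\<^sup>2"
    unfolding parallelogram_defect zw
    using power_mono[OF e(1), of 2] power_mono[of "2 * cmod w" "cmod (p * u)" 2] pu uw uw' by simp
  also have "\<dots> = 4 * cmod w * e + 2 * e * e" by (simp add: power2_eq_square algebra_simps)
  also have "\<dots> \<le> 4 * S * e + 2 * S * e"
    using S e S2 by (intro add_mono mult_right_mono) auto
  also have "\<dots> \<le> 8 * S * e" using S2 e mult_nonneg_nonneg[of S e] by simp
  finally have 1: "cmod (2 * w - p * u) \<le> eta"
    unfolding eta_def zw[symmetric] by (intro real_le_rsqrt) (simp add: norm_minus_commute)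
  have "(cmod (p - z'))\<^sup>2 \<le> 2 * (cmod p)\<^sup>2 + 2 * (cmod p)\<^sup>2 - (2 * cmod p - e)\<^sup>2"
  proof -
    have "(cmod z')\<^sup>2 \<le> (cmod p)\<^sup>2" "(2 * cmod p - e)\<^sup>2 \<le> (cmod (u * w))\<^sup>2"
      using e pu pu' uw big by (auto intro!: power_mono)
    then show ?thesis unfolding parallelogram_defect zp by linarith
  qed
  also have "\<dots> \<le> 4 * cmod p * e" by (simp add: power2_eq_square algebra_simps)
  also have "\<dots> \<le> 8 * S * e" using S S2 e by (intro mult_right_mono) linarith+
  finally have 2: "cmod (2 * p - u * w) \<le> eta"
    unfolding eta_def zp[symmetric] by (intro real_le_rsqrt) simp
  have eta: "eta \<ge> 0" using S2 e by (simp add: eta_def mult_nonneg_nonneg)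
  \<comment> \<open>Eliminating \<open>p\<close> from the two approximate equations leaves
    \<open>u^2\<close> close to 4.\<close>
  have "cmod (w * (4 - u\<^sup>2)) = cmod (2 * (2 * w - p * u) + u * (2 * p - u * w))"
    by (simp add: power2_eq_square algebra_simps)
  also have "\<dots> \<le> 2 * eta + S * eta"
  proof (intro norm_triangle_mono)
    show "cmod (2 * (2 * w - p * u)) \<le> 2 * eta" using 1 unfolding norm_mult by simp
    show "cmod (u * (2 * p - u * w)) \<le> S * eta"
      unfolding norm_mult by (rule mult_mono) (use 2 S eta S2 in auto)
  qed
  finally have "cmod w * cmod (u\<^sup>2 - 4) \<le> (2 + S) * eta"
    unfolding norm_mult norm_minus_commute[of 4] by (simp add: distrib_right)
  moreover have "2 * cmod (u\<^sup>2 - 4) \<le> cmod w * cmod (u\<^sup>2 - 4)" using big by (intro mult_right_mono) auto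
  ultimately have 3: "cmod (u\<^sup>2 - 4) \<le> (2 + S) / 2 * eta" by simp
  have "p\<^sup>2 + u\<^sup>2 + w\<^sup>2 - p * u * w - 4 = (p * (2 * p - u * w) + w * (2 * w - p * u)) / 2 + (u\<^sup>2 - 4)"
    by (simp add: power2_eq_square field_simps)
  also have "cmod \<dots> \<le> (S * eta + S * eta) / 2 + (2 + S) / 2 * eta"
  proof (intro norm_triangle_mono 3)
    have "cmod (p * (2 * p - u * w) + w * (2 * w - p * u)) \<le> S * eta + S * eta"
      by (intro norm_triangle_mono) (use 1 2 S S2 eta in \<open>auto simp: norm_mult intro!: mult_mono\<close>)
    then show "cmod ((p * (2 * p - u * w) + w * (2 * w - p * u)) / 2) \<le> (S * eta + S * eta) / 2"
      by simp
  qed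
  also have "\<dots> \<le> (2 * S + 1) * eta"
    using mult_right_mono[OF S2 eta] mult_nonneg_nonneg[of S eta] S2 eta by (simp add: field_simps)
  finally show ?thesis by (simp add: eta_def)
qed

lemma below_trans: "below r s \<Longrightarrow> below s t \<Longrightarrow> below r t"
  by (rotate_tac, induction rule: below.induct) (auto intro: below.intros)

lemma below_cases: "below s t \<Longrightarrow> t = s \<or> below (left s) t \<or> below (right s) t"
  by (induction rule: below.induct) (auto intro: below.intros)

lemma fst_left [simp]: "fst (left s) = (\<not> fst s)" and fst_right [simp]: "fst (right s) = True"
  by (cases s rule: left.cases; simp)+

text \<open>The traces \<open>tx\<close>, \<open>ty\<close> are those of the two regions adjacent to an edge, \<open>tw\<close> and \<open>tz\<close> those
  of the regions at its lower and upper end, and \<open>h\<close> locates the axis of the first component of a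
  state.\<close>

locale trace_tree =
  fixes tx ty tz tw :: "state \<Rightarrow> complex" and h :: "state \<Rightarrow> real" and r0 :: state
    and C :: real and \<mu> :: complex
  assumes edge: "below r0 s \<Longrightarrow> tz s + tw s = tx s * ty s"
    and vertex: "below r0 s \<Longrightarrow> (tx s)\<^sup>2 + (ty s)\<^sup>2 + (tw s)\<^sup>2 - tx s * ty s * tw s = \<mu>"
    and mu: "\<mu> \<noteq> 4"
    and left: "below r0 s \<Longrightarrow> tx (left s) = tx s" "below r0 s \<Longrightarrow> ty (left s) = tw s"
      "below r0 s \<Longrightarrow> tz (left s) = ty s"
    and right: "below r0 s \<Longrightarrow> tx (right s) = (if fst s then tw s else ty s)"
      "below r0 s \<Longrightarrow> ty (right s) = (if fst s then ty s else tw s)"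
      "below r0 s \<Longrightarrow> tz (right s) = tx s"
    and lox: "below r0 s \<Longrightarrow> tx s \<notin> complex_of_real ` {-2..2}" "below r0 s \<Longrightarrow> ty s \<notin> complex_of_real ` {-2..2}"
    and C: "C \<ge> 0"
    and h_left: "below r0 s \<Longrightarrow> h (left s) = h s"
    and h_right: "below r0 s \<Longrightarrow>
      \<bar>h (right s) - h s\<bar> \<le> C / sqrt (cmod ((tx s)\<^sup>2 - 4) * cmod ((tx (right s))\<^sup>2 - 4))"
    and fin: "\<sigma> 0 = r0 \<Longrightarrow> (\<And>n. \<sigma> (Suc n) \<in> {left (\<sigma> n), right (\<sigma> n)}) \<Longrightarrow>
      finite {n. cmod (tw (\<sigma> n)) \<le> 2}"
begin

section \<open>Boundedness below an edge that points away from the root\<close>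

definition bdd_below :: "state \<Rightarrow> bool" where
  "bdd_below s \<longleftrightarrow> (\<exists>M. \<forall>t. below s t \<longrightarrow> \<bar>h t\<bar> \<le> M)"

text \<open>Bowditch's orientation of an edge by the size of its end regions; with
  \<open>m > 2\<close> it is inherited by the whole subtree.\<close>

definition outward :: "real \<Rightarrow> state \<Rightarrow> bool" where
  "outward m s \<longleftrightarrow> m \<le> cmod (tx s) \<and> m \<le> cmod (ty s) \<and> cmod (tz s) \<le> cmod (tw s)"

lemma cmod_square_minus_4:
  assumes "m \<le> cmod x" "m > 2"
  shows "(1 - 4 / m\<^sup>2) * (cmod x)\<^sup>2 \<le> cmod (x\<^sup>2 - 4)"
proof -
  have "m\<^sup>2 \<le> (cmod x)\<^sup>2" using assms by (intro power_mono) auto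
  then have "4 * m\<^sup>2 \<le> 4 * (cmod x)\<^sup>2" by simp
  then have "4 \<le> 4 / m\<^sup>2 * (cmod x)\<^sup>2" using assms by (simp add: field_simps)
  moreover have "(cmod x)\<^sup>2 - 4 \<le> cmod (x\<^sup>2 - 4)"
    using norm_triangle_ineq2[of "x\<^sup>2" 4] by (simp add: norm_power)
  ultimately show ?thesis by (simp add: algebra_simps)
qed

lemma delta_pos: "(m::real) > 2 \<Longrightarrow> 1 - 4 / m\<^sup>2 > 0"
  using power_strict_mono[of 2 m 2] by (simp add: divide_less_eq)

lemma step_bound:
  assumes "m \<le> cmod x" "m \<le> cmod y" "m > 2"
  shows "C / sqrt (cmod (x\<^sup>2 - 4) * cmod (y\<^sup>2 - 4)) \<le> C / ((1 - 4 / m\<^sup>2) * (cmod x * cmod y))"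
proof -
  define d where "d = 1 - 4 / m\<^sup>2"
  have d: "d > 0" unfolding d_def by (rule delta_pos[OF assms(3)])
  have "(d * (cmod x * cmod y))\<^sup>2 = (d * (cmod x)\<^sup>2) * (d * (cmod y)\<^sup>2)"
    by (simp add: power2_eq_square algebra_simps)
  also have "\<dots> \<le> cmod (x\<^sup>2 - 4) * cmod (y\<^sup>2 - 4)"
    using cmod_square_minus_4[OF assms(1,3)] cmod_square_minus_4[OF assms(2,3)] d
    by (intro mult_mono) (auto simp: d_def)
  finally have "d * (cmod x * cmod y) \<le> sqrt (cmod (x\<^sup>2 - 4) * cmod (y\<^sup>2 - 4))"
    by (rule real_le_rsqrt)
  moreover have "0 < d * (cmod x * cmod y)" using assms d by (intro mult_pos_pos) auto
  ultimately show ?thesis unfolding d_def[symmetric] using C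
    by (intro divide_left_mono) (auto intro: mult_pos_pos less_le_trans)
qed

text \<open>The constant for which the step bounds telescope: \<open>1 - 4 / m^2\<close> compares
  \<open>x^2 - 4\<close> with \<open>x^2\<close>, and \<open>(m / 2 - 1) m\<close> is the least
  increase of the modulus in an outward step.\<close>

definition slack :: "real \<Rightarrow> real" where
  "slack m = C / ((1 - 4 / m\<^sup>2) * ((m / 2 - 1) * m))"

lemma slack_step:
  assumes m: "m > 2" "m \<le> cmod x" and w: "m / 2 * cmod x \<le> cmod w"
  shows "C / sqrt (cmod (x\<^sup>2 - 4) * cmod (w\<^sup>2 - 4)) \<le> slack m / cmod x - slack m / cmod w"
proof -
  define d where "d = 1 - 4 / m\<^sup>2"
  have d: "d > 0" unfolding d_def by (rule delta_pos[OF assms(1)])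
  have "(m / 2 - 1) * m \<le> (m / 2 - 1) * cmod x" using m by (intro mult_left_mono) auto
  then have gap: "(m / 2 - 1) * m \<le> cmod w - cmod x" using w by (simp add: algebra_simps)
  moreover have "(m / 2 - 1) * m > 0" using m by simp
  ultimately have xw: "cmod x < cmod w" by linarith
  have "C / sqrt (cmod (x\<^sup>2 - 4) * cmod (w\<^sup>2 - 4)) \<le> C / (d * (cmod x * cmod w))"
    unfolding d_def by (rule step_bound) (use m xw in auto)
  also have "\<dots> = C / d / (cmod x * cmod w)" by simp
  also have "\<dots> \<le> slack m * (cmod w - cmod x) / (cmod x * cmod w)"
  proof (intro divide_right_mono)
    have "C / d = slack m * ((m / 2 - 1) * m)" using m by (simp add: slack_def d_def[symmetric])
    also have "\<dots> \<le> slack m * (cmod w - cmod x)"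
      using gap m d C by (intro mult_left_mono) (auto simp: slack_def d_def[symmetric])
    finally show "C / d \<le> slack m * (cmod w - cmod x)" .
  qed simp
  also have "\<dots> = slack m / cmod x - slack m / cmod w"
  proof -
    have "cmod x \<noteq> 0" "cmod w \<noteq> 0" using m xw by auto
    then show ?thesis by (simp add: field_simps del: norm_eq_zero)
  qed
  finally show ?thesis .
qed

lemma slack_nonneg: "m > 2 \<Longrightarrow> slack m \<ge> 0"
  unfolding slack_def using C delta_pos[of m]
  by (intro divide_nonneg_nonneg mult_nonneg_nonneg) auto

text \<open>The edge relation gives \<open>2 |w| \<ge> |x y|\<close>, so \<open>w\<close> exceeds
  both neighbours by the factor \<open>m / 2\<close>; the next region \<open>a w - b\<close> has
  modulus at least \<open>2 |w| - |b| \<ge> |b|\<close>.\<close>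

lemma outward_children:
  assumes s: "below r0 s" and o: "outward m s" and m: "m > 2"
  shows "outward m (left s)" "outward m (right s)" "m / 2 * cmod (tx s) \<le> cmod (tw s)"
proof -
  let ?x = "tx s" and ?y = "ty s" and ?w = "tw s" and ?z = "tz s"
  have x: "m \<le> cmod ?x" and y: "m \<le> cmod ?y" and zw: "cmod ?z \<le> cmod ?w"
    using o by (auto simp: outward_def)
  have "cmod ?x * cmod ?y \<le> 2 * cmod ?w"
    using edge[OF s] norm_triangle_ineq[of ?z ?w] zw by (simp add: norm_mult[symmetric])
  moreover have "m * cmod ?x \<le> cmod ?x * cmod ?y" "m * cmod ?y \<le> cmod ?x * cmod ?y"
    using x y mult_left_mono[of m "cmod ?y" "cmod ?x"] mult_right_mono[of m "cmod ?x" "cmod ?y"]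
    by (simp_all add: mult.commute)
  ultimately have wx: "m / 2 * cmod ?x \<le> cmod ?w" and wy: "m / 2 * cmod ?y \<le> cmod ?w" by simp_all
  show "m / 2 * cmod ?x \<le> cmod ?w" by fact
  have ge: "cmod x \<le> m / 2 * cmod x" for x :: complex using m mult_right_mono[of 1 "m/2" "cmod x"] by simp
  have xw: "cmod ?x \<le> cmod ?w" and yw: "cmod ?y \<le> cmod ?w" using wx wy ge[of ?x] ge[of ?y] by linarith+
  have grow: "cmod b \<le> cmod (a * ?w - b)" if "m \<le> cmod a" "cmod b \<le> cmod ?w" for a b
  proof -
    have "2 * cmod ?w \<le> cmod (a * ?w)" using that(1) m by (simp add: norm_mult mult_right_mono)
    then show ?thesis using norm_triangle_ineq2[of "a * ?w" b] that(2) by linarith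
  qed
  have "tw (left s) = ?x * ?w - ?y"
    using edge[OF below.left[OF s]] left[OF s] by (simp add: algebra_simps)
  then show "outward m (left s)"
    using grow[of ?x ?y] x y xw yw left[OF s] by (simp add: outward_def)
  have "tw (right s) = ?y * ?w - ?x"
    using edge[OF below.right[OF s]] right[OF s] by (auto simp: algebra_simps split: if_splits)
  then show "outward m (right s)"
    using grow[of ?y ?x] x y xw yw right[OF s] by (auto simp: outward_def)
qed

text \<open>\<open>slack m\<close> divided by the modulus of the trace is a potential that pays for
  each later step. In a state without flag both regions have palindromic representatives and
  \<open>right\<close> merely exchanges them, with no growth to pay for the step; therefore the
  invariant controls both positions.\<close>

lemma outward_bounded:
  assumes s: "below r0 s" and o: "outward m s" and m: "m > 2"
    and H: "\<bar>h s\<bar> \<le> H" "\<not> fst s \<Longrightarrow> \<bar>h (right s)\<bar> \<le> H" and t: "below s t"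
  shows "\<bar>h t\<bar> \<le> H + slack m / m"
proof -
  define M where "M = H + slack m / m"
  have init: "\<bar>a\<bar> \<le> H \<Longrightarrow> m \<le> cmod x \<Longrightarrow> \<bar>a\<bar> \<le> M - slack m / cmod x" for a x
  proof -
    assume *: "\<bar>a\<bar> \<le> H" "m \<le> cmod x"
    then have "0 < m * cmod x" using m by (intro mult_pos_pos) auto
    then have "slack m / cmod x \<le> slack m / m"
      using * slack_nonneg[OF m] by (intro divide_left_mono) (auto simp: mult.commute)
    then show ?thesis using * unfolding M_def by linarith
  qed
  have "outward m t \<and> \<bar>h t\<bar> \<le> M - slack m / cmod (tx t) \<and>
      (\<not> fst t \<longrightarrow> \<bar>h (right t)\<bar> \<le> M - slack m / cmod (ty t))"
    using t
  proof (induction rule: below.induct)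
    case refl
    then show ?case using o H init unfolding outward_def by auto
  next
    case (left t)
    have rt: "below r0 t" using s left.hyps by (rule below_trans)
    note oc = outward_children[OF rt _ m]
    show ?case
    proof (cases "fst t")
      case True
      have "\<bar>h (right (left t)) - h t\<bar> \<le> slack m / cmod (tx t) - slack m / cmod (tw t)"
        using h_right[OF below.left[OF rt]] slack_step[of m "tx t" "tw t"] oc(3) left.IH m True
          trace_tree.left[OF trace_tree_axioms rt] right[OF below.left[OF rt]] h_left[OF rt]
        unfolding outward_def by auto
      then show ?thesis using oc left.IH True trace_tree.left[OF trace_tree_axioms rt] h_left[OF rt] by auto
    next
      case False
      then show ?thesis using oc left.IH trace_tree.left[OF trace_tree_axioms rt] h_left[OF rt] by auto
    qed
  next
    case (right t)
    have rt: "below r0 t" using s right.hyps by (rule below_trans)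
    note oc = outward_children[OF rt _ m]
    show ?case
    proof (cases "fst t")
      case True
      have "\<bar>h (right t) - h t\<bar> \<le> slack m / cmod (tx t) - slack m / cmod (tw t)"
        using h_right[OF rt] slack_step[of m "tx t" "tw t"] oc(3) right.IH m True
          trace_tree.right[OF trace_tree_axioms rt]
        unfolding outward_def by auto
      then show ?thesis using oc right.IH True trace_tree.right[OF trace_tree_axioms rt] by auto
    next
      case False
      then show ?thesis using oc right.IH trace_tree.right[OF trace_tree_axioms rt] by auto
    qed
  qed
  then have "\<bar>h t\<bar> \<le> M - slack m / cmod (tx t)" by blast
  also have "\<dots> \<le> M" using slack_nonneg[OF m] by simp
  finally show ?thesis by (simp add: M_def)
qed

lemma outward_bdd: "below r0 s \<Longrightarrow> outward m s \<Longrightarrow> m > 2 \<Longrightarrow> bdd_below s"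
  unfolding bdd_below_def
  using outward_bounded[of s m "max \<bar>h s\<bar> \<bar>h (right s)\<bar>"] by fastforce

lemma below_path:
  assumes "\<And>n. n \<ge> N \<Longrightarrow> \<sigma> (Suc n) = f (\<sigma> n)" "(f, g) \<in> {(left, right), (right, left)}"
    "below (\<sigma> N) t"
  shows "\<exists>n\<ge>N. t = \<sigma> n \<or> below (g (\<sigma> n)) t"
  using assms(3)
proof (induction rule: below.induct)
  case refl
  then show ?case by auto
next
  case (left t)
  then obtain n where n: "n \<ge> N" "t = \<sigma> n \<or> below (g (\<sigma> n)) t" by blast
  then consider "below (g (\<sigma> n)) t" | "t = \<sigma> n" "g = left" | "left t = \<sigma> (Suc n)"
    using assms(1)[of n] assms(2) by auto
  then show ?case
  proof cases
    case 3
    then show ?thesis using n(1) le_SucI by blast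
  qed (use n(1) in \<open>auto intro: below.intros\<close>)
next
  case (right t)
  then obtain n where n: "n \<ge> N" "t = \<sigma> n \<or> below (g (\<sigma> n)) t" by blast
  then consider "below (g (\<sigma> n)) t" | "t = \<sigma> n" "g = right" | "right t = \<sigma> (Suc n)"
    using assms(1)[of n] assms(2) by auto
  then show ?case
  proof cases
    case 3
    then show ?thesis using n(1) le_SucI by blast
  qed (use n(1) in \<open>auto intro: below.intros\<close>)
qed

section \<open>Branches that wind around one region\<close>

lemma fan_growth:
  fixes a :: "nat \<Rightarrow> complex"
  assumes "\<And>n. n \<ge> N \<Longrightarrow> a (n + 2) = t * a (n + 1) - a n" "t \<notin> complex_of_real ` {-2..2}"
    "\<And>n. n \<ge> N \<Longrightarrow> cmod (a n) > 2"
  obtains c q N' where "c > 0" "q > 1" "N' \<ge> N" "\<And>n. n \<ge> N' \<Longrightarrow> c * q ^ n \<le> cmod (a n)"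
    "\<And>n. n \<ge> N' \<Longrightarrow> 3 + cmod t \<le> cmod (a n)"
proof -
  obtain c q N1 where cq: "c > 0" "q > 1" "N1 \<ge> N" "\<And>n. n \<ge> N1 \<Longrightarrow> c * q ^ n \<le> cmod (a n)"
    using recurrence_growth[OF assms] by blast
  obtain N2 where N2: "(3 + cmod t) / c < q ^ N2" using real_arch_pow[OF cq(2)] by blast
  have "3 + cmod t \<le> cmod (a n)" if "n \<ge> max N1 N2" for n
  proof -
    have "q ^ N2 \<le> q ^ n" using that cq(2) by (intro power_increasing) auto
    then have "(3 + cmod t) / c \<le> q ^ n" using N2 by linarith
    then have "3 + cmod t \<le> c * q ^ n" using cq(1) by (simp add: field_simps)
    then show ?thesis using cq(4)[of n] that by simp
  qed
  then show ?thesis using that[OF cq(1,2), of "max N1 N2"] cq(3,4) by auto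
qed

text \<open>The threshold \<open>3 + cmod x\<close> makes the side branches of a fan around the
  region with trace \<open>x\<close> outward for \<open>m = 3\<close>.\<close>

lemma big_prod:
  assumes "3 + cmod x \<le> cmod a" "3 + cmod x \<le> cmod b" shows "cmod x \<le> cmod (a * b - x)"
proof -
  have "3 * cmod b \<le> cmod a * cmod b" 
    using assms(1) norm_ge_zero[of x] by (intro mult_right_mono norm_ge_zero) linarith
  then show ?thesis using norm_triangle_ineq2[of "a * b" x] assms(2) norm_ge_zero[of x] unfolding norm_mult by linarith
qed

text \<open>The first region stays fixed and with it \<open>h\<close>, so the branch itself
  contributes nothing. The traces around it grow, all late side branches point outward, and entering
  one costs at most a constant.\<close>

lemma left_fan:
  assumes r: "\<And>n. below r0 (\<sigma> n)" and f: "\<And>n. n \<ge> N \<Longrightarrow> \<sigma> (Suc n) = left (\<sigma> n)"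
    and big: "\<And>n. n \<ge> N \<Longrightarrow> cmod (tw (\<sigma> n)) > 2"
  shows "\<exists>n. bdd_below (\<sigma> n)"
proof -
  define x where "x = tx (\<sigma> N)"
  have tx: "tx (\<sigma> n) = x" and hh: "h (\<sigma> n) = h (\<sigma> N)" if "n \<ge> N" for n
    using that by (induction n rule: dec_induct) (auto simp: x_def f left[OF r] h_left[OF r])
  have ty: "ty (\<sigma> (Suc n)) = tw (\<sigma> n)" if "n \<ge> N" for n
    using f[OF that] left[OF r] by simp
  have "ty (\<sigma> (n + 2)) = x * ty (\<sigma> (n + 1)) - ty (\<sigma> n)" if "n \<ge> N" for n
    using ty[of "Suc n"] that edge[OF r[of "Suc n"]] tx[of "Suc n"] f[OF that] left(3)[OF r[of n]]
    by (simp add: algebra_simps)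
  moreover have "x \<notin> complex_of_real ` {-2..2}" using lox(1)[OF r[of N]] by (simp add: x_def)
  moreover have "cmod (ty (\<sigma> n)) > 2" if "n \<ge> Suc N" for n
    using that ty[of "n - 1"] big[of "n - 1"] by (cases n) auto
  ultimately obtain N' where N': "N' \<ge> Suc N" "\<And>n. n \<ge> N' \<Longrightarrow> 3 + cmod x \<le> cmod (ty (\<sigma> n))"
    using fan_growth[of "Suc N" "\<lambda>n. ty (\<sigma> n)" x] by (metis Suc_leD)
  \<comment> \<open>No lower bound for \<open>x\<close> is available beyond
    \<open>x^2 \<noteq> 4\<close>; the other factor under the root is at least 1 once that trace has
    modulus at least 3.\<close>
  define D where "D = C / sqrt (cmod (x\<^sup>2 - 4))"
  have x4: "cmod (x\<^sup>2 - 4) > 0"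
  proof -
    have "x \<noteq> complex_of_real 2" "x \<noteq> complex_of_real (- 2)" using \<open>x \<notin> _\<close> by (force simp del: of_real_numeral)+
    then have "(x - 2) * (x + 2) \<noteq> 0" by (simp add: add_eq_0_iff2)
    then show ?thesis by (simp add: power2_eq_square algebra_simps)
  qed
  have "\<bar>h t\<bar> \<le> \<bar>h (\<sigma> N)\<bar> + D + slack 3 / 3" if t: "below (\<sigma> N') t" for t
  proof -
    obtain n where n: "n \<ge> N'" "t = \<sigma> n \<or> below (right (\<sigma> n)) t"
      using below_path[of N' \<sigma> left right t] f N'(1) t by auto
    have D0: "D \<ge> 0" "slack 3 / 3 \<ge> 0" using C slack_nonneg[of 3] by (simp_all add: D_def)
    have nN: "n \<ge> N" using n N' by simp
    show ?thesis
    proof (cases "t = \<sigma> n")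
      case True
      then show ?thesis using hh[OF nN] D0 by simp
    next
      case False
      then have b: "below (right (\<sigma> n)) t" using n by simp
      have y1: "3 + cmod x \<le> cmod (ty (\<sigma> n))" using N'(2)[of n] n by simp
      have w1: "3 + cmod x \<le> cmod (tw (\<sigma> n))" using N'(2)[of "Suc n"] ty[OF nN] n by simp
      have yw3: "3 \<le> cmod (ty (\<sigma> n))" "3 \<le> cmod (tw (\<sigma> n))" using y1 w1 norm_ge_zero[of x] by linarith+
      note R = right[OF r[of n]]
      have "tw (right (\<sigma> n)) = ty (\<sigma> n) * tw (\<sigma> n) - x"
        using edge[OF below.right[OF r[of n]]] R tx[OF nN] by (auto simp: algebra_simps split: if_splits)
      then have o: "outward 3 (right (\<sigma> n))"
        using R tx[OF nN] yw3 big_prod[OF y1 w1] unfolding outward_def by auto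
      have "3 \<le> cmod (tx (right (\<sigma> n)))" using o by (simp add: outward_def)
      then have "1 \<le> cmod ((tx (right (\<sigma> n)))\<^sup>2 - 4)"
        using cmod_square_minus_4[of 3 "tx (right (\<sigma> n))"] power_mono[of 3 "cmod (tx (right (\<sigma> n)))" 2] by simp
      then have "cmod (x\<^sup>2 - 4) \<le> cmod (x\<^sup>2 - 4) * cmod ((tx (right (\<sigma> n)))\<^sup>2 - 4)"
        using mult_left_mono[of 1] by fastforce
      then have "C / sqrt (cmod (x\<^sup>2 - 4) * cmod ((tx (right (\<sigma> n)))\<^sup>2 - 4)) \<le> D"
        unfolding D_def using C x4 \<open>1 \<le> _\<close>
        by (intro divide_left_mono) (auto intro!: mult_pos_pos simp del: zero_less_norm_iff)
      then have "\<bar>h (right (\<sigma> n))\<bar> \<le> \<bar>h (\<sigma> N)\<bar> + D"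
        using h_right[OF r[of n]] tx[OF nN] hh[OF nN] by simp
      then show ?thesis
        using outward_bounded[OF below.right[OF r] o _ _ _ b, of "\<bar>h (\<sigma> N)\<bar> + D"] by simp
    qed
  qed
  then show ?thesis unfolding bdd_below_def by blast
qed

text \<open>Here the second region is fixed and the first one changes in every step. The steps are
  summable since the traces around a fixed region grow exponentially.\<close>

lemma right_fan:
  assumes r: "\<And>n. below r0 (\<sigma> n)" and f: "\<And>n. n \<ge> N \<Longrightarrow> \<sigma> (Suc n) = right (\<sigma> n)"
    and big: "\<And>n. n \<ge> N \<Longrightarrow> cmod (tw (\<sigma> n)) > 2"
  shows "\<exists>n. bdd_below (\<sigma> n)"
proof -
  \<comment> \<open>One step is skipped: \<open>right\<close> keeps the second region only once the
    flag is set.\<close>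
  define y where "y = ty (\<sigma> (Suc N))"
  have k: "fst (\<sigma> n)" if "n \<ge> Suc N" for n using that f[of "n - 1"] by (cases n) auto
  have ty: "ty (\<sigma> n) = y" if "n \<ge> Suc N" for n
    using that
  proof (induction n rule: dec_induct)
    case (step n)
    then show ?case using f[of n] right(2)[OF r[of n]] k[of n] by simp
  qed (simp add: y_def)
  have tx: "tx (\<sigma> (Suc n)) = tw (\<sigma> n)" if "n \<ge> Suc N" for n
    using f[of n] right(1)[OF r[of n]] k[of n] that by simp
  have "tx (\<sigma> (n + 2)) = y * tx (\<sigma> (n + 1)) - tx (\<sigma> n)" if "n \<ge> Suc N" for n
    using tx[of "Suc n"] that edge[OF r[of "Suc n"]] ty[of "Suc n"] f[of n] right(3)[OF r[of n]]
    by (simp add: algebra_simps)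
  moreover have y: "y \<notin> complex_of_real ` {-2..2}" using lox(2)[OF r] by (simp add: y_def)
  moreover have "cmod (tx (\<sigma> n)) > 2" if "n \<ge> Suc (Suc N)" for n
    using that tx[of "n - 1"] big[of "n - 1"] by (cases n) auto
  ultimately obtain c q N' where N': "c > 0" "q > 1" "N' \<ge> Suc (Suc N)"
    "\<And>n. n \<ge> N' \<Longrightarrow> c * q ^ n \<le> cmod (tx (\<sigma> n))" "\<And>n. n \<ge> N' \<Longrightarrow> 3 + cmod y \<le> cmod (tx (\<sigma> n))"
    using fan_growth[of "Suc (Suc N)" "\<lambda>n. tx (\<sigma> n)" y] by (metis Suc_leD)
  have x3: "3 \<le> cmod (tx (\<sigma> n))" if "n \<ge> N'" for n using N'(5)[OF that] norm_ge_zero[of y] by linarith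
  define E where "E = C / c"
  have step: "C / sqrt (cmod ((tx (\<sigma> n))\<^sup>2 - 4) * cmod ((tx (\<sigma> (Suc n)))\<^sup>2 - 4)) \<le> E * (1 / q) ^ n" if "n \<ge> N'" for n
  proof -
    have "C / sqrt (cmod ((tx (\<sigma> n))\<^sup>2 - 4) * cmod ((tx (\<sigma> (Suc n)))\<^sup>2 - 4))
        \<le> C / ((1 - 4 / 3\<^sup>2) * (cmod (tx (\<sigma> n)) * cmod (tx (\<sigma> (Suc n)))))"
      by (rule step_bound) (use x3 that in auto)
    also have "\<dots> \<le> C / (c * q ^ n)"
    proof (intro divide_left_mono C)
      \<comment> \<open>One of the two traces suffices, as \<open>(1 - 4 / 9) * 3 > 1\<close> lets
        the other one be dropped.\<close>
      have "c * q ^ n * 1 \<le> cmod (tx (\<sigma> n)) * ((1 - 4 / 3\<^sup>2) * cmod (tx (\<sigma> (Suc n))))"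
        using N'(1,2) N'(4)[OF that] x3[of "Suc n"] that by (intro mult_mono) auto
      then show le: "c * q ^ n \<le> (1 - 4 / 3\<^sup>2) * (cmod (tx (\<sigma> n)) * cmod (tx (\<sigma> (Suc n))))"
        by (simp add: algebra_simps)
      have "0 < c * q ^ n" using N'(1,2) by simp
      with le show "0 < (1 - 4 / 3\<^sup>2) * (cmod (tx (\<sigma> n)) * cmod (tx (\<sigma> (Suc n)))) * (c * q ^ n)"
        by (meson less_le_trans mult_pos_pos)
    qed
    finally show ?thesis by (simp add: E_def power_divide)
  qed
  define T where "T = E * (1 / (1 - 1 / q))"
  have hs: "\<bar>h (\<sigma> n)\<bar> \<le> \<bar>h (\<sigma> N')\<bar> + E * (\<Sum>k<n. (1 / q) ^ k)" if "n \<ge> N'" for n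
    using that
  proof (induction n rule: dec_induct)
    case base
    have "0 \<le> E * (\<Sum>k<N'. (1 / q) ^ k)" using C N'(1,2) by (intro mult_nonneg_nonneg sum_nonneg) (auto simp: E_def)
    then show ?case by simp
  next
    case (step n)
    have "\<bar>h (\<sigma> (Suc n)) - h (\<sigma> n)\<bar> \<le> E * (1 / q) ^ n"
      using h_right[OF r[of n]] \<open>\<And>n. N' \<le> n \<Longrightarrow> _ \<le> E * (1 / q) ^ n\<close>[of n] step f[of n] N'(3) by simp
    then show ?case using step.IH by (simp add: algebra_simps)
  qed
  have geo: "(\<Sum>k<n. (1 / q) ^ k) \<le> 1 / (1 - 1 / q)" for n
    using sum_le_suminf[OF summable_geometric[of "1 / q"], of "{..<n}"] suminf_geometric[of "1 / q"] N'(2)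
    by simp
  have E0: "E \<ge> 0" using C N'(1) by (simp add: E_def)
  have hT: "\<bar>h (\<sigma> n)\<bar> \<le> \<bar>h (\<sigma> N')\<bar> + T" if "n \<ge> N'" for n
    using hs[OF that] mult_left_mono[OF geo E0, of n] by (simp add: T_def)
  have T0: "T \<ge> 0" unfolding T_def using E0 N'(2) by (intro mult_nonneg_nonneg) auto
  have "\<bar>h t\<bar> \<le> \<bar>h (\<sigma> N')\<bar> + T + slack 3 / 3" if t: "below (\<sigma> N') t" for t
  proof -
    obtain n where n: "n \<ge> N'" "t = \<sigma> n \<or> below (left (\<sigma> n)) t"
      using below_path[of N' \<sigma> right left t] f N'(3) t by auto
    have S0: "slack 3 / 3 \<ge> 0" using slack_nonneg[of 3] by simp
    have nN: "n \<ge> Suc N" "n \<ge> N" using n N' by simp_all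
    show ?thesis
    proof (cases "t = \<sigma> n")
      case True
      then show ?thesis using hT[OF n(1)] S0 by simp
    next
      case False
      then have b: "below (left (\<sigma> n)) t" using n by simp
      have x1: "3 + cmod y \<le> cmod (tx (\<sigma> n))" using N'(5)[of n] n by simp
      have w1: "3 + cmod y \<le> cmod (tw (\<sigma> n))" using N'(5)[of "Suc n"] tx[OF nN(1)] n by simp
      have xw3: "3 \<le> cmod (tx (\<sigma> n))" "3 \<le> cmod (tw (\<sigma> n))" using x1 w1 norm_ge_zero[of y] by linarith+
      note L = left[OF r[of n]]
      have "tw (left (\<sigma> n)) = tx (\<sigma> n) * tw (\<sigma> n) - y"
        using edge[OF below.left[OF r[of n]]] L ty[OF nN(1)] by (simp add: algebra_simps)
      then have o: "outward 3 (left (\<sigma> n))"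
        using L ty[OF nN(1)] xw3 big_prod[OF x1 w1] unfolding outward_def by auto
      have h1: "\<bar>h (left (\<sigma> n))\<bar> \<le> \<bar>h (\<sigma> N')\<bar> + T" using hT[OF n(1)] h_left[OF r] by simp
      have "tx (right (left (\<sigma> n))) = tx (\<sigma> (Suc n))"
        using right(1)[OF below.left[OF r[of n]]] k[OF nN(1)] L tx[OF nN(1)] by simp
      then have "\<bar>h (right (left (\<sigma> n))) - h (\<sigma> n)\<bar> \<le> E * (1 / q) ^ n"
        using h_right[OF below.left[OF r[of n]]] step[OF n(1)] L h_left[OF r[of n]] by simp
      then have "\<bar>h (right (left (\<sigma> n)))\<bar> \<le> \<bar>h (\<sigma> N')\<bar> + E * (\<Sum>k<Suc n. (1 / q) ^ k)"
        using hs[OF n(1)] by (simp add: algebra_simps)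
      then have "\<bar>h (right (left (\<sigma> n)))\<bar> \<le> \<bar>h (\<sigma> N')\<bar> + T"
        using mult_left_mono[OF geo E0, of "Suc n"] by (simp add: T_def)
      then show ?thesis
        using outward_bounded[OF below.left[OF r] o _ h1 _ b] by simp
    qed
  qed
  then show ?thesis unfolding bdd_below_def by blast
qed

section \<open>Excluding an unbounded branch\<close>

lemma bdd_below_children: "bdd_below (left s) \<Longrightarrow> bdd_below (right s) \<Longrightarrow> bdd_below s"
proof -
  assume "bdd_below (left s)" "bdd_below (right s)"
  then obtain M1 M2 where "\<And>t. below (left s) t \<Longrightarrow> \<bar>h t\<bar> \<le> M1" "\<And>t. below (right s) t \<Longrightarrow> \<bar>h t\<bar> \<le> M2"
    unfolding bdd_below_def by blast
  then have "\<bar>h t\<bar> \<le> max \<bar>h s\<bar> (max M1 M2)" if "below s t" for t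
    using below_cases[OF that] by fastforce
  then show ?thesis unfolding bdd_below_def by blast
qed

text \<open>The sum of the moduli of the three regions at the upper end of the edge drops by exactly
  \<open>e n\<close> in a step. It is nonnegative, so \<open>e n\<close> tends to 0 with all traces
  bounded, and \<open>inward_edges_estimate\<close> yields \<open>\<mu> = 4\<close>.\<close>

lemma no_inward_path:
  assumes r: "\<And>n. below r0 (\<sigma> n)" and f: "\<And>n. \<sigma> (Suc n) \<in> {left (\<sigma> n), right (\<sigma> n)}"
    and big: "\<And>n. n \<ge> K \<Longrightarrow> cmod (tx (\<sigma> n)) > 2" "\<And>n. n \<ge> K \<Longrightarrow> cmod (ty (\<sigma> n)) > 2"
      "\<And>n. n \<ge> K \<Longrightarrow> cmod (tw (\<sigma> n)) > 2"
    and inward: "\<And>n. n \<ge> K \<Longrightarrow> cmod (tw (\<sigma> n)) < cmod (tz (\<sigma> n))"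
  shows False
proof -
  define sg where "sg n = cmod (tx (\<sigma> (K + n))) + cmod (ty (\<sigma> (K + n))) + cmod (tz (\<sigma> (K + n)))" for n
  define e where "e n = cmod (tz (\<sigma> (K + n))) - cmod (tw (\<sigma> (K + n)))" for n
  have sg: "sg (Suc n) = sg n - e n" for n
    using f[of "K + n"] left[OF r[of "K + n"]] right[OF r[of "K + n"]]
    by (auto simp: sg_def e_def split: if_splits)
  have e0: "e n \<ge> 0" for n using inward[of "K + n"] by (simp add: e_def)
  have dec: "decseq sg" by (rule decseq_SucI) (use sg e0 in auto)
  have "sg n \<ge> 0" for n by (simp add: sg_def)
  then obtain L where L: "sg \<longlonglongrightarrow> L" using decseq_convergent[OF dec] by blast
  have "(\<lambda>n. sg n - sg (Suc n)) \<longlonglongrightarrow> L - L" by (intro tendsto_diff L LIMSEQ_Suc)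
  then have elim: "e \<longlonglongrightarrow> 0" by (simp add: sg)
  define S where "S = sg 0"
  have S: "cmod (tx (\<sigma> (K + n))) \<le> S" "cmod (ty (\<sigma> (K + n))) \<le> S" "cmod (tw (\<sigma> (K + n))) \<le> S" for n
  proof -
    have "sg n \<le> S" using dec by (simp add: S_def decseq_def)
    moreover have "cmod (tx (\<sigma> (K + n))) \<le> sg n" "cmod (ty (\<sigma> (K + n))) \<le> sg n" "cmod (tw (\<sigma> (K + n))) \<le> sg n"
      using e0[of n] by (simp_all add: sg_def e_def add_increasing add_increasing2)
    ultimately show "cmod (tx (\<sigma> (K + n))) \<le> S" "cmod (ty (\<sigma> (K + n))) \<le> S" "cmod (tw (\<sigma> (K + n))) \<le> S"
      by linarith+
  qed
  have est: "cmod (\<mu> - 4) \<le> (2 * S + 1) * sqrt (8 * S * e n)" if en: "e n \<le> 1" for n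
  proof -
    let ?s = "\<sigma> (K + n)" and ?s' = "\<sigma> (Suc (K + n))"
    have inw: "cmod (tz ?s) \<le> cmod (tw ?s) + e n" "cmod (tw ?s') \<le> cmod (tz ?s')"
      using inward[of "Suc (K + n)"] by (simp_all add: e_def)
    have b: "cmod (tx ?s) \<ge> 2" "cmod (ty ?s) \<ge> 2" "cmod (tw ?s) \<ge> 2"
      using big[of "K + n"] by simp_all
    have v: "\<mu> = (tx ?s)\<^sup>2 + (ty ?s)\<^sup>2 + (tw ?s)\<^sup>2 - tx ?s * ty ?s * tw ?s"
      using vertex[OF r[of "K + n"]] by simp
    from f[of "K + n"] consider "?s' = left ?s" | "?s' = right ?s" by auto
    then show ?thesis
    proof cases
      case 1
      have "tz ?s' + tw ?s' = tx ?s' * ty ?s'" by (rule edge[OF r])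
      then have "ty ?s + tw ?s' = tx ?s * tw ?s" using 1 left[OF r[of "K + n"]] by simp
      then have "cmod ((ty ?s)\<^sup>2 + (tx ?s)\<^sup>2 + (tw ?s)\<^sup>2 - ty ?s * tx ?s * tw ?s - 4) \<le> (2 * S + 1) * sqrt (8 * S * e n)"
        using edge[OF r[of "K + n"]] b S inw left[OF r[of "K + n"]] 1 e0 en
        by (intro inward_edges_estimate[where z = "tz ?s" and z' = "tw ?s'"]) (auto simp: mult.commute)
      then show ?thesis unfolding v by (simp add: algebra_simps)
    next
      case 2
      have "tz ?s' + tw ?s' = tx ?s' * ty ?s'" by (rule edge[OF r])
      then have "tx ?s + tw ?s' = ty ?s * tw ?s"
        using 2 right[OF r[of "K + n"]] by (simp add: mult.commute split: if_splits)
      then show ?thesis unfolding v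
        using edge[OF r[of "K + n"]] b S inw right[OF r[of "K + n"]] 2 e0 en
        by (intro inward_edges_estimate[where z = "tz ?s" and z' = "tw ?s'"]) auto
    qed
  qed
  have "(\<lambda>n. (2 * S + 1) * sqrt (8 * S * e n)) \<longlonglongrightarrow> (2 * S + 1) * sqrt (8 * S * 0)"
    by (intro tendsto_intros elim)
  then have "(\<lambda>n. (2 * S + 1) * sqrt (8 * S * e n)) \<longlonglongrightarrow> 0" by simp
  then have "\<forall>\<^sub>F n in sequentially. (2 * S + 1) * sqrt (8 * S * e n) < cmod (\<mu> - 4)"
    by (rule order_tendstoD) (use mu in simp)
  moreover have "\<forall>\<^sub>F n in sequentially. e n < 1" using elim by (rule order_tendstoD) simp
  ultimately have "\<forall>\<^sub>F n in sequentially. False"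
    by eventually_elim (use est in \<open>meson less_imp_le not_le\<close>)
  then show False by simp
qed

text \<open>If \<open>h\<close> is unbounded, one may always pass to a child below which it is
  unbounded. On that branch every new trace is eventually of modulus above 2. Either both adjacent
  regions are so too, and the branch points inward forever, or a small region stays adjacent, and
  the branch is a fan around it.\<close>

theorem bounded: "\<exists>M. \<forall>t. below r0 t \<longrightarrow> \<bar>h t\<bar> \<le> M"
proof (rule ccontr)
  assume "\<not> ?thesis"
  then have nb: "\<not> bdd_below r0" by (simp add: bdd_below_def)
  define nxt where "nxt s = (if bdd_below (left s) then right s else left s)" for s
  define \<sigma> where "\<sigma> n = (nxt ^^ n) r0" for n
  have f: "\<sigma> (Suc n) \<in> {left (\<sigma> n), right (\<sigma> n)}" for n by (simp add: \<sigma>_def nxt_def)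
  have un: "\<not> bdd_below (\<sigma> n)" for n
  proof (induction n)
    case (Suc n)
    then show ?case using bdd_below_children[of "\<sigma> n"] by (auto simp: \<sigma>_def nxt_def)
  qed (simp add: \<sigma>_def nb)
  have r: "below r0 (\<sigma> n)" for n
  proof (induction n)
    case (Suc n)
    then show ?case using f[of n] by (auto intro: below.intros)
  qed (simp add: \<sigma>_def below.refl)
  have "finite {n. cmod (tw (\<sigma> n)) \<le> 2}" by (rule fin[of \<sigma>, OF _ f]) (simp add: \<sigma>_def)
  then obtain N where N: "{n. cmod (tw (\<sigma> n)) \<le> 2} \<subseteq> {..<N}" using finite_nat_bounded by blast
  then have big: "cmod (tw (\<sigma> n)) > 2" if "n \<ge> N" for n
    using that by (metis (mono_tags, lifting) lessThan_iff linorder_not_le mem_Collect_eq subset_eq)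
  have inward: "cmod (tw (\<sigma> n)) < cmod (tz (\<sigma> n))" if "cmod (tx (\<sigma> n)) > 2" "cmod (ty (\<sigma> n)) > 2" for n
  proof (rule ccontr)
    assume "\<not> ?thesis"
    \<comment> \<open>The threshold may depend on the edge, as only boundedness below this edge is
      wanted.\<close>
    then have "outward (min (cmod (tx (\<sigma> n))) (cmod (ty (\<sigma> n)))) (\<sigma> n)" by (simp add: outward_def)
    then show False using outward_bdd[OF r[of n]] un[of n] that by fastforce
  qed
  \<comment> \<open>Once both adjacent traces are large they remain so, since all later regions are
    large.\<close>
  have small: "cmod (tx (\<sigma> n)) \<le> 2 \<or> cmod (ty (\<sigma> n)) \<le> 2" if n: "n \<ge> N" for n
  proof (rule ccontr)
    assume *: "\<not> ?thesis"
    have "cmod (tx (\<sigma> m)) > 2 \<and> cmod (ty (\<sigma> m)) > 2" if "m \<ge> n" for m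
      using that
    proof (induction m rule: dec_induct)
      case (step m)
      then show ?case using f[of m] left[OF r[of m]] right[OF r[of m]] big[of m] n by auto
    qed (use * in auto)
    then show False
      using no_inward_path[of \<sigma> n, OF r f] big inward n by (meson le_trans)
  qed
  show False
  \<comment> \<open>A small region in the first position is kept only by \<open>left\<close>, one in
    the second position only by \<open>right\<close>; any other step would leave two large
    regions.\<close>
  proof (cases "\<exists>n\<ge>N. cmod (tx (\<sigma> (Suc n))) \<le> 2 \<and> cmod (ty (\<sigma> (Suc n))) > 2")
    case True
    then obtain n where n: "n \<ge> N" "cmod (tx (\<sigma> (Suc n))) \<le> 2" "cmod (ty (\<sigma> (Suc n))) > 2" by blast
    have "cmod (tx (\<sigma> m)) \<le> 2 \<and> cmod (ty (\<sigma> m)) > 2 \<and> \<sigma> (Suc m) = left (\<sigma> m)" if "m \<ge> Suc n" for m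
      using that
    proof (induction m rule: dec_induct)
      case base
      then show ?case using n f[of "Suc n"] right[OF r[of "Suc n"]] big[of "Suc n"] small[of "Suc (Suc n)"]
        by (auto split: if_splits)
    next
      case (step m)
      then have "cmod (tx (\<sigma> (Suc m))) \<le> 2 \<and> cmod (ty (\<sigma> (Suc m))) > 2"
        using left[OF r[of m]] big[of m] n by simp
      then show ?case using f[of "Suc m"] right[OF r[of "Suc m"]] big[of "Suc m"] small[of "Suc (Suc m)"] n step
        by (auto split: if_splits)
    qed
    then show False using left_fan[of \<sigma> "Suc n", OF r] big n un by (meson Suc_leD le_trans)
  next
    case False
    have one: "cmod (tx (\<sigma> (Suc n))) > 2 \<or> cmod (ty (\<sigma> (Suc n))) > 2" if "n \<ge> N" for n
      using f[of n] left[OF r[of n]] right[OF r[of n]] big[OF that] by (auto split: if_splits)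
    have "\<sigma> (Suc m) = right (\<sigma> m)" if "m \<ge> Suc N" for m
    proof -
      obtain n where m: "m = Suc n" "n \<ge> N" using \<open>m \<ge> Suc N\<close> by (cases m) auto
      have "cmod (tx (\<sigma> m)) > 2" using one[OF m(2)] small[of m] False m by force
      then have "\<sigma> (Suc m) \<noteq> left (\<sigma> m)"
        using left[OF r[of m]] big[of m] small[of "Suc m"] m by auto
      then show ?thesis using f[of m] by blast
    qed
    then show False using right_fan[of \<sigma> "Suc N", OF r] big un by (meson Suc_leD)
  qed
qed

end

section \<open>Two by two matrices\<close>

definition mk :: "complex \<Rightarrow> complex \<Rightarrow> complex \<Rightarrow> complex \<Rightarrow> mat2" where
  "mk a b c d = vector [vector [a, b], vector [c, d]]"

lemma mk_nth [simp]: "mk a b c d $ 1 $ 1 = a" "mk a b c d $ 1 $ 2 = b" "mk a b c d $ 2 $ 1 = c" "mk a b c d $ 2 $ 2 = d"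
  by (simp_all add: mk_def)

lemma mat2_eq_iff: "M = N \<longleftrightarrow> M$1$1 = N$1$1 \<and> M$1$2 = N$1$2 \<and> M$2$1 = N$2$1 \<and> M$2$2 = (N::mat2)$2$2"
  by (auto simp: vec_eq_iff forall_2)

lemma mk_eq_iff [simp]: "mk a b c d = mk a' b' c' d' \<longleftrightarrow> a = a' \<and> b = b' \<and> c = c' \<and> d = d'"
  by (simp add: mat2_eq_iff)

lemma mat2_cases: obtains a b c d where "M = mk a b c d"
  by (rule that[of "M$1$1" "M$1$2" "M$2$1" "M$2$2"]) (simp add: mat2_eq_iff)

lemma mult_mk [simp]: "mk a b c d ** mk a' b' c' d' = mk (a*a' + b*c') (a*b' + b*d') (c*a' + d*c') (c*b' + d*d')"
  by (simp add: mat2_eq_iff matrix_matrix_mult_def sum_2)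

lemma det_mk [simp]: "det (mk a b c d) = a * d - b * c"
  by (simp add: det_2)

lemma trace_mk [simp]: "trace (mk a b c d) = a + d"
  by (simp add: trace_def sum_2)

lemma mat_mk: "(mat k :: mat2) = mk k 0 0 k"
  by (simp add: mat2_eq_iff mat_def)

lemma arith_mk [simp]: "mk a b c d + mk a' b' c' d' = mk (a + a') (b + b') (c + c') (d + d')"
  "mk a b c d - mk a' b' c' d' = mk (a - a') (b - b') (c - c') (d - d')"
  "- mk a b c d = mk (- a) (- b) (- c) (- d)"
  by (simp_all add: mat2_eq_iff)

text \<open>The adjugate, which is the inverse on determinant 1 and at the same time linear.\<close>

definition adj :: "mat2 \<Rightarrow> mat2" where
  "adj M = mk (M$2$2) (- M$1$2) (- M$2$1) (M$1$1)"

lemma adj_mk [simp]: "adj (mk a b c d) = mk d (- b) (- c) a"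
  by (simp add: adj_def)

lemma adj_adj [simp]: "adj (adj M) = M" and det_adj [simp]: "det (adj M) = det M"
  and trace_adj [simp]: "trace (adj M) = trace M" and adj_one [simp]: "adj (mat 1) = mat 1"
  and adj_mult: "adj (M ** N) = adj N ** adj M"
  by (cases M rule: mat2_cases; cases N rule: mat2_cases; simp add: mat_mk algebra_simps)+

lemma mult_adj: "det M = 1 \<Longrightarrow> M ** adj M = mat 1" "det M = 1 \<Longrightarrow> adj M ** M = mat 1"
  by (cases M rule: mat2_cases; simp add: mat_mk algebra_simps)+

lemma mult_adj_assoc: "det M = 1 \<Longrightarrow> M ** (adj M ** N) = N" "det M = 1 \<Longrightarrow> adj M ** (M ** N) = N"
  by (simp_all add: matrix_mul_assoc mult_adj)

lemma adj_unique: "det M = 1 \<Longrightarrow> M ** N = mat 1 \<Longrightarrow> N = adj M"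
  by (metis matrix_mul_rid mult_adj_assoc(2))

lemma trace_mult_commute: "trace (M ** N) = trace (N ** (M :: mat2))"
  by (cases M rule: mat2_cases; cases N rule: mat2_cases) (simp add: algebra_simps)

lemma trace_conj: "det G = 1 \<Longrightarrow> trace (adj G ** M ** G) = trace M"
  by (subst trace_mult_commute) (simp add: mult_adj_assoc)

text \<open>Cayley-Hamilton in the form \<open>M + adj M = trace M\<close>.\<close>

lemma trace_identity: "trace (adj M ** N) + trace (M ** N) = trace M * trace (N :: mat2)"
  "trace (M ** adj N) + trace (M ** N) = trace M * trace (N :: mat2)"
  by (cases M rule: mat2_cases; cases N rule: mat2_cases; simp add: algebra_simps)+

text \<open>The commutator identity of Fricke, with the group commutator replaced by the Lie bracket.\<close>

lemma fricke:
  assumes "det M = 1" "det N = 1"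
  shows "(trace M)\<^sup>2 + (trace N)\<^sup>2 + (trace (M ** N))\<^sup>2 - trace M * trace N * trace (M ** N) =
    4 - det (M ** N - N ** (M :: mat2))"
proof -
  obtain a b c d a' b' c' d' where M: "M = mk a b c d" "N = mk a' b' c' d'"
    by (metis mat2_cases)
  have "a * d - b * c = 1" "a' * d' - b' * c' = 1" using assms M by auto
  then show ?thesis unfolding M by simp algebra
qed

section \<open>Evaluation of words\<close>

definition ev_letter :: "mat2 \<Rightarrow> mat2 \<Rightarrow> letter \<Rightarrow> mat2" where
  "ev_letter A B l = (let M = (case fst l of X \<Rightarrow> A | Y \<Rightarrow> B) in if snd l then M else adj M)"

definition ev :: "mat2 \<Rightarrow> mat2 \<Rightarrow> letter list \<Rightarrow> mat2" where
  "ev A B w = foldr (\<lambda>l M. ev_letter A B l ** M) w (mat 1)"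

lemma ev_simps [simp]: "ev A B [] = mat 1" "ev A B (l # w) = ev_letter A B l ** ev A B w"
  by (simp_all add: ev_def)

lemma ev_append [simp]: "ev A B (u @ v) = ev A B u ** ev A B v"
  by (induction u) (simp_all add: matrix_mul_assoc)

lemma ev_letter_inv: "ev_letter A B (inv_letter l) = adj (ev_letter A B l)"
  by (simp add: ev_letter_def inv_letter_def Let_def)

lemma ev_winv [simp]: "ev A B (winv w) = adj (ev A B w)"
  by (induction w) (simp_all add: ev_letter_inv adj_mult)

lemma det_ev_letter: "det A = 1 \<Longrightarrow> det B = 1 \<Longrightarrow> det (ev_letter A B l) = 1"
  by (simp add: ev_letter_def Let_def split: gen.split)

lemma det_ev: "det A = 1 \<Longrightarrow> det B = 1 \<Longrightarrow> det (ev A B w) = 1"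
  by (induction w) (simp_all add: det_mul det_ev_letter)

lemma ev_push: assumes "det A = 1" "det B = 1" shows "ev A B (push l w) = ev_letter A B l ** ev A B w"
  by (cases w) (auto simp: ev_letter_inv mult_adj_assoc det_ev_letter assms)

lemma ev_reduce: assumes "det A = 1" "det B = 1" shows "ev A B (reduce w) = ev A B w"
  by (induction w) (auto simp: reduce_def ev_push assms)

lemma ev_weq: assumes "det A = 1" "det B = 1" "u \<doteq> v" shows "ev A B u = ev A B v"
  by (metis assms ev_reduce weq_iff_reduce)

lemma ev_conj:
  assumes "det A = 1" "det B = 1" "det G = 1"
  shows "ev (adj G ** A ** G) (adj G ** B ** G) w = adj G ** ev A B w ** G"
proof (induction w)
  case Nil
  then show ?case by (simp add: mult_adj assms)
next
  case (Cons l w)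
  have "ev_letter (adj G ** A ** G) (adj G ** B ** G) l = adj G ** ev_letter A B l ** G"
    by (simp add: ev_letter_def Let_def adj_mult matrix_mul_assoc split: gen.split)
  then have "ev (adj G ** A ** G) (adj G ** B ** G) (l # w) = adj G ** ev_letter A B l ** (G ** (adj G ** (ev A B w ** G)))"
    using Cons by (simp add: matrix_mul_assoc)
  also have "\<dots> = adj G ** ev_letter A B l ** (ev A B w ** G)"
    using assms by (simp only: mult_adj_assoc)
  finally show ?case by (simp add: matrix_mul_assoc)
qed

lemma ev_hom: assumes "det A = 1" "det B = 1" shows "ev A B \<in> hom F2 SL2C"
  by (rule homI) (simp_all add: F2_simps SL2C_def det_ev ev_reduce assms)

lemma hom_det: "\<rho> \<in> hom F2 SL2C \<Longrightarrow> reduced w \<Longrightarrow> det (\<rho> w) = 1"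
  using hom_in_carrier[of \<rho> F2 SL2C w] by (simp add: F2_simps SL2C_def)

lemma hom_reduce_append:
  "\<rho> \<in> hom F2 SL2C \<Longrightarrow> reduced u \<Longrightarrow> reduced v \<Longrightarrow> \<rho> (reduce (u @ v)) = \<rho> u ** \<rho> v"
  using hom_mult[of \<rho> F2 SL2C u v] by (simp add: F2_simps SL2C_def)

lemma hom_eq_ev:
  assumes "\<rho> \<in> hom F2 SL2C" "reduced w"
  shows "\<rho> w = ev (\<rho> gen_a) (\<rho> gen_b) w"
proof -
  have one: "\<rho> [] = mat 1"
    using hom_one[OF assms(1) group_F2 group_SL2C] by (simp add: F2_simps SL2C_def)
  have inv: "\<rho> [(g, False)] = adj (\<rho> [(g, True)])" for g
    using hom_reduce_append[OF assms(1), of "[(g, True)]" "[(g, False)]"] one hom_det[OF assms(1), of "[(g, True)]"]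
    by (intro adj_unique) (auto simp: reduce_def)
  have letter: "\<rho> [l] = ev_letter (\<rho> gen_a) (\<rho> gen_b) l" for l
    using inv by (cases l; cases "fst l"; cases "snd l") (auto simp: ev_letter_def gen_a_def gen_b_def)
  show ?thesis
    using assms(2)
  proof (induction w)
    case (Cons l w)
    then have "\<rho> (l # w) = \<rho> [l] ** \<rho> w"
      using hom_reduce_append[OF assms(1), of "[l]" w] reduce_reduced[of "l # w"] by (simp add: reduced_Cons)
    then show ?case using Cons letter by (simp add: reduced_Cons)
  qed (simp add: one)
qed

text \<open>Exchanging the diagonal entries is an anti-automorphism; it reverses words in matrices with equal
  diagonal entries.\<close>

definition flip :: "mat2 \<Rightarrow> mat2" where
  "flip M = mk (M$2$2) (M$1$2) (M$2$1) (M$1$1)"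

lemma flip_mk [simp]: "flip (mk a b c d) = mk d b c a"
  by (simp add: flip_def)

lemma flip_mult: "flip (M ** N) = flip N ** flip M" and flip_adj: "flip (adj M) = adj (flip M)"
  and flip_one [simp]: "flip (mat 1) = mat 1"
  by (cases M rule: mat2_cases; cases N rule: mat2_cases; simp add: mat_mk algebra_simps)+

lemma flip_ev:
  assumes "flip A = A" "flip B = B" shows "flip (ev A B w) = ev A B (rev w)"
proof (induction w)
  case (Cons l w)
  have "flip (ev_letter A B l) = ev_letter A B l"
    using assms by (simp add: ev_letter_def Let_def flip_adj split: gen.split)
  then show ?case using Cons by (simp add: flip_mult)
qed simp

lemma flip_fixed: assumes "flip M = M" obtains t y z where "M = mk t y z t"
proof (rule that)
  show "M = mk (M$1$1) (M$1$2) (M$2$1) (M$1$1)"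
    using arg_cong[OF assms, of "\<lambda>N. N$1$1"] by (simp add: mat2_eq_iff flip_def)
qed

section \<open>Displacement of the axes\<close>

text \<open>For equal diagonal entries the fixed points are the square roots of the quotient of the
  off-diagonal entries, so this is twice the logarithm of the height at which the axis crosses the
  vertical line.\<close>

definition height :: "mat2 \<Rightarrow> real" where
  "height M = ln (cmod (M$1$2)) - ln (cmod (M$2$1))"

lemma height_adj [simp]: "height (adj M) = height M"
  by (simp add: height_def adj_def)

text \<open>With \<open>x = (ln s - ln t) / 2\<close> this is
  \<open>|x| \<le> |sinh x|\<close>.\<close>

lemma abs_ln_diff_le:
  fixes s t :: real assumes "s > 0" "t > 0"
  shows "\<bar>ln s - ln t\<bar> \<le> \<bar>s - t\<bar> / sqrt (s * t)"
proof -
  define x where "x = (ln s - ln t) / 2"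
  define a b where "a = sqrt s" "b = sqrt t"
  have ab: "a > 0" "b > 0" "s = a * a" "t = b * b" using assms by (simp_all add: a_b_def)
  have "exp x = exp (ln a) / exp (ln b)"
    unfolding exp_diff[symmetric] x_def using ab by (simp add: ln_mult)
  then have e: "exp x = a / b" using ab by simp
  have "(a / b - inverse (a / b)) / 2 = (a * a - b * b) / (2 * (a * b))"
    using ab(1,2) by (simp add: field_simps)
  moreover have "sqrt (s * t) = a * b" by (simp add: a_b_def real_sqrt_mult)
  ultimately have sh: "(exp x - inverse (exp x)) / 2 = (s - t) / (2 * sqrt (s * t))"
    unfolding e ab(3,4) by metis
  have "\<bar>x\<bar> \<le> \<bar>(s - t) / (2 * sqrt (s * t))\<bar>" unfolding sh[symmetric] by (rule real_le_abs_sinh)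
  also have "\<dots> = \<bar>s - t\<bar> / (2 * sqrt (s * t))" using assms by (simp add: abs_divide)
  finally show ?thesis by (simp add: x_def abs_divide)
qed

text \<open>The bracket of two such matrices is diagonal, so its entries compare the quotients of the
  off-diagonal entries.\<close>

lemma height_step:
  assumes P: "flip P = P" "det P = 1" and R: "flip R = R" "det R = 1"
    and k: "cmod ((P ** R - R ** P)$1$1) = k"
    and ne: "(trace P)\<^sup>2 \<noteq> 4" "(trace R)\<^sup>2 \<noteq> 4"
  shows "\<bar>height R - height P\<bar> \<le> 4 * k / sqrt (cmod ((trace P)\<^sup>2 - 4) * cmod ((trace R)\<^sup>2 - 4))"
proof -
  obtain a b c where P': "P = mk a b c a" using P(1) by (rule flip_fixed)
  obtain p q r where R': "R = mk p q r p" using R(1) by (rule flip_fixed)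
  \<comment> \<open>The trace is twice the diagonal entry, so \<open>x^2 - 4\<close> is four times
    the product of the off-diagonal entries; this is the origin of the factor 4.\<close>
  have bc: "(trace P)\<^sup>2 - 4 = 4 * (b * c)" and qr: "(trace R)\<^sup>2 - 4 = 4 * (q * r)"
  proof -
    have "a * a - b * c = 1" "p * p - q * r = 1" using P(2) R(2) by (simp_all add: P' R')
    then have "(a + a)\<^sup>2 - 4 = 4 * (b * c)" "(p + p)\<^sup>2 - 4 = 4 * (q * r)" by algebra+
    then show "(trace P)\<^sup>2 - 4 = 4 * (b * c)" "(trace R)\<^sup>2 - 4 = 4 * (q * r)" by (simp_all add: P' R')
  qed
  then have nz: "b \<noteq> 0" "c \<noteq> 0" "q \<noteq> 0" "r \<noteq> 0" using ne by auto
  define s where "s = cmod (b * r)"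
  define t where "t = cmod (c * q)"
  have pos: "s > 0" "t > 0" using nz by (simp_all add: s_def t_def)
  have "height R - height P = ln t - ln s"
    using nz by (simp add: height_def P' R' s_def t_def norm_mult ln_mult)
  then have "\<bar>height R - height P\<bar> \<le> \<bar>t - s\<bar> / sqrt (t * s)" using abs_ln_diff_le[OF pos(2,1)] by simp
  also have "\<dots> \<le> k / sqrt (t * s)"
  proof (intro divide_right_mono)
    have "k = cmod (b * r - c * q)" using k by (simp add: P' R' algebra_simps)
    then show "\<bar>t - s\<bar> \<le> k" using norm_triangle_ineq3[of "b * r" "c * q"] by (simp add: s_def t_def)
  qed (use pos in simp)
  also have "sqrt (t * s) = sqrt (cmod ((trace P)\<^sup>2 - 4) * cmod ((trace R)\<^sup>2 - 4)) / 4"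
    unfolding bc qr by (simp add: s_def t_def norm_mult real_sqrt_mult algebra_simps)
  finally show ?thesis by (simp add: algebra_simps)
qed

section \<open>Bounded displacement for the BQ-conditions\<close>

lemma ext_conj_refl: "g \<in> primitives \<Longrightarrow> (g, g) \<in> ext_conj"
proof -
  assume g: "g \<in> primitives"
  then have "g = [] \<otimes>\<^bsub>F2\<^esub> g \<otimes>\<^bsub>F2\<^esub> inv\<^bsub>F2\<^esub> []"
    by (simp add: F2_simps inv_F2 primitives_altdef reduce_reduced)
  moreover have "[] \<in> carrier F2" by (simp add: F2_simps)
  ultimately show ?thesis using g unfolding ext_conj_def by blast
qed

lemma ext_conj_wt: "(u, v) \<in> ext_conj \<Longrightarrow> \<bar>wt i j v\<bar> = \<bar>wt i j u\<bar>"
  by (auto simp: ext_conj_def F2_simps inv_F2 primitives_altdef)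

text \<open>Up to sign the exponent sums are invariants of the extended conjugacy class.\<close>

lemma finite_abs_wt:
  assumes "finite (S // ext_conj)" "S \<subseteq> primitives"
  shows "finite ((\<lambda>g. \<bar>wt i j g\<bar>) ` S)"
proof (rule finite_subset)
  show "(\<lambda>g. \<bar>wt i j g\<bar>) ` S \<subseteq> (\<lambda>c. \<bar>wt i j (SOME x. x \<in> c)\<bar>) ` (S // ext_conj)"
  proof
    fix k assume "k \<in> (\<lambda>g. \<bar>wt i j g\<bar>) ` S"
    then obtain g where g: "g \<in> S" "k = \<bar>wt i j g\<bar>" by auto
    have "g \<in> ext_conj `` {g}" using ext_conj_refl g assms(2) by auto
    then have "(SOME x. x \<in> ext_conj `` {g}) \<in> ext_conj `` {g}" by (rule someI)
    then have "\<bar>wt i j (SOME x. x \<in> ext_conj `` {g})\<bar> = k" using ext_conj_wt g by simp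
    moreover have "ext_conj `` {g} \<in> S // ext_conj" using g by (auto simp: quotient_def)
    ultimately show "k \<in> (\<lambda>c. \<bar>wt i j (SOME x. x \<in> c)\<bar>) ` (S // ext_conj)"
      by (auto intro!: image_eqI)
  qed
  show "finite ((\<lambda>c. \<bar>wt i j (SOME x. x \<in> c)\<bar>) ` (S // ext_conj))" using assms(1) by simp
qed

section \<open>The regions around an edge as words\<close>

fun region_x :: "state \<Rightarrow> letter list" where "region_x (k, P, R) = P"
fun region_y :: "state \<Rightarrow> letter list" where "region_y (k, P, R) = (if k then P @ R else R)"
fun region_w :: "state \<Rightarrow> letter list" where "region_w (k, P, R) = (if k then P @ P @ R else P @ R)"
fun region_z :: "state \<Rightarrow> letter list" where "region_z (k, P, R) = (if k then R else P @ winv R)"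

text \<open>Positive on the regions of the half tree \<open>b\<close> and additive at each vertex:
  the sum of numerator and denominator of the slope. It therefore increases strictly along
  branches.\<close>

abbreviation orient :: "bool \<Rightarrow> letter list \<Rightarrow> int" where
  "orient b \<equiv> wt 1 (if b then 1 else - 1)"

lemma orient_region_w: "orient b (region_w s) = orient b (region_x s) + orient b (region_y s)"
  by (cases s rule: region_w.cases) simp

lemma orient_children:
  "orient b (region_x (left s)) = orient b (region_x s)"
  "orient b (region_y (left s)) = orient b (region_w s)"
  "orient b (region_x (right s)) = (if fst s then orient b (region_w s) else orient b (region_y s))"
  "orient b (region_y (right s)) = (if fst s then orient b (region_y s) else orient b (region_w s))"
  by (cases s rule: left.cases; simp)+

lemma orient_positive:
  "below (farey_root b) s \<Longrightarrow> orient b (region_x s) \<ge> 1 \<and> orient b (region_y s) \<ge> 1"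
proof (induction rule: below.induct)
  case (left t)
  then show ?case using orient_region_w[of b t] by (simp add: orient_children)
next
  case (right t)
  then show ?case using orient_region_w[of b t] by (simp add: orient_children)
qed (simp add: farey_root_def)

lemma region_primitive:
  assumes "tree s"
  shows "reduce (region_x s) \<in> primitives" "reduce (region_y s) \<in> primitives" "reduce (region_w s) \<in> primitives"
proof -
  obtain k P R where s: "s = (k, P, R)" by (cases s rule: region_x.cases)
  then have b: "basis P R" using assms tree_basis by blast
  then show "reduce (region_x s) \<in> primitives" "reduce (region_y s) \<in> primitives" "reduce (region_w s) \<in> primitives"
    using basis_primitives[OF b] basis_primitives(2)[OF basis_moves(3)[OF b]]
      basis_primitives(2)[OF basis_moves(3)[OF basis_moves(3)[OF b]]] s by auto
qed

lemma mult_diff_right: "(M :: mat2) ** (N - N') = M ** N - M ** (N' :: mat2)"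
  by (cases M rule: mat2_cases; cases N rule: mat2_cases; cases N' rule: mat2_cases)
    (simp add: algebra_simps)

lemma mult_diff_left: "(N - N') ** M = N ** M - N' ** (M :: mat2)"
  for N N' :: mat2
  by (cases M rule: mat2_cases; cases N rule: mat2_cases; cases N' rule: mat2_cases)
    (simp add: algebra_simps)

text \<open>Coordinates in which the hyperelliptic axis of \<open>A\<close> and \<open>B\<close> is
  the vertical line; the half turn about it is the bracket up to a scalar.\<close>

locale bq_frame =
  fixes A B :: mat2 and q :: complex
  assumes det: "det A = 1" "det B = 1" and flip: "flip A = A" "flip B = B"
    and bracket: "A ** B - B ** A = mk q 0 0 (- q)" and q: "q \<noteq> 0"
    and lox: "\<And>g. g \<in> primitives \<Longrightarrow> trace (ev A B g) \<notin> complex_of_real ` {-2..2}"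
    and fin: "finite ({g \<in> primitives. cmod (trace (ev A B g)) \<le> 2} // ext_conj)"
begin

abbreviation E :: "letter list \<Rightarrow> mat2" where "E \<equiv> ev A B"
abbreviation Q :: mat2 where "Q \<equiv> mk q 0 0 (- q)"

text \<open>The bracket of \<open>P\<close> and \<open>P R P\<close> is
  \<open>P (P R - R P) P\<close>, and a matrix with equal diagonal entries and determinant 1
  satisfies \<open>Q P = P^-1 Q\<close>, so \<open>P Q P = Q\<close>.\<close>

lemma bracket_palindrome:
  assumes "flip P = P" "det P = 1" "P ** R - R ** P = Q \<or> P ** R - R ** P = - Q"
  shows "P ** (P ** R ** P) - (P ** R ** P) ** P = P ** R - R ** P"
proof -
  obtain t y z where P: "P = mk t y z t" using assms(1) by (rule flip_fixed)
  obtain a b c d where R: "R = mk a b c d" by (rule mat2_cases)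
  have d: "t * t - y * z = 1" using assms(2) P by simp
  have "y * d + t * b = b * t + a * y" "z * a + t * c = c * t + d * z"
    using assms(3) by (auto simp: P R algebra_simps)
  then show ?thesis using d unfolding P R
    by (simp, intro conjI; algebra)
qed

lemma tree_bracket:
  assumes "tree (k, P, R)"
  shows "E P ** E R - E R ** E P = Q \<or> E P ** E R - E R ** E P = - Q"
proof -
  have fl: "flip (E P) = E P" if "tree (k, P, R)" for k P R
    using flip_ev[OF flip, of P] tree_pal[OF that] by simp
  have "case s of (k, P, R) \<Rightarrow> E P ** E R - E R ** E P = Q \<or> E P ** E R - E R ** E P = - Q" if "tree s" for s
    using that
  proof (induction rule: tree_induct)
    case (root b)
    have "A ** adj B - adj B ** A = - (A ** B - B ** A)"
      by (cases A rule: mat2_cases; cases B rule: mat2_cases; simp add: algebra_simps)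
    then show ?case using bracket by (cases b) (simp_all add: farey_root_def ev_letter_def)
  next
    case (left t)
    then show ?case
    proof (cases t rule: left.cases)
      case (2 P R)
      then have "E P ** E (P @ R @ P) - E (P @ R @ P) ** E P = E P ** E R - E R ** E P"
        using bracket_palindrome[of "E P" "E R"] fl[of True P R] left by (simp add: det_ev det matrix_mul_assoc)
      then show ?thesis using left 2 by simp
    qed simp
  next
    case (right t)
    then show ?case
    proof (cases t rule: right.cases)
      case (1 P R)
      then have "E P ** E R - E R ** E P = Q \<or> E P ** E R - E R ** E P = - Q" using right by simp
      then have "E R ** E P - E P ** E R = Q \<or> E R ** E P - E P ** E R = - Q"
        by (metis minus_diff_eq minus_minus)
      then show ?thesis using 1 by simp
    next
      case (2 P R)
      have "E (P @ R @ P) ** E (winv P) - E (winv P) ** E (P @ R @ P) = E P ** E R - E R ** E P"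
        by (simp add: matrix_mul_assoc[symmetric] mult_adj mult_adj_assoc det_ev det)
      then show ?thesis using right 2 by simp
    qed
  qed
  then show ?thesis using assms by force
qed

definition tr :: "letter list \<Rightarrow> complex" where "tr w = trace (E w)"

lemma tr_reduce: "tr (reduce w) = tr w"
  by (simp add: tr_def ev_reduce det)

lemma tr_not_4: "tree s \<Longrightarrow> (tr (region_x s))\<^sup>2 \<noteq> 4"
proof
  assume "tree s" "(tr (region_x s))\<^sup>2 = 4"
  then have "(tr (region_x s) - 2) * (tr (region_x s) + 2) = 0" by (simp add: power2_eq_square algebra_simps)
  moreover have "2 \<in> complex_of_real ` {-2..2}" "- 2 \<in> complex_of_real ` {-2..2}"
    by (rule image_eqI[of _ _ 2], simp_all) (rule image_eqI[of _ _ "- 2"], simp_all)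
  ultimately have "tr (region_x s) \<in> complex_of_real ` {-2..2}"
    by (auto simp: add_eq_0_iff2)
  then show False
    using lox[OF region_primitive(1)[OF \<open>tree s\<close>]] tr_reduce unfolding tr_def by simp
qed

lemma height_edge:
  assumes "tree s" "tree s'" "E (region_x s) ** E (region_x s') - E (region_x s') ** E (region_x s) \<in> {Q, - Q}"
  shows "\<bar>height (E (region_x s')) - height (E (region_x s))\<bar> \<le>
    4 * cmod q / sqrt (cmod ((tr (region_x s))\<^sup>2 - 4) * cmod ((tr (region_x s'))\<^sup>2 - 4))"
proof -
  have fl: "flip (E (region_x s)) = E (region_x s)" if "tree s" for s
    using flip_ev[OF flip, of "region_x s"] that tree_pal by (cases s rule: region_x.cases) fastforce
  have "cmod ((E (region_x s) ** E (region_x s') - E (region_x s') ** E (region_x s))$1$1) = cmod q"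
  proof -
    from assms(3) consider "E (region_x s) ** E (region_x s') - E (region_x s') ** E (region_x s) = Q"
      | "E (region_x s) ** E (region_x s') - E (region_x s') ** E (region_x s) = - Q" by blast
    then show ?thesis by cases (simp_all only: arith_mk mk_nth norm_minus_cancel)
  qed
  then show ?thesis
    unfolding tr_def using fl assms(1,2) tr_not_4[OF assms(1)] tr_not_4[OF assms(2)]
    by (intro height_step) (auto simp: det_ev det tr_def)
qed

text \<open>Fricke's identity gives the vertex constant \<open>4 - det Q = 4 + q^2\<close>, and
  \<open>4 * cmod q\<close> is the constant of \<open>height_step\<close>. Finiteness along a branch
  comes from the second BQ-condition.\<close>

lemma trace_tree:
  "trace_tree (\<lambda>s. tr (region_x s)) (\<lambda>s. tr (region_y s)) (\<lambda>s. tr (region_z s)) (\<lambda>s. tr (region_w s))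
    (\<lambda>s. height (E (region_x s))) (farey_root b) (4 * cmod q) (4 + q\<^sup>2)"
proof
  fix s assume s: "below (farey_root b) s"
  then have t: "tree s" by (auto simp: tree_def)
  obtain k P R where kPR: "s = (k, P, R)" by (cases s rule: region_x.cases)
  note d = det_ev[OF det]
  have c1: "trace (E u ** E v) = trace (E v ** E u)" for u v by (rule trace_mult_commute)
  show "tr (region_z s) + tr (region_w s) = tr (region_x s) * tr (region_y s)"
  proof (cases k)
    case True
    have "trace (adj (E P) ** (E P ** E R)) + trace (E P ** (E P ** E R)) = trace (E P) * trace (E P ** E R)"
      by (rule trace_identity)
    then show ?thesis using True by (simp add: kPR tr_def mult_adj_assoc d)
  next
    case False
    then show ?thesis using trace_identity(2)[of "E P" "E R"] by (simp add: kPR tr_def)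
  qed
  have br: "det (E P ** E R - E R ** E P) = - q\<^sup>2"
    using tree_bracket[of k P R] t kPR by (auto simp: power2_eq_square)
  show "(tr (region_x s))\<^sup>2 + (tr (region_y s))\<^sup>2 + (tr (region_w s))\<^sup>2
      - tr (region_x s) * tr (region_y s) * tr (region_w s) = 4 + q\<^sup>2"
  proof (cases k)
    case True
    have "E P ** (E P ** E R) - (E P ** E R) ** E P = E P ** (E P ** E R - E R ** E P)"
      by (simp add: matrix_mul_assoc mult_diff_right)
    then have "det (E P ** (E P ** E R) - (E P ** E R) ** E P) = - q\<^sup>2"
      using br by (simp add: det_mul d)
    then show ?thesis using True fricke[of "E P" "E P ** E R"] by (simp add: kPR tr_def d det_mul)
  next
    case False
    then show ?thesis using br fricke[of "E P" "E R"] by (simp add: kPR tr_def d)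
  qed
  show "tr (region_x (left s)) = tr (region_x s)"
    by (cases s rule: left.cases) simp_all
  show "tr (region_y (left s)) = tr (region_w s)"
    using c1[of "P @ R" P] by (cases s rule: left.cases) (auto simp: tr_def kPR matrix_mul_assoc)
  show "tr (region_z (left s)) = tr (region_y s)"
  proof (cases k)
    case True
    have "E P ** adj (E P ** E R ** E P) = adj (E P ** E R)"
      by (simp add: adj_mult mult_adj_assoc d)
    then have "trace (E P ** adj (E P ** E R ** E P)) = trace (E P ** E R)" by (metis trace_adj)
    then show ?thesis using True by (simp add: kPR tr_def matrix_mul_assoc adj_mult)
  qed (simp add: kPR tr_def)
  show "tr (region_x (right s)) = (if fst s then tr (region_w s) else tr (region_y s))"
    using c1[of "P @ R" P] by (cases k) (auto simp: tr_def kPR matrix_mul_assoc)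
  have "E P ** E R ** E P ** adj (E P) = E P ** E R"
    by (simp add: matrix_mul_assoc[symmetric] mult_adj d)
  then show "tr (region_y (right s)) = (if fst s then tr (region_y s) else tr (region_w s))"
    using c1[of P R] by (cases k) (auto simp: tr_def kPR matrix_mul_assoc)
  show "tr (region_z (right s)) = tr (region_x s)"
  proof (cases k)
    case False
    have "E R ** adj (E R ** E P) = adj (E R) ** (E R ** (E R ** adj (E R ** E P)))"
      by (simp add: mult_adj_assoc d)
    then show ?thesis using False by (simp add: kPR tr_def)
  qed (simp add: kPR tr_def)
  show "tr (region_x s) \<notin> complex_of_real ` {-2..2}" "tr (region_y s) \<notin> complex_of_real ` {-2..2}"
    using lox[OF region_primitive(1)[OF t]] lox[OF region_primitive(2)[OF t]] tr_reduce
    by (simp_all add: tr_def)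
  show "height (E (region_x (left s))) = height (E (region_x s))"
    by (cases s rule: left.cases) simp_all
  have t': "tree (right s)" using t by (rule tree_intros(3))
  show "\<bar>height (E (region_x (right s))) - height (E (region_x s))\<bar>
      \<le> 4 * cmod q / sqrt (cmod ((tr (region_x s))\<^sup>2 - 4) * cmod ((tr (region_x (right s)))\<^sup>2 - 4))"
  proof (rule height_edge[OF t t'])
    show "E (region_x s) ** E (region_x (right s)) - E (region_x (right s)) ** E (region_x s) \<in> {Q, - Q}"
    proof (cases k)
      case True
      \<comment> \<open>The palindromes before and after this step are the two of the left child,
        whose bracket is known.\<close>
      then show ?thesis using tree_bracket[of False P "P @ R @ P"] tree_intros(2)[OF t] by (simp add: kPR)
    next
      case False
      then show ?thesis using tree_bracket[of False P R] t by (simp add: kPR)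
    qed
  qed
next
  fix \<sigma> :: "nat \<Rightarrow> state"
  assume s0: "\<sigma> 0 = farey_root b" and step: "\<And>n. \<sigma> (Suc n) \<in> {left (\<sigma> n), right (\<sigma> n)}"
  have r: "below (farey_root b) (\<sigma> n)" for n
  proof (induction n)
    case (Suc n)
    then show ?case using step[of n] by (auto intro: below.intros)
  qed (simp add: s0 below.refl)
  then have t: "tree (\<sigma> n)" for n by (auto simp: tree_def)
  \<comment> \<open>No value of \<open>orient\<close> occurs twice along the branch, while the
    regions with small trace have only finitely many values.\<close>
  have "orient b (region_w (\<sigma> n)) < orient b (region_w (\<sigma> (Suc n)))" for n
    using step[of n] orient_positive[OF r[of n]] orient_region_w[of b "\<sigma> n"] orient_region_w[of b "\<sigma> (Suc n)"]
      orient_children[of b "\<sigma> n"] by auto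
  then have "strict_mono (\<lambda>n. orient b (region_w (\<sigma> n)))" by (simp add: strict_mono_Suc_iff)
  then have inj: "inj (\<lambda>n. orient b (region_w (\<sigma> n)))" by (rule strict_mono_imp_inj_on)
  let ?S = "{g \<in> primitives. cmod (trace (E g)) \<le> 2}"
  have "(\<lambda>n. orient b (region_w (\<sigma> n))) ` {n. cmod (tr (region_w (\<sigma> n))) \<le> 2} \<subseteq>
      (\<lambda>g. \<bar>orient b g\<bar>) ` ?S"
  proof clarify
    fix n assume n: "cmod (tr (region_w (\<sigma> n))) \<le> 2"
    have "orient b (region_w (\<sigma> n)) \<ge> 0" using orient_positive[OF r[of n]] orient_region_w[of b "\<sigma> n"] by simp
    then have "orient b (region_w (\<sigma> n)) = \<bar>orient b (reduce (region_w (\<sigma> n)))\<bar>" by simp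
    moreover have "reduce (region_w (\<sigma> n)) \<in> ?S"
      using region_primitive(3)[OF t] n tr_reduce by (simp add: tr_def)
    ultimately show "orient b (region_w (\<sigma> n)) \<in> (\<lambda>g. \<bar>orient b g\<bar>) ` ?S" by (rule image_eqI)
  qed
  moreover have "finite ((\<lambda>g. \<bar>orient b g\<bar>) ` ?S)" using fin by (intro finite_abs_wt) auto
  ultimately show "finite {n. cmod (tr (region_w (\<sigma> n))) \<le> 2}"
    using finite_subset finite_imageD inj by (metis (no_types, lifting) inj_on_subset subset_UNIV)
qed (use q in auto)

theorem height_bounded: "\<exists>M. \<forall>w\<in>primitives. rev w = w \<longrightarrow> \<bar>height (E w)\<bar> \<le> M"
proof -
  have "\<exists>M. \<forall>s. below (farey_root b) s \<longrightarrow> \<bar>height (E (region_x s))\<bar> \<le> M" for b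
    by (rule trace_tree.bounded[OF trace_tree])
  then obtain M where M: "\<And>b s. below (farey_root b) s \<Longrightarrow> \<bar>height (E (region_x s))\<bar> \<le> M b" by metis
  have "\<bar>height (E w)\<bar> \<le> max (M True) (M False)" if w: "w \<in> primitives" "rev w = w" for w
  proof -
    obtain k P R where t: "tree (k, P, R)" and pm: "pm w P" using palindromic_primitive_in_tree[OF w] by blast
    have "E w = E P \<or> E w = adj (E P)"
      using pm ev_weq[OF det, of w P] ev_weq[OF det, of w "winv P"] by (auto simp: pm_def)
    then have "height (E w) = height (E P)" by auto
    moreover obtain b where "below (farey_root b) (k, P, R)" using t by (auto simp: tree_def)
    then have "\<bar>height (E P)\<bar> \<le> M b" using M[of b "(k, P, R)"] by simp
    ultimately show ?thesis by (cases b) auto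
  qed
  then show ?thesis by blast
qed

end

section \<open>The action on upper half-space via Hermitian matrices\<close>

text \<open>The positive Hermitian matrix of determinant 1 that represents the point; the action
  becomes \<open>H -> M H M^*\<close>, with \<open>ctr\<close> as the conjugate transpose.\<close>

definition herm :: "point \<Rightarrow> mat2" where
  "herm p = mk (of_real ((cmod (fst p))\<^sup>2 + (snd p)\<^sup>2) / of_real (snd p)) (fst p / of_real (snd p))
     (cnj (fst p) / of_real (snd p)) (1 / of_real (snd p))"

definition ctr :: "mat2 \<Rightarrow> mat2" where
  "ctr M = mk (cnj (M$1$1)) (cnj (M$2$1)) (cnj (M$1$2)) (cnj (M$2$2))"

lemma ctr_mk [simp]: "ctr (mk a b c d) = mk (cnj a) (cnj c) (cnj b) (cnj d)"
  by (simp add: ctr_def)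

lemma ctr_mult: "ctr (M ** N) = ctr N ** ctr M"
  by (cases M rule: mat2_cases; cases N rule: mat2_cases) (simp add: algebra_simps)

lemma det_ctr: "det (ctr M) = cnj (det M)"
  by (cases M rule: mat2_cases) simp

lemma det_herm: "p \<in> H3 \<Longrightarrow> det (herm p) = 1"
proof -
  assume p: "p \<in> H3"
  have "complex_of_real ((cmod (fst p))\<^sup>2) = fst p * cnj (fst p)" by (rule complex_norm_square)
  then show ?thesis using p unfolding herm_def of_real_add
    by (simp add: H3_def field_simps power2_eq_square)
qed

lemma Re_mult_cnj: "Re (u * cnj u) = (cmod u)\<^sup>2"
  by (metis complex_norm_square Re_complex_of_real)

lemma herm_inject: assumes "p \<in> H3" "q \<in> H3" "herm p = herm q" shows "p = q"
  using assms by (auto simp: herm_def H3_def prod_eq_iff)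

lemma act_mk:
  "act (mk a b c d) (z, t) =
     (let N = (cmod (c * z + d))\<^sup>2 + (cmod c)\<^sup>2 * t\<^sup>2
      in (((a * z + b) * cnj (c * z + d) + a * cnj c * of_real (t\<^sup>2)) / of_real N, t / N))"
  by (simp add: act_def Let_def)

lemma act_denominator_pos:
  assumes "a * d - b * c = 1" "t > 0"
  shows "(cmod (c * z + d))\<^sup>2 + (cmod c)\<^sup>2 * t\<^sup>2 > 0"
proof (cases "c = 0")
  case True
  then have "d \<noteq> 0" using assms(1) by auto
  then show ?thesis using True by simp
next
  case False
  then have "(cmod c)\<^sup>2 * t\<^sup>2 > 0" using assms(2) by simp
  then show ?thesis by (simp add: add_nonneg_pos)
qed

lemma herm_act:
  assumes "det M = 1" "p \<in> H3"
  shows "act M p \<in> H3" "herm (act M p) = M ** herm p ** ctr M"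
proof -
  obtain a b c d where M: "M = mk a b c d" by (rule mat2_cases)
  obtain z t where p: "p = (z, t)" by (cases p)
  have t: "t > 0" using assms(2) by (simp add: p H3_def)
  have det: "a * d - b * c = 1" using assms(1) by (simp add: M)
  define N where "N = (cmod (c * z + d))\<^sup>2 + (cmod c)\<^sup>2 * t\<^sup>2"
  define w where "w = (a * z + b) * cnj (c * z + d) + a * cnj c * of_real (t\<^sup>2)"
  have N: "N > 0" unfolding N_def by (rule act_denominator_pos[OF det t])
  have act: "act M p = (w / of_real N, t / N)" by (simp add: M p act_mk N_def w_def Let_def)
  show H: "act M p \<in> H3" using N t by (simp add: act H3_def)
  have zz: "complex_of_real ((cmod z)\<^sup>2) = z * cnj z" for z by (rule complex_norm_square)
  have Nc: "complex_of_real N = (c * z + d) * cnj (c * z + d) + c * cnj c * of_real (t\<^sup>2)"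
    unfolding N_def of_real_add of_real_mult zz by simp
  let ?K = "M ** herm p ** ctr M"
  have t0: "complex_of_real t \<noteq> 0" using t by simp
  have K: "?K$2$2 = of_real N / of_real t" "?K$1$2 = w / of_real t" "?K$2$1 = cnj w / of_real t"
    unfolding Nc w_def M p herm_def of_real_add zz using t0
    by (simp_all add: field_simps power2_eq_square)
  have L: "herm (act M p)$2$2 = of_real N / of_real t" "herm (act M p)$1$2 = w / of_real t"
    "herm (act M p)$2$1 = cnj w / of_real t"
    using N t by (simp_all add: act herm_def field_simps)
  \<comment> \<open>Three entries have been compared; the fourth is determined by determinant
    1.\<close>
  have "det ?K = 1" by (simp add: det_mul det_ctr det_herm assms)
  then have "?K$1$1 * ?K$2$2 = 1 + ?K$1$2 * ?K$2$1" unfolding det_2 by (simp add: algebra_simps)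
  moreover have "det (herm (act M p)) = 1" using H by (rule det_herm)
  then have "herm (act M p)$1$1 * herm (act M p)$2$2 = 1 + herm (act M p)$1$2 * herm (act M p)$2$1"
    unfolding det_2 by (simp add: algebra_simps)
  ultimately have "?K$1$1 * ?K$2$2 = herm (act M p)$1$1 * ?K$2$2" using K L by simp
  moreover have "?K$2$2 \<noteq> 0" using K N t by simp
  ultimately have "?K$1$1 = herm (act M p)$1$1" by simp
  then show "herm (act M p) = ?K" using K L by (simp add: mat2_eq_iff)
qed

lemma act_mult: assumes "det M = 1" "det N = 1" "p \<in> H3" shows "act (M ** N) p = act M (act N p)"
proof (rule herm_inject)
  show "act (M ** N) p \<in> H3" "act M (act N p) \<in> H3"
    by (simp_all add: herm_act(1) det_mul assms)
  show "herm (act (M ** N) p) = herm (act M (act N p))"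
    by (simp add: herm_act det_mul assms ctr_mult matrix_mul_assoc)
qed

lemma act_one: "act (mat 1) p = p"
  by (cases p) (simp add: mat_mk act_mk)

lemma act_adj: "det M = 1 \<Longrightarrow> p \<in> H3 \<Longrightarrow> act M (act (adj M) p) = p" "det M = 1 \<Longrightarrow> p \<in> H3 \<Longrightarrow> act (adj M) (act M p) = p"
  by (simp_all add: act_mult[symmetric] mult_adj act_one)

text \<open>The hyperbolic cosine of the distance.\<close>

definition chd :: "point \<Rightarrow> point \<Rightarrow> real" where
  "chd p q = 1 + (dist p q)\<^sup>2 / (2 * snd p * snd q)"

lemma hdist_chd: "hdist p q = arcosh (chd p q)"
  by (simp add: hdist_def chd_def)

lemma chd_ge_1: "p \<in> H3 \<Longrightarrow> q \<in> H3 \<Longrightarrow> chd p q \<ge> 1"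
  by (simp add: chd_def H3_def)

lemma dist_square: "(dist (z, s) (w, t))\<^sup>2 = (cmod (z - w))\<^sup>2 + (s - t)\<^sup>2" for z w :: complex and s t :: real
  unfolding dist_Pair_Pair by (simp add: dist_norm)

text \<open>The right-hand side does not change under \<open>H -> M H M^*\<close>, which makes the
  action isometric.\<close>

lemma chd_trace:
  assumes "p \<in> H3" "q \<in> H3"
  shows "complex_of_real (2 * chd p q) = trace (herm p ** adj (herm q))"
proof -
  obtain z s where p: "p = (z, s)" by (cases p)
  obtain w t where q: "q = (w, t)" by (cases q)
  have st: "complex_of_real s \<noteq> 0" "complex_of_real t \<noteq> 0" using assms by (auto simp: p q H3_def)
  have zz: "complex_of_real ((cmod z)\<^sup>2) = z * cnj z" for z by (rule complex_norm_square)
  have "complex_of_real (2 * chd p q) = 2 + ((z - w) * cnj (z - w) + (of_real s - of_real t)\<^sup>2) / (of_real s * of_real t)"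
    unfolding chd_def p q dist_square snd_conv zz[symmetric] using st by (simp add: field_simps)
  also have "\<dots> = trace (herm p ** adj (herm q))"
    unfolding p q herm_def of_real_add fst_conv snd_conv zz using st
    by (simp add: field_simps power2_eq_square)
  finally show ?thesis .
qed

lemma chd_act:
  assumes "det M = 1" "p \<in> H3" "q \<in> H3"
  shows "chd (act M p) (act M q) = chd p q"
proof -
  have c: "det (ctr M) = 1" using assms(1) by (simp add: det_ctr)
  have "complex_of_real (2 * chd (act M p) (act M q)) = trace (M ** herm p ** ctr M ** adj (M ** herm q ** ctr M))"
    by (subst chd_trace) (simp_all add: herm_act assms)
  also have "M ** herm p ** ctr M ** adj (M ** herm q ** ctr M) = M ** (herm p ** adj (herm q) ** adj M)"
    by (simp add: adj_mult matrix_mul_assoc[symmetric] mult_adj_assoc c)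
  also have "trace \<dots> = trace (herm p ** adj (herm q) ** (adj M ** M))"
    by (subst trace_mult_commute) (simp add: matrix_mul_assoc)
  also have "\<dots> = complex_of_real (2 * chd p q)"
    by (simp only: mult_adj[OF assms(1)] matrix_mul_rid chd_trace[OF assms(2,3)])
  finally have "2 * chd (act M p) (act M q) = 2 * chd p q" by (simp only: of_real_eq_iff)
  then show ?thesis by simp
qed

lemma hdist_act: "det M = 1 \<Longrightarrow> p \<in> H3 \<Longrightarrow> q \<in> H3 \<Longrightarrow> hdist (act M p) (act M q) = hdist p q"
  by (simp add: hdist_chd chd_act)

section \<open>Geodesics\<close>

definition vert :: "real \<Rightarrow> point" where "vert s = (0, exp s)"

lemma vert_H3 [simp]: "vert s \<in> H3" by (simp add: vert_def H3_def)

lemma hdist_vert: "hdist (vert s) (vert t) = \<bar>s - t\<bar>"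
proof -
  have "chd (vert s) (vert t) = cosh (s - t)"
    unfolding chd_def vert_def dist_square
    by (simp add: cosh_def exp_diff exp_minus field_simps power2_eq_square)
  then show ?thesis
    using arcosh_cosh_real[of "\<bar>s - t\<bar>"] by (cases "s \<ge> t") (simp_all add: hdist_chd cosh_minus[of "s - t", symmetric])
qed

lemma geodesic_vert: "det G = 1 \<Longrightarrow> unit_speed_geodesic (\<lambda>s. act G (vert (s + c)))"
  by (simp add: unit_speed_geodesic_def herm_act hdist_act hdist_vert)

text \<open>The half circle from \<open>- \<zeta>\<close> to \<open>\<zeta>\<close>.\<close>

definition arch :: "complex \<Rightarrow> real \<Rightarrow> point" where
  "arch \<zeta> s = (\<zeta> * of_real (tanh s), cmod \<zeta> / cosh s)"

text \<open>The map \<open>z -> \<zeta> (z - 1) / (z + 1)\<close>, which sends 0 and infinity to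
  \<open>- \<zeta>\<close> and \<open>\<zeta>\<close>; division by \<open>m\<close> normalises the
  determinant.\<close>

definition arch_matrix :: "complex \<Rightarrow> mat2" where
  "arch_matrix \<zeta> = (let m = csqrt (2 * \<zeta>) in mk (\<zeta> / m) (- \<zeta> / m) (1 / m) (1 / m))"

lemma det_arch_matrix: "\<zeta> \<noteq> 0 \<Longrightarrow> det (arch_matrix \<zeta>) = 1"
proof -
  assume z: "\<zeta> \<noteq> 0"
  have "csqrt (2 * \<zeta>) * csqrt (2 * \<zeta>) = 2 * \<zeta>" by (simp flip: power2_eq_square)
  then show ?thesis using z by (simp add: arch_matrix_def Let_def field_simps)
qed

lemma act_arch_matrix: assumes "\<zeta> \<noteq> 0" shows "act (arch_matrix \<zeta>) (vert s) = arch \<zeta> s"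
proof -
  define m where "m = csqrt (2 * \<zeta>)"
  have mm: "m * m = 2 * \<zeta>" by (simp add: m_def flip: power2_eq_square)
  then have m0: "m \<noteq> 0" using assms by auto
  have cm: "(cmod m)\<^sup>2 = 2 * cmod \<zeta>" using arg_cong[OF mm, of cmod] by (simp add: norm_mult power2_eq_square)
  define x where "x = exp s"
  have x: "x > 0" by (simp add: x_def)
  define N where "N = (cmod (1 / m))\<^sup>2 + (cmod (1 / m))\<^sup>2 * x\<^sup>2"
  have N: "N = (1 + x\<^sup>2) / (2 * cmod \<zeta>)" by (simp add: N_def norm_divide power_divide cm add_divide_distrib)
  have act: "act (arch_matrix \<zeta>) (vert s) = ((- \<zeta> / m * cnj (1 / m) + \<zeta> / m * cnj (1 / m) * of_real (x\<^sup>2)) / of_real N, x / N)"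
    by (simp add: arch_matrix_def act_mk vert_def Let_def m_def[symmetric] N_def x_def)
  have tanh: "tanh s = (x\<^sup>2 - 1) / (x\<^sup>2 + 1)"
  proof -
    have "tanh s = (x - inverse x) / (x + inverse x)"
      proof -
      have "(a / 2) / (b / 2) = a / b" for a b :: real by simp
      then show ?thesis unfolding tanh_def sinh_field_def cosh_field_def x_def exp_minus .
    qed
    also have "\<dots> = (x * (x - inverse x)) / (x * (x + inverse x))" using x by simp
    also have "\<dots> = (x\<^sup>2 - 1) / (x\<^sup>2 + 1)"
      using x by (simp add: right_diff_distrib distrib_left power2_eq_square)
    finally show ?thesis .
  qed
  have mcm: "m * cnj m = of_real (2 * cmod \<zeta>)" using cm by (simp add: complex_norm_square[symmetric])
  have "(- \<zeta> / m * cnj (1 / m) + \<zeta> / m * cnj (1 / m) * of_real (x\<^sup>2)) = \<zeta> * of_real (x\<^sup>2 - 1) / (m * cnj m)"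
    using m0 by (simp add: field_simps)
  also have "\<dots> / of_real N = \<zeta> * of_real ((x\<^sup>2 - 1) / (2 * cmod \<zeta>) / N)"
    unfolding mcm by simp
  also have "(x\<^sup>2 - 1) / (2 * cmod \<zeta>) / N = tanh s"
  proof -
    have "u / c / (v / c) = u / v" if "c \<noteq> 0" for u v c :: real using that by simp
    then show ?thesis unfolding N tanh using assms by (simp add: add.commute)
  qed
  finally have 1: "(- \<zeta> / m * cnj (1 / m) + \<zeta> / m * cnj (1 / m) * of_real (x\<^sup>2)) / of_real N = \<zeta> * of_real (tanh s)" .
  have "1 + x\<^sup>2 > 0" using x by (simp add: add_pos_nonneg)
  then have 2: "x / N = cmod \<zeta> / cosh s"
    unfolding N cosh_def using assms x by (simp add: x_def exp_minus field_simps power2_eq_square)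
  show ?thesis unfolding act arch_def 1 2 ..
qed

lemma arch_H3 [simp]: "\<zeta> \<noteq> 0 \<Longrightarrow> arch \<zeta> s \<in> H3"
  by (simp add: arch_def H3_def)

lemma geodesic_arch: assumes "det G = 1" "\<zeta> \<noteq> 0" shows "unit_speed_geodesic (\<lambda>s. act G (arch \<zeta> s))"
proof -
  have "unit_speed_geodesic (\<lambda>s. act (G ** arch_matrix \<zeta>) (vert (s + 0)))"
    by (rule geodesic_vert) (simp add: det_mul det_arch_matrix assms)
  then show ?thesis using assms by (simp add: act_mult det_arch_matrix act_arch_matrix)
qed

lemma range_shift: "range (\<lambda>s::real. f (s + c)) = range f"
proof (intro equalityI subsetI)
  fix y assume "y \<in> range f"
  then obtain x where "y = f ((x - c) + c)" by auto
  then show "y \<in> range (\<lambda>s. f (s + c))" by blast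
qed auto

lemma arch_inter_vert: "\<zeta> \<noteq> 0 \<Longrightarrow> arch \<zeta> 0 = vert (ln (cmod \<zeta>))"
  by (simp add: arch_def vert_def)

text \<open>A common point has equal distance from the origin and equal height on both half circles,
  so the parameters agree up to sign; away from the top, the horizontal coordinate would determine
  \<open>\<zeta>\<close> up to sign.\<close>

lemma arch_inter_arch:
  assumes "\<zeta> \<noteq> 0" "\<xi> \<noteq> 0" "\<zeta>\<^sup>2 \<noteq> \<xi>\<^sup>2"
  shows "range (arch \<zeta>) \<inter> range (arch \<xi>) \<subseteq> range vert"
proof
  fix p assume "p \<in> range (arch \<zeta>) \<inter> range (arch \<xi>)"
  then obtain s t where st: "p = arch \<zeta> s" "p = arch \<xi> t" by blast
  have n: "(cmod (fst (arch \<eta> r)))\<^sup>2 + (snd (arch \<eta> r))\<^sup>2 = (cmod \<eta>)\<^sup>2" for \<eta> r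
  proof -
    have "(sinh r)\<^sup>2 + 1 = (cosh r)\<^sup>2" by (simp add: cosh_square_eq)
    then have "(tanh r)\<^sup>2 + 1 / (cosh r)\<^sup>2 = 1" by (simp add: tanh_def field_simps)
    then have "(cmod \<eta>)\<^sup>2 * ((tanh r)\<^sup>2 + 1 / (cosh r)\<^sup>2) = (cmod \<eta>)\<^sup>2" by simp
    then show ?thesis by (simp add: arch_def norm_mult power_mult_distrib power_divide distrib_left)
  qed
  have "(cmod \<zeta>)\<^sup>2 = (cmod \<xi>)\<^sup>2" using n[of \<zeta> s] n[of \<xi> t] st by simp
  then have c: "cmod \<zeta> = cmod \<xi>" by simp
  have "cmod \<zeta> / cosh s = cmod \<xi> / cosh t" using st by (simp add: arch_def)
  then have "cosh s = cosh t" using c assms by simp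
  then have "\<bar>s\<bar> = \<bar>t\<bar>" by (metis cosh_real_abs arcosh_cosh_real abs_ge_zero)
  then consider "t = s" | "t = - s" by (auto simp: abs_if split: if_splits)
  then have e: "\<zeta> * of_real (tanh s) = \<xi> * of_real (tanh s) \<or> \<zeta> * of_real (tanh s) = - \<xi> * of_real (tanh s)"
    using st by cases (auto simp: arch_def)
  have "tanh s = 0"
  proof (rule ccontr)
    assume "tanh s \<noteq> 0"
    moreover have "(\<zeta> - \<xi>) * of_real (tanh s) = 0 \<or> (\<zeta> + \<xi>) * of_real (tanh s) = 0"
      using e by (auto simp: algebra_simps)
    ultimately have "\<zeta> = \<xi> \<or> \<zeta> = - \<xi>" by (auto simp: add_eq_0_iff2)
    then show False using assms(3) by auto
  qed
  then have "s = 0" by simp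
  then show "p \<in> range vert" using st(1) arch_inter_vert[OF assms(1)] by simp
qed

section \<open>Conformality\<close>

text \<open>Turns norms of tangent vectors into limits of Euclidean distances, which the isometry
  controls.\<close>

lemma has_vector_derivative_quotient:
  fixes h :: "real \<Rightarrow> 'a :: real_normed_vector"
  assumes "(h has_vector_derivative d) (at 0)" "h 0 = 0"
  shows "((\<lambda>s. (norm (h s) / \<bar>s\<bar>)\<^sup>2) \<longlongrightarrow> (norm d)\<^sup>2) (at 0)"
proof -
  have *: "((\<lambda>s. norm (h s - s *\<^sub>R d) / norm s) \<longlongrightarrow> 0) (at 0)"
    using assms unfolding has_vector_derivative_def has_derivative_at by simp
  have "((\<lambda>s. h s /\<^sub>R s - d) \<longlongrightarrow> 0) (at 0)"
  proof (rule tendsto_norm_zero_cancel, rule Lim_transform_eventually[OF *])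
    have "norm (h s - s *\<^sub>R d) / norm s = norm (h s /\<^sub>R s - d)" if "s \<noteq> 0" for s
    proof -
      have "h s /\<^sub>R s - d = (h s - s *\<^sub>R d) /\<^sub>R s" using that by (simp add: scaleR_diff_right)
      then show ?thesis by (simp add: divide_inverse_commute)
    qed
    then show "\<forall>\<^sub>F s in at 0. norm (h s - s *\<^sub>R d) / norm s = norm (h s /\<^sub>R s - d)"
      by (simp add: eventually_at_filter)
  qed
  then have "((\<lambda>s. h s /\<^sub>R s) \<longlongrightarrow> d) (at 0)" by (simp add: LIM_zero_iff)
  then have "((\<lambda>s. (norm (h s /\<^sub>R s))\<^sup>2) \<longlongrightarrow> (norm d)\<^sup>2) (at 0)" by (intro tendsto_intros)
  then show ?thesis by (simp add: divide_inverse_commute)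
qed

lemma bounded_linear_differentiable: "bounded_linear f \<Longrightarrow> f differentiable F"
  using bounded_linear_imp_has_derivative differentiable_def by blast

lemma differentiable_Pair:
  "f differentiable (at x within S) \<Longrightarrow> g differentiable (at x within S) \<Longrightarrow>
    (\<lambda>x. (f x, g x)) differentiable (at x within S)"
  unfolding differentiable_def using has_derivative_Pair by blast

lemma act_differentiable: assumes "det M = 1" "p \<in> H3" shows "act M differentiable (at p)"
proof -
  obtain a b c d where M: "M = mk a b c d" by (rule mat2_cases)
  define N where "N p = Re ((c * fst p + d) * cnj (c * fst p + d)) + (cmod c)\<^sup>2 * (snd p)\<^sup>2" for p :: point
  have act: "act M = (\<lambda>p. (((a * fst p + b) * cnj (c * fst p + d) + a * cnj c * of_real ((snd p)\<^sup>2)) / of_real (N p), snd p / N p))"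
    unfolding M act_def Let_def N_def Re_mult_cnj mk_nth ..
  have N0: "N p \<noteq> 0"
    using act_denominator_pos[of a d b c "snd p" "fst p"] assms
    unfolding N_def Re_mult_cnj by (simp add: M H3_def)
  have f: "fst differentiable (at p)" and s: "snd differentiable (at p)"
    by (intro bounded_linear_differentiable bounded_linear_fst bounded_linear_snd)+
  have c: "(\<lambda>p. cnj (h p)) differentiable (at p)" and r: "(\<lambda>p. Re (h p)) differentiable (at p)"
    if "h differentiable (at p)" for h :: "point \<Rightarrow> complex"
    using that unfolding differentiable_def
    by (blast intro: has_derivative_cnj bounded_linear.has_derivative[OF bounded_linear_Re])+
  have o: "(\<lambda>p. complex_of_real (h p)) differentiable (at p)" if "h differentiable (at p)" for h :: "point \<Rightarrow> real"
    using that unfolding differentiable_def by (blast intro: bounded_linear.has_derivative[OF bounded_linear_of_real])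
  have N: "N differentiable (at p)" unfolding N_def[abs_def]
    by (intro differentiable_add differentiable_mult differentiable_power r c f s differentiable_const)
  show ?thesis unfolding act
    by (intro differentiable_Pair differentiable_divide differentiable_add differentiable_mult differentiable_power
        o c f s N differentiable_const) (use N0 in auto)
qed

lemma act_vector_derivative:
  assumes "det M = 1" "f s \<in> H3" "(f has_vector_derivative x) (at s)"
  shows "\<exists>x'. ((\<lambda>s. act M (f s)) has_vector_derivative x') (at s)"
proof -
  have "f differentiable (at s)" using assms(3) by (rule differentiableI_vector)
  then have "(act M \<circ> f) differentiable (at s)"
    using act_differentiable[OF assms(1,2)] by (rule differentiable_chain_at)
  then show ?thesis unfolding vector_derivative_works comp_def by blast
qed

text \<open>Invariance of \<open>chd\<close> says that Euclidean squared distances are scaled by a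
  quotient of heights. In the limit this is the conformal factor, without computing a derivative of
  the action.\<close>

lemma act_conformal:
  assumes M: "det M = 1" and H: "\<And>s. f s \<in> H3" "\<And>s. g s \<in> H3" and 0: "f 0 = g 0"
    and d: "(f has_vector_derivative x) (at 0)" "(g has_vector_derivative y) (at 0)"
    and d': "((\<lambda>s. act M (f s)) has_vector_derivative x') (at 0)" "((\<lambda>s. act M (g s)) has_vector_derivative y') (at 0)"
  shows "(norm (x' - y'))\<^sup>2 = (snd (act M (f 0)) / snd (f 0))\<^sup>2 * (norm (x - y))\<^sup>2"
proof -
  let ?F = "\<lambda>s. act M (f s)" and ?G = "\<lambda>s. act M (g s)"
  define c where "c s = (snd (?F s) * snd (?G s)) / (snd (f s) * snd (g s))" for s
  have dist: "(dist p q)\<^sup>2 = 2 * snd p * snd q * (chd p q - 1)" if "p \<in> H3" "q \<in> H3" for p q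
    using that by (simp add: chd_def H3_def)
  have e: "(norm (?F s - ?G s) / \<bar>s\<bar>)\<^sup>2 = c s * (norm (f s - g s) / \<bar>s\<bar>)\<^sup>2" for s
  proof -
    have "(dist (?F s) (?G s))\<^sup>2 = c s * (dist (f s) (g s))\<^sup>2"
    proof -
      have "(dist (?F s) (?G s))\<^sup>2 = 2 * snd (?F s) * snd (?G s) * (chd (f s) (g s) - 1)"
        using dist[OF herm_act(1)[OF M H(1)[of s]] herm_act(1)[OF M H(2)[of s]]] chd_act[OF M H(1) H(2), of s s]
        by simp
      moreover have "snd (f s) \<noteq> 0" "snd (g s) \<noteq> 0" using H[of s] by (simp_all add: H3_def)
      ultimately show ?thesis by (simp add: dist[OF H] c_def)
    qed
    then show ?thesis by (simp add: dist_norm power_divide)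
  qed
  have 1: "((\<lambda>s. (norm (?F s - ?G s) / \<bar>s\<bar>)\<^sup>2) \<longlongrightarrow> (norm (x' - y'))\<^sup>2) (at 0)"
    using 0 by (intro has_vector_derivative_quotient has_vector_derivative_diff d') simp
  have cont: "isCont f 0" "isCont g 0" "isCont ?F 0" "isCont ?G 0"
    using d d' has_vector_derivative_continuous by blast+
  have nz: "snd (f 0) * snd (g 0) \<noteq> 0" using H[of 0] by (auto simp: H3_def)
  have "isCont c 0" unfolding c_def[abs_def] by (intro continuous_intros cont) (use nz in auto)
  then have "(c \<longlongrightarrow> c 0) (at 0)" by (simp add: isCont_def)
  then have "((\<lambda>s. c s * (norm (f s - g s) / \<bar>s\<bar>)\<^sup>2) \<longlongrightarrow> c 0 * (norm (x - y))\<^sup>2) (at 0)"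
    using 0 by (intro tendsto_mult has_vector_derivative_quotient has_vector_derivative_diff d) simp_all
  then have "(norm (x' - y'))\<^sup>2 = c 0 * (norm (x - y))\<^sup>2"
    using 1 unfolding e by (intro tendsto_unique[of "at (0::real)"]) auto
  moreover have "c 0 = (snd (?F 0) / snd (f 0))\<^sup>2" using 0 by (simp add: c_def power2_eq_square)
  ultimately show ?thesis by simp
qed

lemma act_orthogonal:
  assumes M: "det M = 1" and H: "\<And>s. f s \<in> H3" "\<And>s. g s \<in> H3" and 0: "f 0 = g 0"
    and d: "(f has_vector_derivative x) (at 0)" "(g has_vector_derivative y) (at 0)"
    and d': "((\<lambda>s. act M (f s)) has_vector_derivative x') (at 0)" "((\<lambda>s. act M (g s)) has_vector_derivative y') (at 0)"
    and xy: "inner x y = 0"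
  shows "inner x' y' = 0"
proof -
  define k where "k = (snd (act M (f 0)) / snd (f 0))\<^sup>2"
  \<comment> \<open>Comparison with a constant path gives the norms of the single tangent vectors;
    polarisation then yields the inner product.\<close>
  have c: "((\<lambda>s. p) has_vector_derivative 0) (at 0)" for p :: point by (rule has_vector_derivative_const)
  have "(norm (x' - y'))\<^sup>2 = k * (norm (x - y))\<^sup>2"
    unfolding k_def by (rule act_conformal[OF M H 0 d d'])
  moreover have "(norm (x' - 0))\<^sup>2 = k * (norm (x - 0))\<^sup>2"
    unfolding k_def by (rule act_conformal[OF M H(1) _ _ d(1) c d'(1), of "f 0"]) (use H c in auto)
  moreover have "(norm (y' - 0))\<^sup>2 = k * (norm (y - 0))\<^sup>2"
    unfolding k_def 0 by (rule act_conformal[OF M H(2) _ _ d(2) c d'(2), of "g 0"]) (use H c in auto)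
  moreover have "(norm (v - w))\<^sup>2 = (norm v)\<^sup>2 + (norm w)\<^sup>2 - 2 * inner v w" for v w :: point
    by (simp add: power2_norm_eq_inner inner_diff_left inner_diff_right inner_commute)
  ultimately have "k * (norm x)\<^sup>2 + k * (norm y)\<^sup>2 - 2 * inner x' y' = k * ((norm x)\<^sup>2 + (norm y)\<^sup>2)"
    using xy by simp
  then show ?thesis by (simp add: algebra_simps)
qed

lemma arch_derivative: "(arch \<zeta> has_vector_derivative (\<zeta>, 0)) (at 0)"
proof -
  have t: "((\<lambda>s. tanh s :: real) has_real_derivative 1) (at 0)"
    by (auto intro!: derivative_eq_intros)
  have "((\<lambda>s. \<zeta> * of_real (tanh s)) has_vector_derivative \<zeta> * of_real 1) (at 0)"
    using t by (intro has_vector_derivative_mult_right has_vector_derivative_of_real)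
  moreover have "((\<lambda>s. cmod \<zeta> / cosh s) has_real_derivative 0) (at 0)"
    by (auto intro!: derivative_eq_intros)
  ultimately show ?thesis
    unfolding arch_def[abs_def]
    by (intro has_vector_derivative_Pair) (simp_all add: has_real_derivative_iff_has_vector_derivative)
qed

lemma vert_arch_orthogonal:
  assumes "det G = 1" "\<zeta> \<noteq> 0"
  shows "meet_orthogonally (act G ` range vert) (act G ` range (arch \<zeta>))"
proof -
  define r where "r = ln (cmod \<zeta>)"
  have v: "((\<lambda>s. vert (s + r)) has_vector_derivative (0, exp r)) (at 0)"
    unfolding vert_def
    by (auto intro!: derivative_eq_intros has_vector_derivative_Pair simp: has_real_derivative_iff_has_vector_derivative[symmetric])
  note a = arch_derivative[of \<zeta>]
  obtain x' where x': "((\<lambda>s. act G (vert (s + r))) has_vector_derivative x') (at 0)"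
    using act_vector_derivative[OF assms(1) _ v] by auto
  obtain y' where y': "((\<lambda>s. act G (arch \<zeta> s)) has_vector_derivative y') (at 0)"
    using act_vector_derivative[OF assms(1) _ a] assms(2) by auto
  have e: "vert (0 + r) = arch \<zeta> 0" using arch_inter_vert[OF assms(2)] by (simp add: r_def)
  have "inner x' y' = 0"
    by (rule act_orthogonal[OF assms(1) _ _ e v a x' y']) (use assms(2) in auto)
  moreover have "act G ` range vert = range (\<lambda>s. act G (vert (s + r)))"
    using range_shift[of "\<lambda>s. act G (vert s)" r] by (simp add: image_image)
  ultimately show ?thesis
    unfolding meet_orthogonally_def using geodesic_vert[OF assms(1), of r] geodesic_arch[OF assms] x' y' e
    by (intro exI[of _ "\<lambda>s. act G (vert (s + r))"] exI[of _ "\<lambda>s. act G (arch \<zeta> s)"] exI[of _ x'] exI[of _ y'])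
      (simp add: image_image)
qed

section \<open>Irreducibility\<close>

lemma mult_vec_nth: "(M *v x) $ 1 = M$1$1 * x$1 + M$1$2 * x$2" "(M *v x) $ 2 = M$2$1 * x$1 + M$2$2 * x$2"
  for M :: mat2
  by (simp_all add: matrix_vector_mult_def sum_2)

lemma vec2_eq_iff: "x = y \<longleftrightarrow> x$1 = y$1 \<and> x$2 = y$2" for x y :: "complex^2"
  by (simp add: vec_eq_iff forall_2)

lemma invariant_ev:
  assumes W: "vec.subspace W" and A: "\<And>x. x \<in> W \<Longrightarrow> A *v x \<in> W" and B: "\<And>x. x \<in> W \<Longrightarrow> B *v x \<in> W"
    and x: "x \<in> W"
  shows "ev A B w *v x \<in> W"
  using x
proof (induction w)
  case (Cons l w)
  have adj: "adj M *v y = trace M *s y - M *v y" for M :: mat2 and y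
    by (cases M rule: mat2_cases) (simp add: vec2_eq_iff mult_vec_nth algebra_simps)
  have "adj A *v y \<in> W" "adj B *v y \<in> W" if "y \<in> W" for y
    unfolding adj using that A B by (auto intro!: vec.subspace_diff[OF W] vec.subspace_scale[OF W])
  then have "ev_letter A B l *v y \<in> W" if "y \<in> W" for y
    using that A B by (simp add: ev_letter_def Let_def split: gen.split)
  then show ?case using Cons by (simp add: matrix_vector_mul_assoc[symmetric])
qed simp

text \<open>Schur's argument: the kernel of an intertwining matrix is an invariant subspace.\<close>

lemma irreducible_kernel:
  assumes \<rho>: "\<rho> \<in> hom F2 SL2C" "irreducible_rep \<rho>" and N: "N ** \<rho> gen_a = A' ** N" "N ** \<rho> gen_b = B' ** N"
    and det: "det N = 0"
  shows "N = 0"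
proof (rule ccontr)
  assume n0: "N \<noteq> 0"
  define W where "W = {x. N *v x = 0}"
  have sub: "vec.subspace W"
    by (rule vec.subspaceI) (auto simp: W_def matrix_vector_right_distrib vector_scalar_commute)
  have inv: "\<rho> gen_a *v x \<in> W" "\<rho> gen_b *v x \<in> W" if "x \<in> W" for x
    using that N unfolding W_def by (simp_all add: matrix_vector_mul_assoc) (simp_all add: matrix_vector_mul_assoc[symmetric])
  have "\<rho> g *v x \<in> W" if "g \<in> carrier F2" "x \<in> W" for g x
    using invariant_ev[OF sub inv that(2), of g] hom_eq_ev[OF \<rho>(1), of g] that(1) by (simp add: F2_simps)
  then consider "W = {0}" | "W = UNIV" using \<rho>(2) sub unfolding irreducible_rep_def by blast
  then show False
  proof cases
    case 1
    obtain a b c d where abcd: "N = mk a b c d" by (rule mat2_cases)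
    then have "a * d = b * c" using det by simp
    \<comment> \<open>For a singular matrix these vectors lie in the kernel, and they vanish
      together only for the zero matrix.\<close>
    then have "vector [b, - a] \<in> W" "vector [d, - c] \<in> W"
      by (auto simp: W_def vec2_eq_iff mult_vec_nth abcd algebra_simps)
    then have "(vector [b, - a] :: complex^2) = 0" "(vector [d, - c] :: complex^2) = 0" using 1 by auto
    then have "N = 0" by (simp add: vec2_eq_iff abcd mat2_eq_iff)
    then show False using n0 by simp
  next
    case 2
    then have "N *v x = 0 *v x" for x by (auto simp: W_def)
    then show False using n0 by (simp add: matrix_eq)
  qed
qed

text \<open>Conjugation by the bracket inverts both generators: it is the half turn about their
  common perpendicular.\<close>

lemma bracket_intertwines:
  "(A ** B - B ** A) ** A = adj A ** (A ** B - B ** (A :: mat2))" "(A ** B - B ** A) ** B = adj B ** (A ** B - B ** A)"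
  by (cases A rule: mat2_cases; cases B rule: mat2_cases; simp add: algebra_simps)+

text \<open>A singular bracket would vanish by Schur's argument. Then the images commute, are
  scalar, and commute with a nonzero nilpotent matrix, which Schur's argument forbids.\<close>

lemma irreducible_bracket:
  assumes \<rho>: "\<rho> \<in> hom F2 SL2C" "irreducible_rep \<rho>"
  shows "det (\<rho> gen_a ** \<rho> gen_b - \<rho> gen_b ** \<rho> gen_a) \<noteq> 0"
proof
  let ?A = "\<rho> gen_a" and ?B = "\<rho> gen_b"
  assume z: "det (?A ** ?B - ?B ** ?A) = 0"
  have det: "det ?A = 1" "det ?B = 1" using hom_det[OF \<rho>(1)] by (simp_all add: gen_a_def gen_b_def)
  have "?A ** ?B - ?B ** ?A = 0"
    by (rule irreducible_kernel[OF \<rho> bracket_intertwines z])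
  then have AB: "?A ** ?B = ?B ** ?A" by simp
  have scalar: "\<exists>l. M = mat l" if M: "M ** ?A = ?A ** M" "M ** ?B = ?B ** M" for M
  proof -
    obtain a b c d where abcd: "M = mk a b c d" by (rule mat2_cases)
    define s where "s = csqrt ((a - d)\<^sup>2 + 4 * b * c)"
    define l where "l = (a + d + s) / 2"
    have "s * s = (a - d)\<^sup>2 + 4 * b * c" by (simp add: s_def flip: power2_eq_square)
    then have "det (M - mat l) = 0"
      by (simp add: abcd mat_mk l_def field_simps power2_eq_square)
    moreover have "mat l ** K = K ** mat l" for K :: mat2
      by (cases K rule: mat2_cases) (simp add: mat_mk)
    then have "(M - mat l) ** ?A = ?A ** (M - mat l)" "(M - mat l) ** ?B = ?B ** (M - mat l)"
      using M by (simp_all add: mult_diff_right mult_diff_left)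
    ultimately have "M - mat l = 0" by (intro irreducible_kernel[OF \<rho>])
    then show ?thesis by (metis eq_iff_diff_eq_0)
  qed
  obtain l where l: "?A = mat l" using scalar[of ?A] AB by auto
  obtain k where k: "?B = mat k" using scalar[of ?B] AB by auto
  have "mk 0 1 0 0 = 0"
    by (rule irreducible_kernel[OF \<rho>, of _ ?A ?B]) (simp_all add: l k mat_mk)
  then show False by (simp add: mat2_eq_iff)
qed

lemma traceless_diagonalization:
  assumes "trace Q = 0" "det Q \<noteq> 0"
  obtains G q where "det G = 1" "q \<noteq> 0" "adj G ** Q ** G = mk q 0 0 (- q)"
proof -
  obtain a b c d where Q': "Q = mk a b c d" by (rule mat2_cases)
  then have d: "d = - a" using assms(1) by (simp add: add_eq_0_iff)
  note Q = Q'[unfolded d]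
  define q where "q = csqrt (- det Q)"
  have "q * q = - det Q" by (simp add: q_def flip: power2_eq_square)
  then have qq: "q * q = a * a + b * c" by (simp add: Q)
  have q: "q \<noteq> 0" using assms(2) by (simp add: q_def)
  \<comment> \<open>The choice \<open>N = Q + D\<close> with \<open>D = diag(q, - q)\<close> works
    because \<open>Q\<close> and \<open>D\<close> have the same square. It is singular for
    \<open>a = - q\<close>, where another pair of eigenvectors is taken.\<close>
  have "\<exists>N. det N \<noteq> 0 \<and> Q ** N = N ** mk q 0 0 (- q)"
  proof (cases "a + q = 0")
    case False
    have "det (mk (a + q) b c (- a - q)) = - (2 * q * (a + q))"
      unfolding det_mk using qq by algebra
    moreover have "Q ** mk (a + q) b c (- a - q) = mk (a + q) b c (- a - q) ** mk q 0 0 (- q)"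
      unfolding Q by (simp add: algebra_simps qq)
    ultimately show ?thesis using False q by (intro exI[of _ "mk (a + q) b c (- a - q)"]) (simp del: det_mk)
  next
    case True
    then have a: "a = - q" by (simp add: eq_neg_iff_add_eq_0)
    have "det (mk b (a - q) (q - a) c) = 4 * q * q"
      unfolding det_mk using qq a by algebra
    moreover have "Q ** mk b (a - q) (q - a) c = mk b (a - q) (q - a) c ** mk q 0 0 (- q)"
      unfolding Q by (simp add: algebra_simps qq)
    ultimately show ?thesis using q by (intro exI[of _ "mk b (a - q) (q - a) c"]) (simp del: det_mk)
  qed
  then obtain n1 n2 n3 n4 where N: "det (mk n1 n2 n3 n4) \<noteq> 0" "Q ** mk n1 n2 n3 n4 = mk n1 n2 n3 n4 ** mk q 0 0 (- q)"
    by (metis mat2_cases)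
  define s where "s = csqrt (det (mk n1 n2 n3 n4))"
  have ss: "s * s = n1 * n4 - n2 * n3" by (simp add: s_def flip: power2_eq_square)
  have s: "s \<noteq> 0" using N(1) by (simp add: s_def)
  define G where "G = mk (n1 / s) (n2 / s) (n3 / s) (n4 / s)"
  have "det G = (n1 * n4 - n2 * n3) / (s * s)" by (simp add: G_def diff_divide_distrib)
  then have G: "det G = 1" using ss s by (metis divide_self_if mult_eq_0_iff)
  have scale: "mk x1 x2 x3 x4 ** G = mk (y1 / s) (y2 / s) (y3 / s) (y4 / s)"
    if "mk x1 x2 x3 x4 ** mk n1 n2 n3 n4 = mk y1 y2 y3 y4" for x1 x2 x3 x4 y1 y2 y3 y4
    using that by (auto simp: G_def add_divide_distrib)
  have "Q ** G = G ** mk q 0 0 (- q)"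
    using scale[of a b c "- a" "n1 * q" "- (n2 * q)" "n3 * q" "- (n4 * q)"] N(2) by (simp add: Q G_def)
  then have "adj G ** Q ** G = mk q 0 0 (- q)"
    by (simp add: matrix_mul_assoc[symmetric] mult_adj_assoc G)
  then show ?thesis using that G q by blast
qed

section \<open>Axes of matrices with equal diagonal entries\<close>

lemma image_act_mult:
  assumes "det M = 1" "det N = 1" "S \<subseteq> H3" shows "act (M ** N) ` S = act M ` act N ` S"
  using assms by (force simp: act_mult image_image)

lemma range_arch: "\<zeta> \<noteq> 0 \<Longrightarrow> range (arch \<zeta>) = act (arch_matrix \<zeta>) ` range vert"
  by (simp add: image_image act_arch_matrix)

lemma act_diagonal_vert: "l * k = 1 \<Longrightarrow> act (mk l 0 0 k) ` range vert = range vert"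
proof -
  assume lk: "l * k = 1"
  then have k: "k \<noteq> 0" by auto
  have "act (mk l 0 0 k) (vert s) = vert (s - ln ((cmod k)\<^sup>2))" for s
  proof -
    have "exp (ln ((cmod k)\<^sup>2)) = (cmod k)\<^sup>2" using k by (intro exp_ln) simp
    then show ?thesis by (simp add: act_mk vert_def Let_def exp_diff)
  qed
  then have "act (mk l 0 0 k) ` range vert = range (\<lambda>s. vert (s + - ln ((cmod k)\<^sup>2)))"
    by (simp add: image_image)
  then show ?thesis unfolding range_shift[of vert] .
qed

text \<open>The fixed points are \<open>\<zeta>\<close> and \<open>- \<zeta>\<close>, so
  \<open>arch_matrix\<close> diagonalises the matrix and carries the vertical line to the
  axis.\<close>

lemma axis_equal_diagonal:
  assumes G: "det G = 1" and M: "det M = 1" "loxodromic M" and fl: "flip (adj G ** M ** G) = adj G ** M ** G"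
  defines "M' \<equiv> adj G ** M ** G"
  obtains \<zeta> where "\<zeta> \<noteq> 0" "\<zeta>\<^sup>2 = M'$1$2 / M'$2$1" "M'$1$2 \<noteq> 0" "M'$2$1 \<noteq> 0"
    "is_axis M (Line (act G ` range (arch \<zeta>)))"
proof -
  obtain t y z where M'e: "M' = mk t y z t" unfolding M'_def using fl by (rule flip_fixed)
  have tr: "trace M = 2 * t" using trace_conj[OF G, of M] M'e by (simp add: M'_def)
  have "det M' = 1" by (simp add: M'_def det_mul G M)
  then have yz: "t * t - y * z = 1" by (simp add: M'e)
  have "y * z \<noteq> 0"
  proof
    assume "y * z = 0"
    then have "(t - 1) * (t + 1) = 0" using yz by (simp add: algebra_simps)
    then have "t = 1 \<or> t = - 1" by (auto simp: add_eq_0_iff2)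
    then have "trace M = complex_of_real 2 \<or> trace M = complex_of_real (- 2)" using tr by auto
    moreover have "complex_of_real 2 \<in> complex_of_real ` {-2..2}" "complex_of_real (- 2) \<in> complex_of_real ` {-2..2}"
      by (intro imageI, simp)+
    ultimately show False using M(2) unfolding loxodromic_def by metis
  qed
  then have nz: "y \<noteq> 0" "z \<noteq> 0" by auto
  define \<zeta> where "\<zeta> = csqrt (y / z)"
  have z2: "\<zeta>\<^sup>2 = y / z" by (simp add: \<zeta>_def)
  then have z0: "\<zeta> \<noteq> 0" using nz by auto
  have zz: "z * (\<zeta> * \<zeta>) = y" using z2 nz by (simp add: power2_eq_square)
  let ?T = "arch_matrix \<zeta>"
  have T: "det ?T = 1" using det_arch_matrix z0 by blast
  define l k where "l = t + z * \<zeta>" "k = t - z * \<zeta>"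
  have lk: "l * k = 1" using yz zz unfolding l_k_def by algebra
  define m where "m = csqrt (2 * \<zeta>)"
  have MT: "M' ** ?T = ?T ** mk l 0 0 k"
    unfolding M'e arch_matrix_def Let_def m_def[symmetric] l_k_def
    using zz by (simp add: algebra_simps)
  have dk: "det (mk l 0 0 k) = 1" using lk by simp
  have GT: "det (G ** ?T) = 1" by (simp add: det_mul G T)
  have "M ** (G ** ?T) = G ** (M' ** ?T)"
    unfolding M'_def by (simp add: matrix_mul_assoc[symmetric] mult_adj_assoc G)
  then have e: "M ** (G ** ?T) = (G ** ?T) ** mk l 0 0 k" by (simp add: MT matrix_mul_assoc)
  let ?L = "act G ` range (arch \<zeta>)"
  have v: "range vert \<subseteq> H3" by auto
  have L: "?L = act (G ** ?T) ` range vert"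
    unfolding range_arch[OF z0] image_act_mult[OF G T v] ..
  have "act M ` ?L = act ((G ** ?T) ** mk l 0 0 k) ` range vert"
    unfolding L e[symmetric] image_act_mult[OF M(1) GT v] ..
  also have "\<dots> = ?L"
    unfolding image_act_mult[OF GT dk v] act_diagonal_vert[OF lk] L ..
  finally have "act M ` ?L = ?L" .
  moreover have "geodesic_line ?L"
    unfolding geodesic_line_def using geodesic_arch[OF G z0] by (auto simp: image_image)
  ultimately have "is_axis M (Line ?L)" using M(2) by simp
  then show ?thesis using that[OF z0] z2 nz M'e by simp
qed

lemma act_inj_on: assumes "det G = 1" shows "inj_on (act G) H3"
  by (rule inj_on_inverseI[of _ "act (adj G)"]) (simp add: act_adj assms)

text \<open>The nonzero bracket entry says that the quotients of off-diagonal entries differ; so the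
  axes are different half circles around the origin and can meet only on the vertical line.\<close>

lemma hyperelliptic_axis_frame:
  assumes G: "det G = 1" and A: "det A = 1" "loxodromic A" "flip (adj G ** A ** G) = adj G ** A ** G"
    and B: "det B = 1" "loxodromic B" "flip (adj G ** B ** G) = adj G ** B ** G"
    and q: "adj G ** (A ** B - B ** A) ** G = mk q 0 0 (- q)" "q \<noteq> 0"
  shows "is_hyperelliptic_axis A B (act G ` range vert)"
proof -
  let ?A = "adj G ** A ** G" and ?B = "adj G ** B ** G"
  obtain \<zeta> where z: "\<zeta> \<noteq> 0" "\<zeta>\<^sup>2 = ?A$1$2 / ?A$2$1" "?A$1$2 \<noteq> 0" "?A$2$1 \<noteq> 0"
    "is_axis A (Line (act G ` range (arch \<zeta>)))" using axis_equal_diagonal[OF G A] by blast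
  obtain \<xi> where x: "\<xi> \<noteq> 0" "\<xi>\<^sup>2 = ?B$1$2 / ?B$2$1" "?B$1$2 \<noteq> 0" "?B$2$1 \<noteq> 0"
    "is_axis B (Line (act G ` range (arch \<xi>)))" using axis_equal_diagonal[OF G B] by blast
  have "?A ** ?B - ?B ** ?A = adj G ** (A ** B - B ** A) ** G"
    by (simp add: mult_diff_right mult_diff_left matrix_mul_assoc[symmetric] mult_adj_assoc G)
  then have "(?A ** ?B - ?B ** ?A)$1$1 = q" using q by simp
  then have "?A$1$2 * ?B$2$1 - ?B$1$2 * ?A$2$1 = q"
    by (cases ?A rule: mat2_cases; cases ?B rule: mat2_cases) (simp add: algebra_simps)
  moreover have "?A$1$2 * ?B$2$1 = ?B$1$2 * ?A$2$1" if "\<zeta>\<^sup>2 = \<xi>\<^sup>2"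
  proof -
    have "?A$1$2 / ?A$2$1 = ?B$1$2 / ?B$2$1" using that z(2) x(2) by simp
    then show ?thesis using frac_eq_eq[OF z(4) x(4)] by blast
  qed
  ultimately have ne: "\<zeta>\<^sup>2 \<noteq> \<xi>\<^sup>2" using q(2) by auto
  have geo: "geodesic_line (act G ` range vert)"
    unfolding geodesic_line_def using geodesic_vert[OF G, of 0] by (auto simp: image_image)
  have "act G ` range (arch \<zeta>) \<inter> act G ` range (arch \<xi>) = act G ` (range (arch \<zeta>) \<inter> range (arch \<xi>))"
    using z(1) x(1) by (intro inj_on_image_Int[symmetric, OF act_inj_on[OF G]]) auto
  also have "\<dots> \<subseteq> act G ` range vert" using arch_inter_arch[OF z(1) x(1) ne] by blast
  finally have "axis_points (Line (act G ` range (arch \<zeta>))) \<inter> axis_points (Line (act G ` range (arch \<xi>))) \<subseteq> act G ` range vert"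
    by simp
  moreover have "perpendicular_to_axis (act G ` range vert) (Line (act G ` range (arch \<zeta>)))"
    "perpendicular_to_axis (act G ` range vert) (Line (act G ` range (arch \<xi>)))"
    using vert_arch_orthogonal[OF G] z(1) x(1) by simp_all
  ultimately show ?thesis unfolding is_hyperelliptic_axis_def using geo z(5) x(5) by blast
qed

lemma hdist_vert_bounded:
  assumes "p \<in> H3"
  shows "\<exists>D. \<forall>s. \<bar>s\<bar> \<le> M \<longrightarrow> hdist (vert s) p \<le> D"
proof -
  obtain z t where p: "p = (z, t)" by (cases p)
  have t: "t > 0" using assms by (simp add: p H3_def)
  define K where "K = 1 + ((cmod z)\<^sup>2 + (exp M + t)\<^sup>2) / (2 * exp (- M) * t)"
  have "hdist (vert s) p \<le> arcosh K" if s: "\<bar>s\<bar> \<le> M" for s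
  proof -
    have e: "exp (- M) \<le> exp s" "exp s \<le> exp M" using s by auto
    have "\<bar>exp s - t\<bar> \<le> exp M + t" using e t exp_gt_zero[of s] by linarith
    then have "(exp s - t)\<^sup>2 \<le> (exp M + t)\<^sup>2" by (metis abs_ge_zero power2_abs power_mono)
    then have "(cmod z)\<^sup>2 + (exp s - t)\<^sup>2 \<le> (cmod z)\<^sup>2 + (exp M + t)\<^sup>2" by simp
    then have "((cmod z)\<^sup>2 + (exp s - t)\<^sup>2) / (2 * exp s * t) \<le> ((cmod z)\<^sup>2 + (exp M + t)\<^sup>2) / (2 * exp (- M) * t)"
      using e t by (intro frac_le) auto
    then have "chd (vert s) p \<le> K" unfolding chd_def vert_def p dist_square K_def by simp
    moreover have "1 \<le> chd (vert s) p" using chd_ge_1[OF vert_H3 assms] .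
    ultimately show ?thesis unfolding hdist_chd by (metis arcosh_less_iff_real linorder_not_le order_trans)
  qed
  then show ?thesis by blast
qed

theorem BQ_imp_bounded_palindromes:
  assumes \<rho>: "\<rho> \<in> hom F2 SL2C" "irreducible_rep \<rho>" "BQ_conditions \<rho>" and p0: "p0 \<in> H3"
  shows "\<exists>D. \<forall>w\<in>primitives. rev w = w \<longrightarrow>
    (\<exists>L E. is_axis (\<rho> w) (Line L) \<and> is_hyperelliptic_axis (\<rho> gen_a) (\<rho> gen_b) E \<and> (\<exists>p\<in>L \<inter> E. hdist p p0 \<le> D))"
proof -
  let ?A = "\<rho> gen_a" and ?B = "\<rho> gen_b"
  have det: "det ?A = 1" "det ?B = 1" using hom_det[OF \<rho>(1)] by (simp_all add: gen_a_def gen_b_def)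
  have "trace (?A ** ?B - ?B ** ?A) = 0" using trace_mult_commute[of ?A ?B] by (simp add: trace_sub)
  then obtain G q where G: "det G = 1" and qG: "q \<noteq> 0" "adj G ** (?A ** ?B - ?B ** ?A) ** G = mk q 0 0 (- q)"
    using traceless_diagonalization irreducible_bracket[OF \<rho>(1,2)] by metis
  let ?A' = "adj G ** ?A ** G" and ?B' = "adj G ** ?B ** G"
  have det': "det ?A' = 1" "det ?B' = 1" by (simp_all add: det_mul det G)
  have br: "?A' ** ?B' - ?B' ** ?A' = mk q 0 0 (- q)"
    unfolding qG(2)[symmetric] by (simp add: mult_diff_right mult_diff_left matrix_mul_assoc[symmetric] mult_adj_assoc G)
  \<comment> \<open>Being inverted by the half turn about the vertical line means having equal
    diagonal entries.\<close>
  have fl: "flip M = M" if "mk q 0 0 (- q) ** M = adj M ** mk q 0 0 (- q)" for M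
  proof -
    obtain a b c d where M: "M = mk a b c d" by (rule mat2_cases)
    have "q * a = d * q" using arg_cong[OF that, of "\<lambda>N. N$1$1"] by (simp add: M)
    then have "a = d" using qG(1) by simp
    then show ?thesis by (simp add: M)
  qed
  have flip: "flip ?A' = ?A'" "flip ?B' = ?B'"
    using fl bracket_intertwines[of ?A' ?B'] unfolding br by blast+
  have red: "reduced w" if "w \<in> primitives" for w using that by (simp add: primitives_altdef)
  have conj: "adj G ** \<rho> w ** G = ev ?A' ?B' w" if "w \<in> primitives" for w
    using hom_eq_ev[OF \<rho>(1) red[OF that]] ev_conj[OF det G] by simp
  have tr: "trace (ev ?A' ?B' w) = trace (\<rho> w)" if "w \<in> primitives" for w
    using conj[OF that] trace_conj[OF G, of "\<rho> w"] by simp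
  have S: "{g \<in> primitives. cmod (trace (ev ?A' ?B' g)) \<le> 2} = {g \<in> primitives. cmod (trace (\<rho> g)) \<le> 2}"
    using tr by auto
  have lox: "loxodromic (\<rho> w)" if "w \<in> primitives" for w
    using \<rho>(3) that by (auto simp: BQ_conditions_def loxodromic_def)
  have frame: "bq_frame ?A' ?B' q"
    using det' flip br qG(1) \<rho>(3) tr S by unfold_locales (auto simp: BQ_conditions_def)
  obtain M where M: "\<And>w. w \<in> primitives \<Longrightarrow> rev w = w \<Longrightarrow> \<bar>height (ev ?A' ?B' w)\<bar> \<le> M"
    using bq_frame.height_bounded[OF frame] by blast
  have p1: "act (adj G) p0 \<in> H3" using herm_act(1)[of "adj G" p0] G p0 by simp
  obtain D where D: "\<And>s. \<bar>s\<bar> \<le> M / 2 \<Longrightarrow> hdist (vert s) (act (adj G) p0) \<le> D"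
    using hdist_vert_bounded[OF p1, of "M / 2"] by blast
  have ab: "gen_a \<in> primitives" "gen_b \<in> primitives"
    using basis_primitives[OF basis_std] by (simp_all add: gen_a_def gen_b_def reduce_reduced)
  have E: "is_hyperelliptic_axis ?A ?B (act G ` range vert)"
    by (rule hyperelliptic_axis_frame[OF G det(1) lox[OF ab(1)] flip(1) det(2) lox[OF ab(2)] flip(2) qG(2,1)])
  show ?thesis
  proof (intro exI[of _ D] ballI impI)
    fix w assume w: "w \<in> primitives" "rev w = w"
    let ?W = "ev ?A' ?B' w"
    have "flip ?W = ?W" using flip_ev[OF flip, of w] w(2) by simp
    then have "flip (adj G ** \<rho> w ** G) = adj G ** \<rho> w ** G" using conj[OF w(1)] by simp
    then obtain \<zeta> where z: "\<zeta> \<noteq> 0" "\<zeta>\<^sup>2 = ?W$1$2 / ?W$2$1" "?W$1$2 \<noteq> 0" "?W$2$1 \<noteq> 0"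
      "is_axis (\<rho> w) (Line (act G ` range (arch \<zeta>)))"
      using axis_equal_diagonal[OF G hom_det[OF \<rho>(1) red[OF w(1)]] lox[OF w(1)]] conj[OF w(1)] by metis
    define s where "s = ln (cmod \<zeta>)"
    have "2 * s = ln ((cmod \<zeta>)\<^sup>2)" using z(1) by (simp add: s_def ln_realpow)
    also have "\<dots> = height ?W"
      using z(3,4) by (simp add: norm_power[symmetric] z(2) norm_divide ln_div height_def del: norm_power)
    finally have "\<bar>s\<bar> \<le> M / 2" using M[OF w] by simp
    then have "hdist (act G (vert s)) p0 \<le> D"
      using D[of s] hdist_act[OF G vert_H3 p1, of s] act_adj(1)[OF G p0] by simp
    moreover have "act G (vert s) \<in> act G ` range (arch \<zeta>)"
      using arch_inter_vert[OF z(1)] by (metis s_def image_eqI rangeI)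
    ultimately show "\<exists>L E. is_axis (\<rho> w) (Line L) \<and> is_hyperelliptic_axis ?A ?B E \<and> (\<exists>p\<in>L \<inter> E. hdist p p0 \<le> D)"
      using z(5) E by blast
  qed
qed

section \<open>Change of the generating pair\<close>

lemma reduce_append_reduce: "reduce (reduce u @ v) = reduce (u @ v)" "reduce (u @ reduce v) = reduce (u @ v)"
  using weq_append[of "reduce u" u v v] weq_append[of u u "reduce v" v] by (simp_all add: weq_iff_reduce reduce_reduced)

lemma ext_conj_iff:
  "(u, v) \<in> ext_conj \<longleftrightarrow> u \<in> primitives \<and> v \<in> primitives \<and>
     (\<exists>g. v \<doteq> g @ u @ winv g \<or> v \<doteq> g @ winv u @ winv g)"
proof -
  have *: "(\<exists>g\<in>carrier F2. v = g \<otimes>\<^bsub>F2\<^esub> x \<otimes>\<^bsub>F2\<^esub> inv\<^bsub>F2\<^esub> g) \<longleftrightarrow> (\<exists>g. v \<doteq> g @ x @ winv g)"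
    if v: "reduced v" for x
  proof
    assume "\<exists>g\<in>carrier F2. v = g \<otimes>\<^bsub>F2\<^esub> x \<otimes>\<^bsub>F2\<^esub> inv\<^bsub>F2\<^esub> g"
    then obtain g where "reduced g" "v = reduce (g @ x @ winv g)"
      by (auto simp: F2_simps inv_F2 reduce_append_reduce)
    then have "v \<doteq> g @ x @ winv g" by simp
    then show "\<exists>g. v \<doteq> g @ x @ winv g" by blast
  next
    assume "\<exists>g. v \<doteq> g @ x @ winv g"
    then obtain g where "v \<doteq> g @ x @ winv g" by blast
    also have "g @ x @ winv g \<doteq> reduce g @ x @ winv (reduce g)"
      by (intro weq_append weq_winv) simp_all
    finally have "v = reduce (reduce g @ x @ winv (reduce g))"
      using v by (simp add: weq_iff_reduce reduce_reduced)
    then have "v = reduce g \<otimes>\<^bsub>F2\<^esub> x \<otimes>\<^bsub>F2\<^esub> inv\<^bsub>F2\<^esub> (reduce g)"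
      by (simp add: F2_simps inv_F2 reduce_append_reduce)
    moreover have "reduce g \<in> carrier F2" by (simp add: F2_simps)
    ultimately show "\<exists>g\<in>carrier F2. v = g \<otimes>\<^bsub>F2\<^esub> x \<otimes>\<^bsub>F2\<^esub> inv\<^bsub>F2\<^esub> g" by blast
  qed
  show ?thesis
  proof (cases "u \<in> primitives \<and> v \<in> primitives")
    case True
    then have r: "reduced u" "reduced v" by (auto simp: primitives_altdef)
    show ?thesis unfolding ext_conj_def inv_F2[OF r(1), symmetric]
      using True *[OF r(2), of u] *[OF r(2), of "inv\<^bsub>F2\<^esub> u"] by blast
  qed (auto simp: ext_conj_def)
qed

lemma ext_conj_sym: assumes "(u, v) \<in> ext_conj" shows "(v, u) \<in> ext_conj"
proof -
  obtain g where g: "v \<doteq> g @ u @ winv g \<or> v \<doteq> g @ winv u @ winv g" and p: "u \<in> primitives" "v \<in> primitives"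
    using assms by (auto simp: ext_conj_iff)
  have "u \<doteq> winv g @ v @ winv (winv g)" if "v \<doteq> g @ u @ winv g" using that by (simp add: weq_simps)
  moreover have "u \<doteq> winv g @ winv v @ winv (winv g)" if "v \<doteq> g @ winv u @ winv g"
    using weq_winv[OF that] by (simp add: weq_simps)
  ultimately show ?thesis using g p unfolding ext_conj_iff by blast
qed

lemma ext_conj_trans: assumes "(u, v) \<in> ext_conj" "(v, w) \<in> ext_conj" shows "(u, w) \<in> ext_conj"
proof -
  obtain g where g: "v \<doteq> g @ u @ winv g \<or> v \<doteq> g @ winv u @ winv g" using assms by (auto simp: ext_conj_iff)
  obtain h where h: "w \<doteq> h @ v @ winv h \<or> w \<doteq> h @ winv v @ winv h" using assms by (auto simp: ext_conj_iff)
  have p: "u \<in> primitives" "w \<in> primitives" using assms by (auto simp: ext_conj_iff)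
  have comp: "w \<doteq> (h @ g) @ x @ winv (h @ g)" if "w \<doteq> h @ y @ winv h" "y \<doteq> g @ x @ winv g" for x y
    using that by (simp add: weq_simps)
  have "winv v \<doteq> g @ winv u @ winv g \<or> winv v \<doteq> g @ u @ winv g"
    using g weq_winv[of v "g @ u @ winv g"] weq_winv[of v "g @ winv u @ winv g"] by auto
  then show ?thesis using g h p comp unfolding ext_conj_iff by meson
qed

text \<open>A finite set of representatives is easier to carry through an automorphism than a
  quotient.\<close>

lemma finite_quotient_iff:
  assumes "S \<subseteq> primitives"
  shows "finite (S // ext_conj) \<longleftrightarrow> (\<exists>R. finite R \<and> (\<forall>g\<in>S. \<exists>r\<in>R. (r, g) \<in> ext_conj))"
proof
  assume f: "finite (S // ext_conj)"
  have "\<exists>r\<in>(\<lambda>c. SOME x. x \<in> c) ` (S // ext_conj). (r, g) \<in> ext_conj" if "g \<in> S" for g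
  proof -
    have "g \<in> ext_conj `` {g}" using ext_conj_refl that assms by auto
    then have "(SOME x. x \<in> ext_conj `` {g}) \<in> ext_conj `` {g}" by (rule someI)
    then show ?thesis using that ext_conj_sym by (auto simp: quotient_def)
  qed
  then show "\<exists>R. finite R \<and> (\<forall>g\<in>S. \<exists>r\<in>R. (r, g) \<in> ext_conj)" using f by blast
next
  assume "\<exists>R. finite R \<and> (\<forall>g\<in>S. \<exists>r\<in>R. (r, g) \<in> ext_conj)"
  then obtain R where R: "finite R" "\<forall>g\<in>S. \<exists>r\<in>R. (r, g) \<in> ext_conj" by blast
  have "S // ext_conj \<subseteq> (\<lambda>r. ext_conj `` {r}) ` R"
  proof
    fix c assume "c \<in> S // ext_conj"
    then obtain g where g: "g \<in> S" "c = ext_conj `` {g}" by (auto simp: quotient_def)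
    then obtain r where r: "r \<in> R" "(r, g) \<in> ext_conj" using R by blast
    then have "c = ext_conj `` {r}" using g(2) ext_conj_sym ext_conj_trans by blast
    then show "c \<in> (\<lambda>r. ext_conj `` {r}) ` R" using r(1) by blast
  qed
  then show "finite (S // ext_conj)" using R(1) finite_subset by blast
qed

lemma basis_subst_iff: assumes "basis c d" shows "basis (subst c d s) (subst c d t) \<longleftrightarrow> basis s t"
proof
  assume b: "basis (subst c d s) (subst c d t)"
  have "\<exists>q. subst s t q \<doteq> w" for w
  proof -
    obtain q where "subst (subst c d s) (subst c d t) q \<doteq> subst c d w" using basis_surj[OF b] by blast
    then have "subst s t q \<doteq> w" unfolding subst_subst[symmetric] by (rule basis_inj[OF assms])
    then show ?thesis by blast
  qed
  moreover have "p \<doteq> q" if "subst s t p \<doteq> subst s t q" for p q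
    using weq_subst[OF that, of c d] unfolding subst_subst by (rule basis_inj[OF b])
  ultimately show "basis s t" unfolding basis_altdef by blast
qed (rule basis_subst[OF assms])

lemma primitive_subst:
  assumes "basis c d" "reduced s"
  shows "reduce (subst c d s) \<in> primitives \<longleftrightarrow> s \<in> primitives"
proof
  assume "reduce (subst c d s) \<in> primitives"
  then obtain v where v: "basis (reduce (subst c d s)) v" by (auto simp: primitives_altdef)
  obtain t where "subst c d t \<doteq> v" using basis_surj[OF assms(1)] by blast
  then have "basis (subst c d s) (subst c d t)"
    using v basis_weq[OF reduce_weq(2)] by blast
  then show "s \<in> primitives" using basis_subst_iff[OF assms(1)] assms(2) primitives_altdef by blast
next
  assume "s \<in> primitives"
  then obtain t where "basis s t" by (auto simp: primitives_altdef)
  then show "reduce (subst c d s) \<in> primitives" using basis_primitives(1)[OF basis_subst[OF assms(1)]] by blast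
qed

text \<open>Composition with the automorphism \<open>\<phi>\<close> turns palindromes in
  \<open>(c, d)\<close> into words that are literally palindromes.\<close>

theorem BQ_imp_bounded_palindromes_pair:
  assumes \<rho>: "\<rho> \<in> hom F2 SL2C" "irreducible_rep \<rho>" "BQ_conditions \<rho>" and p0: "p0 \<in> H3"
    and cd: "generating_pair c d"
  shows "\<exists>D. \<forall>w\<in>primitives. palindromic c d w \<longrightarrow>
    (\<exists>L E. is_axis (\<rho> w) (Line L) \<and> is_hyperelliptic_axis (\<rho> c) (\<rho> d) E \<and> (\<exists>p\<in>L \<inter> E. hdist p p0 \<le> D))"
proof -
  have r: "reduced c" "reduced d" and b: "basis c d" using cd by (auto simp: generating_pair_basis)
  define \<phi> where "\<phi> s = reduce (subst c d s)" for s
  define \<rho>' where "\<rho>' s = \<rho> (\<phi> s)" for s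
  have \<phi>_red: "reduced (\<phi> s)" for s by (simp add: \<phi>_def)
  have \<phi>_weq: "\<phi> s \<doteq> subst c d s" for s by (simp add: \<phi>_def)
  have hom: "\<rho>' \<in> hom F2 SL2C"
  proof (rule homI)
    fix x y assume "x \<in> carrier F2" "y \<in> carrier F2"
    have "\<phi> (reduce (x @ y)) = reduce (\<phi> x @ \<phi> y)"
      using weq_subst[OF reduce_weq(1), of c d "x @ y"] by (simp add: \<phi>_def reduce_append_reduce weq_iff_reduce)
    then show "\<rho>' (x \<otimes>\<^bsub>F2\<^esub> y) = \<rho>' x \<otimes>\<^bsub>SL2C\<^esub> \<rho>' y"
      using hom_reduce_append[OF \<rho>(1) \<phi>_red \<phi>_red] by (simp add: F2_simps \<rho>'_def SL2C_def)
  qed (use hom_det[OF \<rho>(1) \<phi>_red] in \<open>simp add: \<rho>'_def SL2C_def\<close>)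
  have surj: "\<exists>s. reduced s \<and> \<phi> s = g" if "reduced g" for g
  proof -
    obtain s where "subst c d s \<doteq> g" using basis_surj[OF b] by blast
    then have "subst c d (reduce s) \<doteq> g" using weq_subst[OF reduce_weq(1)] weq_trans by blast
    then have "\<phi> (reduce s) = g" using that by (simp add: \<phi>_def weq_iff_reduce reduce_reduced)
    then show ?thesis using reduced_reduce by blast
  qed
  have inj: "s \<doteq> t" if "\<phi> s \<doteq> \<phi> t" for s t
    using that \<phi>_weq basis_inj[OF b] weq_trans weq_sym by meson
  have prim: "\<phi> s \<in> primitives \<longleftrightarrow> s \<in> primitives" if "reduced s" for s
    unfolding \<phi>_def by (rule primitive_subst[OF b that])
  have prim_red: "reduced s" if "s \<in> primitives" for s using that by (simp add: primitives_altdef)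
  have irr: "irreducible_rep \<rho>'"
    unfolding irreducible_rep_def
  proof (intro allI impI)
    fix W assume W: "vec.subspace W \<and> (\<forall>g\<in>carrier F2. \<forall>x\<in>W. \<rho>' g *v x \<in> W)"
    have "\<rho> g *v x \<in> W" if "g \<in> carrier F2" "x \<in> W" for g x
    proof -
      have "reduced g" using that(1) by (simp add: F2_simps)
      then obtain s where "reduced s" "\<phi> s = g" using surj by blast
      then show ?thesis using W that(2) by (auto simp: F2_simps \<rho>'_def)
    qed
    then have "\<forall>g\<in>carrier F2. \<forall>x\<in>W. \<rho> g *v x \<in> W" by simp
    then show "W = {0} \<or> W = UNIV" using \<rho>(2) W by (simp add: irreducible_rep_def)
  qed
  let ?S = "{g \<in> primitives. cmod (trace (\<rho> g)) \<le> 2}" and ?S' = "{g \<in> primitives. cmod (trace (\<rho>' g)) \<le> 2}"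
  have "finite (?S // ext_conj)" using \<rho>(3) by (simp add: BQ_conditions_def)
  then obtain R where R: "finite R" "\<forall>g\<in>?S. \<exists>r\<in>R. (r, g) \<in> ext_conj"
    by (subst (asm) finite_quotient_iff) auto
  define R' where "R' = {s. reduced s \<and> \<phi> s \<in> R}"
  have "inj_on \<phi> R'" using inj by (auto intro!: inj_onI simp: R'_def) (metis weq_refl weq_reduced)
  moreover have "\<phi> ` R' \<subseteq> R" by (auto simp: R'_def)
  ultimately have "finite R'" using R(1) by (meson finite_imageD finite_subset)
  moreover have "\<exists>r\<in>R'. (r, g) \<in> ext_conj" if g: "g \<in> ?S'" for g
  proof -
    have "\<phi> g \<in> ?S" using g prim[OF prim_red, of g] by (auto simp: \<rho>'_def)
    then obtain r where r: "r \<in> R" "(r, \<phi> g) \<in> ext_conj" using R by blast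
    then have rp: "r \<in> primitives" by (simp add: ext_conj_iff)
    obtain s where s: "reduced s" "\<phi> s = r" using surj prim_red[OF rp] by blast
    obtain h where h: "\<phi> g \<doteq> h @ \<phi> s @ winv h \<or> \<phi> g \<doteq> h @ winv (\<phi> s) @ winv h"
      using r(2) s(2) by (auto simp: ext_conj_iff)
    obtain k where k: "\<phi> k \<doteq> h" using surj[OF reduced_reduce[of h]] reduce_weq(1) by metis
    have hk: "h \<doteq> subst c d k" using k \<phi>_weq weq_sym weq_trans by meson
    have "subst c d g \<doteq> subst c d (k @ s @ winv k)" if "\<phi> g \<doteq> h @ \<phi> s @ winv h"
    proof -
      have "subst c d g \<doteq> h @ \<phi> s @ winv h" using that \<phi>_weq weq_sym weq_trans by meson
      also have "\<dots> \<doteq> subst c d k @ subst c d s @ winv (subst c d k)"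
        by (intro weq_append weq_winv hk \<phi>_weq)
      finally show ?thesis by (simp add: subst_winv)
    qed
    moreover have "subst c d g \<doteq> subst c d (k @ winv s @ winv k)" if "\<phi> g \<doteq> h @ winv (\<phi> s) @ winv h"
    proof -
      have "subst c d g \<doteq> h @ winv (\<phi> s) @ winv h" using that \<phi>_weq weq_sym weq_trans by meson
      also have "\<dots> \<doteq> subst c d k @ winv (subst c d s) @ winv (subst c d k)"
        by (intro weq_append weq_winv hk \<phi>_weq)
      finally show ?thesis by (simp add: subst_winv)
    qed
    ultimately have "g \<doteq> k @ s @ winv k \<or> g \<doteq> k @ winv s @ winv k" using h basis_inj[OF b] by blast
    moreover have "s \<in> primitives" using prim[OF s(1)] s(2) rp by simp
    ultimately have "(s, g) \<in> ext_conj" using g by (auto simp: ext_conj_iff)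
    then show ?thesis using s r(1) by (auto simp: R'_def)
  qed
  ultimately have "finite (?S' // ext_conj)" by (subst finite_quotient_iff) auto
  moreover have "trace (\<rho>' g) \<notin> complex_of_real ` {-2..2}" if "g \<in> primitives" for g
    using \<rho>(3) prim[OF prim_red[OF that]] that by (auto simp: BQ_conditions_def \<rho>'_def)
  ultimately have BQ: "BQ_conditions \<rho>'" by (simp add: BQ_conditions_def)
  have gens: "\<rho>' gen_a = \<rho> c" "\<rho>' gen_b = \<rho> d"
    using r by (simp_all add: \<rho>'_def \<phi>_def gen_a_def gen_b_def reduce_reduced)
  obtain D where D: "\<And>w. w \<in> primitives \<Longrightarrow> rev w = w \<Longrightarrow>
    \<exists>L E. is_axis (\<rho>' w) (Line L) \<and> is_hyperelliptic_axis (\<rho> c) (\<rho> d) E \<and> (\<exists>p\<in>L \<inter> E. hdist p p0 \<le> D)"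
    using BQ_imp_bounded_palindromes[OF hom irr BQ p0] unfolding gens by blast
  show ?thesis
  proof (intro exI[of _ D] ballI impI)
    fix w assume w: "w \<in> primitives" "palindromic c d w"
    then obtain s where s: "reduced s" "word_val c d s = w" "rev s = s" by (auto simp: palindromic_def)
    then have "\<phi> s = w" using word_val_eq[OF r] by (simp add: \<phi>_def)
    then show "\<exists>L E. is_axis (\<rho> w) (Line L) \<and> is_hyperelliptic_axis (\<rho> c) (\<rho> d) E \<and> (\<exists>p\<in>L \<inter> E. hdist p p0 \<le> D)"
      using D[of s] prim[OF s(1)] s(3) w(1) by (simp add: \<rho>'_def)
  qed
qed

lemma basic_pairs_generating: "(c, d) \<in> basic_pairs \<Longrightarrow> generating_pair c d"
proof -
  have ab: "gen_a \<otimes>\<^bsub>F2\<^esub> gen_b = [(X, True), (Y, True)]"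
    by (simp add: F2_simps gen_a_def gen_b_def reduce_def)
  have "basis [(X, True)] [(X, True), (Y, True)]" using basis_moves(3)[OF basis_std] by simp
  moreover have "basis [(Y, True)] [(X, True), (Y, True)]"
    by (rule basisI_inverse[of _ _ "[(Y, True), (X, False)]" "[(X, True)]"]) (auto simp: weq_iff_reduce reduce_def)
  ultimately show "(c, d) \<in> basic_pairs \<Longrightarrow> generating_pair c d"
    using basis_std unfolding basic_pairs_def ab by (auto simp: generating_pair_basis gen_a_def gen_b_def)
qed

theorem BQ_imp_BIP:
  assumes "\<rho> \<in> hom F2 SL2C" "irreducible_rep \<rho>" "BQ_conditions \<rho>" "p0 \<in> H3"
  shows "BIP p0 \<rho>"
proof -
  define Q where "Q c d D \<longleftrightarrow> (\<forall>w\<in>primitives. palindromic c d w \<longrightarrow>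
    (\<exists>L E. is_axis (\<rho> w) (Line L) \<and> is_hyperelliptic_axis (\<rho> c) (\<rho> d) E \<and> (\<exists>p\<in>L \<inter> E. hdist p p0 \<le> D)))" for c d D
  have mono: "Q c d D \<Longrightarrow> D \<le> D' \<Longrightarrow> Q c d D'" for c d D D'
    unfolding Q_def by (meson order_trans)
  have "\<exists>D. Q c d D" if "(c, d) \<in> basic_pairs" for c d
    unfolding Q_def by (rule BQ_imp_bounded_palindromes_pair[OF assms basic_pairs_generating[OF that]])
  then obtain f where f: "\<And>c d. (c, d) \<in> basic_pairs \<Longrightarrow> Q c d (f c d)" by metis
  have fin: "finite basic_pairs" by (simp add: basic_pairs_def)
  define D where "D = Max (insert 1 (case_prod f ` basic_pairs))"
  have "Q c d D" if "(c, d) \<in> basic_pairs" for c d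
    by (rule mono[OF f[OF that]]) (use fin that in \<open>auto simp: D_def intro!: Max_ge\<close>)
  moreover have "1 \<le> D" unfolding D_def by (rule Max_ge) (use fin in auto)
  then have "D > 0" by simp
  ultimately show ?thesis unfolding BIP_def Q_def by blast
qed

section \<open>Primitive stability\<close>

definition mpow :: "mat2 \<Rightarrow> nat \<Rightarrow> mat2" where
  "mpow M k = ((**) M ^^ k) (mat 1)"

lemma mpow_simps [simp]: "mpow M 0 = mat 1" "mpow M (Suc k) = M ** mpow M k"
  by (simp_all add: mpow_def)

lemma mpow_add: "mpow M (j + k) = mpow M j ** mpow M k"
  by (induction j) (simp_all add: matrix_mul_assoc)

lemma mpow_mult: "mpow M (j * k) = mpow (mpow M j) k"
  by (induction k) (simp_all add: mpow_add)

lemma det_mpow: "det M = 1 \<Longrightarrow> det (mpow M k) = 1"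
  by (induction k) (simp_all add: det_mul)

definition mnorm :: "mat2 \<Rightarrow> real" where
  "mnorm M = cmod (M$1$1) + cmod (M$1$2) + cmod (M$2$1) + cmod (M$2$2)"

lemma mnorm_nonneg: "mnorm M \<ge> 0"
  by (simp add: mnorm_def)

lemma mnorm_adj: "mnorm (adj M) = mnorm M" and mnorm_ctr: "mnorm (ctr M) = mnorm M"
  by (simp_all add: mnorm_def adj_def ctr_def)

lemma mnorm_mult: "mnorm (M ** N) \<le> mnorm M * mnorm N"
proof -
  obtain a b c d where M: "M = mk a b c d" by (rule mat2_cases)
  obtain p q r s where N: "N = mk p q r s" by (rule mat2_cases)
  have t: "cmod (x * y + z * w) \<le> cmod x * cmod y + cmod z * cmod w" for x y z w
    using norm_triangle_ineq[of "x * y" "z * w"] by (simp add: norm_mult)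
  have "mnorm (M ** N) \<le> (cmod a * cmod p + cmod b * cmod r) + (cmod a * cmod q + cmod b * cmod s) +
      (cmod c * cmod p + cmod d * cmod r) + (cmod c * cmod q + cmod d * cmod s)"
    unfolding mnorm_def M N mult_mk mk_nth by (intro add_mono t)
  also have "\<dots> \<le> (cmod a + cmod b + cmod c + cmod d) * (cmod p + cmod q + cmod r + cmod s)"
    by (simp add: algebra_simps)
  finally show ?thesis by (simp add: mnorm_def M N)
qed

lemma cmod_trace_le: "cmod (trace M) \<le> mnorm M" for M :: mat2
proof -
  have "cmod (M$1$1 + M$2$2) \<le> cmod (M$1$1) + cmod (M$2$2)" by (rule norm_triangle_ineq)
  also have "\<dots> \<le> mnorm M" by (simp add: mnorm_def)
  finally show ?thesis by (simp add: trace_def sum_2)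
qed

text \<open>Cayley-Hamilton: \<open>M M N = (trace M) (M N) - N\<close>.\<close>

lemma mnorm_cayley: assumes "det M = 1" shows "mnorm (M ** (M ** N)) \<le> cmod (trace M) * mnorm (M ** N) + mnorm N"
proof -
  obtain a b c d where M: "M = mk a b c d" by (rule mat2_cases)
  obtain p q r s where N: "N = mk p q r s" by (rule mat2_cases)
  have det: "a * d - b * c = 1" using assms by (simp add: M)
  have e: "M ** (M ** N) = mk (trace M * (a * p + b * r) - p) (trace M * (a * q + b * s) - q)
      (trace M * (c * p + d * r) - r) (trace M * (c * q + d * s) - s)"
    unfolding M N mult_mk trace_mk mk_eq_iff using det by (intro conjI) algebra+
  have t: "cmod (trace M * x - y) \<le> cmod (trace M) * cmod x + cmod y" for x y
    using norm_triangle_ineq4[of "trace M * x" y] by (simp add: norm_mult)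
  have "mnorm (M ** (M ** N)) \<le> (cmod (trace M) * cmod (a * p + b * r) + cmod p) + (cmod (trace M) * cmod (a * q + b * s) + cmod q)
      + (cmod (trace M) * cmod (c * p + d * r) + cmod r) + (cmod (trace M) * cmod (c * q + d * s) + cmod s)"
    unfolding e mnorm_def mk_nth by (intro add_mono t)
  also have "\<dots> = cmod (trace M) * mnorm (M ** N) + mnorm N"
    unfolding mnorm_def M N mult_mk mk_nth by (simp add: algebra_simps)
  finally show ?thesis .
qed

text \<open>The rate 3 is crude but independent of \<open>M\<close>, as
  \<open>2 * 3 + 1 \<le> 3^2\<close>.\<close>

lemma mnorm_mpow:
  assumes "det M = 1" "cmod (trace M) \<le> 2"
  shows "mnorm (mpow M k) \<le> (mnorm M + 2) * 3 ^ k"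
proof (induction k rule: induct_nat_012)
  case 0
  then show ?case using mnorm_nonneg[of M] by (simp add: mat_mk mnorm_def)
next
  case 1
  then show ?case using mnorm_nonneg[of M] by simp
next
  case (ge2 k)
  have "mnorm (mpow M (Suc (Suc k))) \<le> cmod (trace M) * mnorm (mpow M (Suc k)) + mnorm (mpow M k)"
    using mnorm_cayley[OF assms(1), of "mpow M k"] by simp
  also have "\<dots> \<le> 2 * ((mnorm M + 2) * 3 ^ Suc k) + (mnorm M + 2) * 3 ^ k"
    using assms(2) ge2 mnorm_nonneg[of "mpow M (Suc k)"] by (intro add_mono mult_mono) auto
  also have "\<dots> \<le> (mnorm M + 2) * 3 ^ Suc (Suc k)"
    using mnorm_nonneg[of M] by (simp add: algebra_simps)
  finally show ?case .
qed

lemma chd_act_le: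
  assumes "det M = 1" "p \<in> H3"
  shows "2 * chd p (act M p) \<le> (mnorm (herm p))\<^sup>2 * (mnorm M)\<^sup>2"
proof -
  have c1: "chd p (act M p) \<ge> 1" by (rule chd_ge_1[OF assms(2) herm_act(1)[OF assms]])
  have "2 * chd p (act M p) = cmod (complex_of_real (2 * chd p (act M p)))" using c1 by (simp only: norm_of_real)
  also have "\<dots> = cmod (trace (herm p ** adj (M ** herm p ** ctr M)))"
    by (simp only: chd_trace[OF assms(2) herm_act(1)[OF assms]] herm_act(2)[OF assms])
  also have "\<dots> \<le> mnorm (herm p ** adj (M ** herm p ** ctr M))" by (rule cmod_trace_le)
  also have "\<dots> \<le> mnorm (herm p) * mnorm (M ** herm p ** ctr M)"
    using mnorm_mult[of "herm p" "adj (M ** herm p ** ctr M)"] by (simp add: mnorm_adj)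
  also have "\<dots> \<le> mnorm (herm p) * (mnorm M * mnorm (herm p) * mnorm M)"
    using mnorm_mult[of "M ** herm p" "ctr M"] mnorm_mult[of M "herm p"] mnorm_nonneg mnorm_ctr
    by (intro mult_left_mono) (metis mult_right_mono order_trans, auto)
  finally show ?thesis by (simp add: power2_eq_square algebra_simps)
qed

lemma arcosh_le_ln: "1 \<le> x \<Longrightarrow> arcosh x \<le> ln (2 * x)" for x :: real
proof -
  assume x: "1 \<le> x"
  have "sqrt (x\<^sup>2 - 1) \<le> sqrt (x\<^sup>2)" by (rule real_sqrt_le_mono) simp
  then have s: "sqrt (x\<^sup>2 - 1) \<le> x" using x by simp
  have "0 \<le> sqrt (x\<^sup>2 - 1)" using x by simp
  then show ?thesis using x s by (simp add: arcosh_real_def add_pos_nonneg)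
qed

text \<open>\<open>chd\<close> is quadratic in the norm, so the rate 3 becomes 9 before the
  logarithm. Only the constant depends on \<open>M\<close>.\<close>

lemma displacement_growth:
  assumes "det M = 1" "cmod (trace M) \<le> 2" "p \<in> H3"
  shows "\<exists>c. \<forall>k. hdist p (act (mpow M k) p) \<le> c + real k * ln 9"
proof -
  define b where "b = (mnorm (herm p))\<^sup>2 * (mnorm M + 2)\<^sup>2"
  have "hdist p (act (mpow M k) p) \<le> ln b + real k * ln 9" for k
  proof -
    let ?x = "chd p (act (mpow M k) p)"
    have d: "det (mpow M k) = 1" by (rule det_mpow[OF assms(1)])
    have 1: "1 \<le> ?x" by (rule chd_ge_1[OF assms(3) herm_act(1)[OF d assms(3)]])
    have "2 * ?x \<le> (mnorm (herm p))\<^sup>2 * (mnorm (mpow M k))\<^sup>2" by (rule chd_act_le[OF d assms(3)])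
    also have "\<dots> \<le> (mnorm (herm p))\<^sup>2 * ((mnorm M + 2) * 3 ^ k)\<^sup>2"
      using mnorm_mpow[OF assms(1,2), of k] mnorm_nonneg by (intro mult_left_mono power_mono) auto
    also have "\<dots> = b * 9 ^ k"
      by (simp add: b_def power_mult_distrib power_mult[symmetric] mult.commute[of k]) (simp add: power_mult)
    finally have le: "2 * ?x \<le> b * 9 ^ k" .
    then have "0 < b * 9 ^ k" using 1 by linarith
    then have b: "b > 0" by (simp add: zero_less_mult_iff)
    have "hdist p (act (mpow M k) p) \<le> ln (2 * ?x)" unfolding hdist_chd by (rule arcosh_le_ln[OF 1])
    also have "\<dots> \<le> ln (b * 9 ^ k)" using le 1 b by (intro ln_mono) auto
    also have "\<dots> = ln b + real k * ln 9" using b by (simp add: ln_mult ln_realpow)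
    finally show ?thesis .
  qed
  then show ?thesis by blast
qed

lemma linear_growth_le:
  fixes a b c :: real assumes "\<And>k::nat. real k * a \<le> c + real k * b" shows "a \<le> b"
proof (rule ccontr)
  assume "\<not> a \<le> b"
  then have ab: "a - b > 0" by simp
  then obtain k :: nat where "c < real k * (a - b)" using reals_Archimedean3 by blast
  then show False using assms[of k] by (simp add: algebra_simps)
qed

section \<open>Vertices of the broken geodesic as powers\<close>

lemma matrix_list_prod_simps [simp]:
  "matrix_list_prod [] = mat 1" "matrix_list_prod (M # Ms) = M ** matrix_list_prod Ms"
  "matrix_list_prod (Ms @ Ns) = matrix_list_prod Ms ** matrix_list_prod Ns"
proof -
  show *: "matrix_list_prod [] = mat 1" "\<And>M Ms. matrix_list_prod (M # Ms) = M ** matrix_list_prod Ms"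
    by (simp_all add: matrix_list_prod_def)
  show "matrix_list_prod (Ms @ Ns) = matrix_list_prod Ms ** matrix_list_prod Ns"
    by (induction Ms) (simp_all add: * matrix_mul_assoc)
qed

lemma hom_word_val:
  assumes "\<rho> \<in> hom F2 SL2C" "reduced u" "reduced v"
  shows "matrix_list_prod (map (\<lambda>l. \<rho> (letter_val u v l)) w) = \<rho> (word_val u v w)"
proof (induction w)
  case Nil
  have "\<rho> [] = mat 1" using hom_eq_ev[OF assms(1), of "[]"] by simp
  then show ?case by (simp add: word_val_def F2_simps)
next
  case (Cons l w)
  have c: "letter_val u v l \<in> carrier F2" "word_val u v w \<in> carrier F2"
    using assms by (simp_all add: F2_simps letter_val_subst reduced_subst_letter word_val_eq)
  have "word_val u v (l # w) = letter_val u v l \<otimes>\<^bsub>F2\<^esub> word_val u v w" by (simp add: word_val_def)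
  then have "\<rho> (word_val u v (l # w)) = \<rho> (letter_val u v l) ** \<rho> (word_val u v w)"
    using hom_mult[OF assms(1) c] by (simp add: SL2C_def)
  then show ?case using Cons by simp
qed

lemma br_vertex_power:
  assumes "\<rho> \<in> hom F2 SL2C" "reduced u" "reduced v" "w \<noteq> []"
  shows "br_vertex \<rho> u v p0 w (int (k * length w)) = act (mpow (\<rho> (word_val u v w)) k) p0"
proof -
  let ?n = "length w" and ?f = "\<lambda>k. br_letter \<rho> u v w (int k)"
  have block: "map ?f [Suc (k * ?n)..<Suc (k * ?n + ?n)] = map (\<lambda>l. \<rho> (letter_val u v l)) w" for k
  proof (rule nth_equalityI)
    fix i assume "i < length (map ?f [Suc (k * ?n)..<Suc (k * ?n + ?n)])"
    then have i: "i < ?n" by (simp del: upt_Suc)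
    \<comment> \<open>The letters of the broken geodesic are numbered from 1, so the successor
      cancels the shift in \<open>br_letter\<close>.\<close>
    have "(int (Suc (k * ?n) + i) - 1) mod int ?n = int i"
    proof -
      have "int (Suc (k * ?n) + i) - 1 = int i + int k * int ?n" by simp
      then show ?thesis using i by (simp only: mod_mult_self1) simp
    qed
    then show "map ?f [Suc (k * ?n)..<Suc (k * ?n + ?n)] ! i = map (\<lambda>l. \<rho> (letter_val u v l)) w ! i"
      using i by (simp add: br_letter_def del: upt_Suc of_nat_Suc)
  qed (simp del: upt_Suc)
  have "matrix_list_prod (map ?f [1..<Suc (k * ?n)]) = mpow (\<rho> (word_val u v w)) k"
  proof (induction k)
    case (Suc k)
    have "[1..<Suc (Suc k * ?n)] = [1..<Suc (k * ?n)] @ [Suc (k * ?n)..<Suc (k * ?n + ?n)]"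
      using upt_add_eq_append[of 1 "Suc (k * ?n)" ?n] by (simp add: add.commute)
    then have "matrix_list_prod (map ?f [1..<Suc (Suc k * ?n)]) = mpow (\<rho> (word_val u v w)) k ** \<rho> (word_val u v w)"
      using Suc by (simp only: map_append matrix_list_prod_simps block hom_word_val[OF assms(1-3)])
    also have "\<dots> = mpow (\<rho> (word_val u v w)) (k + 1)" unfolding mpow_add by simp
    finally show ?case by simp
  qed simp
  then show ?thesis unfolding br_vertex_def by (simp only: nat_int of_nat_0_le_iff if_True)
qed

lemma trace_square: "det M = 1 \<Longrightarrow> trace (M ** M) = (trace M)\<^sup>2 - 2" for M :: mat2
proof (cases M rule: mat2_cases)
  case (1 a b c d)
  assume "det M = 1"
  then have "a * d - b * c = 1" by (simp add: 1)
  then show ?thesis unfolding 1 mult_mk trace_mk by algebra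
qed

text \<open>Squaring replaces the trace \<open>t\<close> by \<open>t^2 - 2\<close>, which preserves
  \<open>[-2, 2]\<close>.\<close>

lemma trace_mpow_power2:
  assumes "det M = 1" "trace M \<in> complex_of_real ` {-2..2}"
  shows "trace (mpow M (2 ^ j)) \<in> complex_of_real ` {-2..2}"
proof (induction j)
  case (Suc j)
  then obtain t where t: "t \<in> {-2..2}" "trace (mpow M (2 ^ j)) = complex_of_real t" by auto
  have "mpow M (2 ^ Suc j) = mpow M (2 ^ j) ** mpow M (2 ^ j)" by (simp add: mult_2 mpow_add)
  then have "trace (mpow M (2 ^ Suc j)) = complex_of_real (t\<^sup>2 - 2)"
    by (simp add: trace_square det_mpow assms(1) t(2))
  moreover have "t\<^sup>2 \<le> 2\<^sup>2" using t(1) by (intro power2_le_iff_abs_le[THEN iffD2]) (auto simp: abs_le_iff)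
  then have "t\<^sup>2 - 2 \<in> {-2..2}" by simp
  ultimately show ?case by blast
qed (use assms(2) in simp)

text \<open>All rotations of \<open>m\<close> are factors of \<open>m m\<close>.\<close>

lemma cyclically_shortest_of_square:
  assumes "reduced (m @ m)" shows "cyclically_shortest m"
  unfolding cyclically_shortest_def
proof
  fix n
  let ?k = "n mod length m"
  have "m @ m = take ?k m @ (drop ?k m @ take ?k m) @ drop ?k m"
    by (metis append.assoc append_take_drop_id)
  then have "reduced (drop ?k m @ take ?k m)" using assms by (metis reduced_append_iff)
  then show "reduced (rotate n m)" by (simp add: rotate_drop_take)
qed

text \<open>A small trace bounds the length of a cyclically shortest word by \<open>K ln 9\<close>,
  which leaves finitely many classes. For a trace in \<open>[-2, 2]\<close> the bound also holds for
  arbitrarily high powers, which is absurd.\<close>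

theorem primitive_stable_imp_BQ:
  assumes \<rho>: "\<rho> \<in> hom F2 SL2C" and uv: "generating_pair u v" and p0: "p0 \<in> H3"
    and ps: "primitive_stable p0 u v \<rho>"
  shows "BQ_conditions \<rho>"
proof -
  have r: "reduced u" "reduced v" and b: "basis u v" using uv by (auto simp: generating_pair_basis)
  obtain K \<epsilon> where K: "K > 0" "\<And>w. cyclically_shortest w \<Longrightarrow> word_val u v w \<in> primitives \<Longrightarrow>
      \<exists>\<gamma>. is_br \<rho> u v p0 w \<gamma> \<and> quasigeodesic K \<epsilon> UNIV \<gamma>"
    using ps unfolding primitive_stable_def by blast
  \<comment> \<open>Each application of this power takes time \<open>2^j\<close> times the length of
    \<open>w\<close>; the quasigeodesic advances at rate at least \<open>1 / K\<close>, but the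
    powers displace by at most \<open>ln 9\<close> on average.\<close>
  have len: "2 ^ j * real (length w) \<le> K * ln 9"
    if w: "cyclically_shortest w" "word_val u v w \<in> primitives" "w \<noteq> []"
      and tr: "cmod (trace (mpow (\<rho> (word_val u v w)) (2 ^ j))) \<le> 2" for w j
  proof -
    let ?W = "\<rho> (word_val u v w)" and ?n = "length w"
    have det: "det ?W = 1" using hom_det[OF \<rho>] by (simp add: word_val_eq[OF r])
    obtain \<gamma> where \<gamma>: "is_br \<rho> u v p0 w \<gamma>" "quasigeodesic K \<epsilon> UNIV \<gamma>" using K(2)[OF w(1,2)] by blast
    have vert: "\<gamma> (real (k * ?n)) = act (mpow ?W k) p0" for k
    proof -
      have "\<gamma> (of_int (int (k * ?n))) = br_vertex \<rho> u v p0 w (int (k * ?n))"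
        using \<gamma>(1) unfolding is_br_def by blast
      then show ?thesis using br_vertex_power[OF \<rho> r w(3)] by simp
    qed
    have q: "\<bar>s - t\<bar> / K - \<epsilon> \<le> hdist (\<gamma> s) (\<gamma> t)" for s t using \<gamma>(2) unfolding quasigeodesic_def by blast
    obtain c where c: "\<And>k. hdist p0 (act (mpow (mpow ?W (2 ^ j)) k) p0) \<le> c + real k * ln 9"
      using displacement_growth[OF det_mpow[OF det] tr p0] by blast
    have "real k * (2 ^ j * real ?n / K) \<le> (c + \<epsilon>) + real k * ln 9" for k
    proof -
      have "real (2 ^ j * k * ?n) / K - \<epsilon> \<le> hdist (\<gamma> (real (0 * ?n))) (\<gamma> (real (2 ^ j * k * ?n)))"
        using q[of "real (0 * ?n)" "real (2 ^ j * k * ?n)"] by simp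
      also have "\<dots> = hdist p0 (act (mpow (mpow ?W (2 ^ j)) k) p0)"
        unfolding vert mpow_mult by (simp add: act_one)
      also have "\<dots> \<le> c + real k * ln 9" by (rule c)
      finally show ?thesis by (simp add: algebra_simps)
    qed
    then have "2 ^ j * real ?n / K \<le> ln 9" by (rule linear_growth_le)
    then show ?thesis using K(1) by (simp add: field_simps)
  qed
  \<comment> \<open>The core of the word for \<open>g\<close> in the basis \<open>(u, v)\<close> is
    a cyclically shortest representative of its conjugacy class.\<close>
  have rep: "\<exists>m. cyclically_shortest m \<and> m \<noteq> [] \<and> word_val u v m \<in> primitives \<and> (word_val u v m, g) \<in> ext_conj \<and>
      trace (\<rho> (word_val u v m)) = trace (\<rho> g)" if g: "g \<in> primitives" for g
  proof -
    obtain v' where v': "basis g v'" and rg: "reduced g" using g by (auto simp: primitives_altdef)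
    obtain s where s: "subst u v s \<doteq> g" using basis_surj[OF b] by blast
    have "g \<noteq> []" using basis_parity[OF v'] by auto
    moreover have "subst u v (reduce s) \<doteq> g" using s weq_subst[OF reduce_weq(1)] weq_trans by blast
    ultimately have sn: "reduce s \<noteq> []" using weq_reduced[OF reduced_Nil rg] by auto
    obtain c m where cm: "reduce s = c @ m @ winv c" "m \<noteq> []" "reduced (m @ m)"
      using cyclic_decomposition[OF reduced_reduce sn] by blast
    have gm: "g \<doteq> subst u v c @ subst u v m @ winv (subst u v c)"
      using \<open>subst u v (reduce s) \<doteq> g\<close> weq_sym by (simp add: cm(1) subst_winv)
    let ?c = "winv (subst u v c)"
    have "subst u v m \<doteq> ?c @ g @ winv ?c" using gm by (simp add: weq_simps)
    moreover have "basis (?c @ g @ winv ?c) (?c @ v' @ winv ?c)" by (rule basis_conj[OF v'])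
    ultimately have "basis (subst u v m) (?c @ v' @ winv ?c)" using basis_weq[OF _ weq_refl] by blast
    then have p: "word_val u v m \<in> primitives" using basis_primitives(1) word_val_eq[OF r] by simp
    have wm: "word_val u v m \<doteq> subst u v m" using word_val_eq[OF r] by simp
    have "g \<doteq> subst u v c @ word_val u v m @ winv (subst u v c)"
      using gm wm by (simp add: weq_simps)
    then have "(word_val u v m, g) \<in> ext_conj" using g p by (auto simp: ext_conj_iff)
    moreover have "trace (\<rho> (word_val u v m)) = trace (\<rho> g)"
    proof -
      let ?A = "\<rho> gen_a" and ?B = "\<rho> gen_b"
      have d: "det ?A = 1" "det ?B = 1" using hom_det[OF \<rho>] by (simp_all add: gen_a_def gen_b_def)
      have "\<rho> g = ev ?A ?B g" "\<rho> (word_val u v m) = ev ?A ?B (subst u v m)"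
        using hom_eq_ev[OF \<rho>] rg ev_weq[OF d wm] by (simp_all add: word_val_eq[OF r])
      moreover have "ev ?A ?B g = ev ?A ?B (subst u v c) ** ev ?A ?B (subst u v m) ** adj (ev ?A ?B (subst u v c))"
        using ev_weq[OF d gm] by (simp add: matrix_mul_assoc)
      ultimately show ?thesis
        using trace_conj[of "adj (ev ?A ?B (subst u v c))" "ev ?A ?B (subst u v m)"] by (simp add: det_ev d)
    qed
    ultimately show ?thesis using cyclically_shortest_of_square[OF cm(3)] cm(2) p by blast
  qed
  have "trace (\<rho> g) \<notin> complex_of_real ` {-2..2}" if g: "g \<in> primitives" for g
  proof
    assume t: "trace (\<rho> g) \<in> complex_of_real ` {-2..2}"
    obtain m where m: "cyclically_shortest m" "m \<noteq> []" "word_val u v m \<in> primitives"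
      "trace (\<rho> (word_val u v m)) = trace (\<rho> g)" using rep[OF g] by blast
    have det: "det (\<rho> (word_val u v m)) = 1" using hom_det[OF \<rho>] by (simp add: word_val_eq[OF r])
    have "cmod (trace (mpow (\<rho> (word_val u v m)) (2 ^ j))) \<le> 2" for j
      using trace_mpow_power2[OF det, of j] t m(4) by auto
    then have "2 ^ j * real (length m) \<le> K * ln 9" for j using len[OF m(1,3,2)] by blast
    moreover obtain j where "K * ln 9 < 2 ^ j" using real_arch_pow[of 2] by auto
    moreover have "2 ^ j \<le> 2 ^ j * real (length m)" using m(2) by (cases m) auto
    ultimately show False by (meson less_le_trans not_le)
  qed
  moreover have "finite ({g \<in> primitives. cmod (trace (\<rho> g)) \<le> 2} // ext_conj)"
  proof (subst finite_quotient_iff)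
    let ?R = "word_val u v ` {m. set m \<subseteq> UNIV \<and> length m \<le> nat \<lfloor>K * ln 9\<rfloor>}"
    have "UNIV = {X, Y}" using gen.exhaust by auto
    then have "finite (UNIV :: gen set)" by (metis finite.emptyI finite.insertI)
    then have "finite (UNIV :: letter set)" by (simp add: finite_Prod_UNIV)
    then have "finite ?R" by (intro finite_imageI finite_lists_length_le)
    moreover have "\<exists>r\<in>?R. (r, g) \<in> ext_conj" if "g \<in> {g \<in> primitives. cmod (trace (\<rho> g)) \<le> 2}" for g
    proof -
      obtain m where m: "cyclically_shortest m" "m \<noteq> []" "word_val u v m \<in> primitives" "(word_val u v m, g) \<in> ext_conj"
        "trace (\<rho> (word_val u v m)) = trace (\<rho> g)" using rep[of g] \<open>g \<in> _\<close> by blast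
      have "2 ^ 0 * real (length m) \<le> K * ln 9"
        using \<open>g \<in> _\<close> m(5) by (intro len[OF m(1,3,2)]) simp
      then have "length m \<le> nat \<lfloor>K * ln 9\<rfloor>" by (simp add: le_nat_floor)
      then show ?thesis using m(4) by blast
    qed
    ultimately show "\<exists>R. finite R \<and> (\<forall>g\<in>{g \<in> primitives. cmod (trace (\<rho> g)) \<le> 2}. \<exists>r\<in>R. (r, g) \<in> ext_conj)" by blast
  qed auto
  ultimately show ?thesis by (simp add: BQ_conditions_def)
qed

section \<open>A representation onto the quaternion group\<close>

abbreviation mJ :: mat2 where "mJ \<equiv> mk 0 1 (- 1) 0"
abbreviation mK :: mat2 where "mK \<equiv> mk 0 \<i> \<i> 0"
abbreviation mI :: mat2 where "mI \<equiv> mk \<i> 0 0 (- \<i>)"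

definition quaternion_rep :: "letter list \<Rightarrow> mat2" where
  "quaternion_rep = ev mJ mK"

lemma quaternion_rep_hom: "quaternion_rep \<in> hom F2 SL2C"
  unfolding quaternion_rep_def by (rule ev_hom) simp_all

text \<open>Modulo sign the quaternion group is the Klein four-group, so only the parities of the
  exponent sums matter; primitive elements have a nonzero class and avoid the centre.\<close>

lemma quaternion_rep_parity:
  "quaternion_rep w \<in> (if even (wt 1 0 w) then if even (wt 0 1 w) then {mat 1, - mat 1} else {mK, - mK}
    else if even (wt 0 1 w) then {mJ, - mJ} else {mI, - mI})"
proof (induction w)
  case (Cons l w)
  obtain g b where l: "l = (g, b)" by (cases l)
  show ?case
    using Cons by (cases g; cases b; cases "even (wt 1 0 w)"; cases "even (wt 0 1 w)")
      (auto simp: quaternion_rep_def l ev_letter_def mat_mk)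
qed (simp add: quaternion_rep_def)

lemma quaternion_rep_primitive:
  assumes "w \<in> primitives"
  shows "quaternion_rep w \<in> {mI, - mI, mJ, - mJ, mK, - mK}"
proof -
  obtain v where "basis w v" using assms by (auto simp: primitives_altdef)
  then have "odd (wt 1 0 w) \<or> odd (wt 0 1 w)" by (rule basis_parity)
  then show ?thesis using quaternion_rep_parity[of w] by (auto split: if_splits)
qed

lemma quaternion_rep_irreducible: "irreducible_rep quaternion_rep"
  unfolding irreducible_rep_def
proof (intro allI impI)
  fix W :: "(complex^2) set"
  assume W: "vec.subspace W \<and> (\<forall>g\<in>carrier F2. \<forall>x\<in>W. quaternion_rep g *v x \<in> W)"
  then have sub: "vec.subspace W" by blast
  have "[(X, True)] \<in> carrier F2" "[(Y, True)] \<in> carrier F2" by (simp_all add: F2_simps)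
  moreover have "quaternion_rep [(X, True)] = mJ" "quaternion_rep [(Y, True)] = mK"
    by (simp_all add: quaternion_rep_def ev_letter_def)
  ultimately have JK: "mJ *v x \<in> W" "mK *v x \<in> W" if "x \<in> W" for x using W that by metis+
  define e1 e2 :: "complex^2" where "e1 = vector [1, 0]" "e2 = vector [0, 1]"
  show "W = {0} \<or> W = UNIV"
  proof (cases "W \<subseteq> {0}")
    case True
    then show ?thesis using vec.subspace_0[OF sub] by auto
  next
    case False
    then obtain x where x: "x \<in> W" "x \<noteq> 0" by auto
    \<comment> \<open>The product \<open>mJ mK\<close> times \<open>- \<i>\<close> is
      \<open>diag(1, -1)\<close>; adding it to and subtracting it from the identity isolates the
      coordinates.\<close>
    have y: "(- \<i>) *s (mJ *v (mK *v x)) \<in> W" by (intro vec.subspace_scale[OF sub] JK x(1))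
    have "x + (- \<i>) *s (mJ *v (mK *v x)) \<in> W" "x - (- \<i>) *s (mJ *v (mK *v x)) \<in> W"
      using vec.subspace_add[OF sub x(1) y] vec.subspace_diff[OF sub x(1) y] by blast+
    moreover have "x + (- \<i>) *s (mJ *v (mK *v x)) = (2 * x$1) *s e1" "x - (- \<i>) *s (mJ *v (mK *v x)) = (2 * x$2) *s e2"
      by (simp_all add: vec2_eq_iff mult_vec_nth e1_e2_def)
    ultimately have c: "(2 * x$1) *s e1 \<in> W" "(2 * x$2) *s e2 \<in> W" by simp_all
    have 1: "e1 \<in> W" if "x$1 \<noteq> 0"
      using vec.subspace_scale[OF sub c(1), of "inverse (2 * x$1)"] that by simp
    have 2: "e2 \<in> W" if "x$2 \<noteq> 0"
      using vec.subspace_scale[OF sub c(2), of "inverse (2 * x$2)"] that by simp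
    have J: "mJ *v e2 = e1" "mK *v e1 = \<i> *s e2"
      by (simp_all add: vec2_eq_iff mult_vec_nth e1_e2_def)
    have "e2 \<in> W" if "e1 \<in> W"
      using vec.subspace_scale[OF sub JK(2)[OF that], of "- \<i>"] J(2) by simp
    moreover have "e1 \<in> W" if "e2 \<in> W" using JK(1)[OF that] J(1) by simp
    moreover have "x$1 \<noteq> 0 \<or> x$2 \<noteq> 0" using x(2) by (auto simp: vec2_eq_iff)
    ultimately have e: "e1 \<in> W" "e2 \<in> W" using 1 2 by blast+
    have "y \<in> W" for y
    proof -
      have "y = y$1 *s e1 + y$2 *s e2" by (simp add: vec2_eq_iff e1_e2_def)
      moreover have "y$1 *s e1 + y$2 *s e2 \<in> W"
        by (intro vec.subspace_add[OF sub] vec.subspace_scale[OF sub] e)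
      ultimately show ?thesis by simp
    qed
    then show ?thesis by blast
  qed
qed

lemma base_points: "(0, 1) \<in> range vert" "(0, 1) \<in> range (arch 1)" "(0, 1) \<in> range (arch \<i>)"
  using rangeI[of vert 0] rangeI[of "arch 1" 0] rangeI[of "arch \<i>" 0] by (simp_all add: vert_def arch_def)

lemma geodesic_lines: "geodesic_line (range vert)" "\<zeta> \<noteq> 0 \<Longrightarrow> geodesic_line (range (arch \<zeta>))"
  using geodesic_vert[of "mat 1" 0] geodesic_arch[of "mat 1" \<zeta>] unfolding geodesic_line_def
  by (auto simp: act_one)

lemma act_mI_vert: "M \<in> {mI, - mI} \<Longrightarrow> act M (vert s) = vert s"
  by (auto simp: act_mk vert_def)

lemma arch_one_norm: "cmod \<zeta> = 1 \<Longrightarrow> (cmod (\<zeta> * of_real (tanh s)))\<^sup>2 + (cmod \<zeta> / cosh s)\<^sup>2 = 1"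
proof -
  assume "cmod \<zeta> = 1"
  have "(sinh s)\<^sup>2 + 1 = (cosh s)\<^sup>2" by (simp add: cosh_square_eq)
  then have "(tanh s)\<^sup>2 + 1 / (cosh s)\<^sup>2 = 1" by (simp add: tanh_def field_simps)
  then show ?thesis using \<open>cmod \<zeta> = 1\<close> by (simp add: norm_mult power_divide)
qed

lemma act_mJ_arch: "M \<in> {mJ, - mJ} \<Longrightarrow> act M (arch \<i> s) = arch \<i> s"
  using arch_one_norm[of \<i> s] by (auto simp: act_mk arch_def Let_def norm_mult)

lemma act_mK_arch: "M \<in> {mK, - mK} \<Longrightarrow> act M (arch 1 s) = arch 1 s"
  using arch_one_norm[of 1 s] by (auto simp: act_mk arch_def Let_def norm_mult power_divide)

lemma elliptic_traceless: "trace M = 0 \<Longrightarrow> elliptic M"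
  unfolding elliptic_def by (rule image_eqI[of _ _ 0]) auto

lemma quaternion_axes:
  "M \<in> {mI, - mI} \<Longrightarrow> is_axis M (Line (range vert))"
  "M \<in> {mJ, - mJ} \<Longrightarrow> is_axis M (Line (range (arch \<i>)))"
  "M \<in> {mK, - mK} \<Longrightarrow> is_axis M (Line (range (arch 1)))"
proof -
  assume M: "M \<in> {mI, - mI}"
  then have "elliptic M" by (intro elliptic_traceless) auto
  then show "is_axis M (Line (range vert))" using act_mI_vert[OF M] geodesic_lines by auto
next
  assume M: "M \<in> {mJ, - mJ}"
  then have "elliptic M" by (intro elliptic_traceless) auto
  then show "is_axis M (Line (range (arch \<i>)))" using act_mJ_arch[OF M] geodesic_lines by auto
next
  assume M: "M \<in> {mK, - mK}"
  then have "elliptic M" by (intro elliptic_traceless) auto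
  then show "is_axis M (Line (range (arch 1)))" using act_mK_arch[OF M] geodesic_lines by auto
qed

lemma meet_orthogonally_sym: "meet_orthogonally L M \<Longrightarrow> meet_orthogonally M L"
  unfolding meet_orthogonally_def by (metis inner_commute)

text \<open>The three axes are mutually orthogonal lines through \<open>(0, 1)\<close>, so the
  hyperelliptic axis of any two of the generators and their product is the third axis.\<close>

lemma quaternion_orthogonal:
  "meet_orthogonally (range vert) (range (arch \<i>))" "meet_orthogonally (range vert) (range (arch 1))"
  "meet_orthogonally (range (arch \<i>)) (range (arch 1))"
proof -
  have "act (mat 1) ` L = L" for L by (simp add: act_one image_def)
  then show "meet_orthogonally (range vert) (range (arch \<i>))" "meet_orthogonally (range vert) (range (arch 1))"
    using vert_arch_orthogonal[of "mat 1" \<i>] vert_arch_orthogonal[of "mat 1" 1] by simp_all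
  have g: "unit_speed_geodesic (arch \<i>)" "unit_speed_geodesic (arch 1)"
    using geodesic_arch[of "mat 1" \<i>] geodesic_arch[of "mat 1" 1] by (simp_all add: act_one)
  have "arch \<i> 0 = arch 1 0" by (simp add: arch_def)
  moreover have "inner (\<i>, 0::real) (1::complex, 0::real) = 0" by (simp add: inner_complex_def)
  ultimately show "meet_orthogonally (range (arch \<i>)) (range (arch 1))"
    unfolding meet_orthogonally_def using g arch_derivative by metis
qed

lemma quaternion_intersections:
  "range vert \<inter> range (arch \<i>) \<subseteq> {(0, 1)}" "range vert \<inter> range (arch 1) \<subseteq> {(0, 1)}"
  "range (arch \<i>) \<inter> range (arch 1) \<subseteq> {(0, 1)}"
proof -
  have *: "range vert \<inter> range (arch \<zeta>) \<subseteq> {(0, 1)}" if "cmod \<zeta> = 1" for \<zeta>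
  proof
    fix p assume "p \<in> range vert \<inter> range (arch \<zeta>)"
    then obtain s t where p: "p = vert s" "p = arch \<zeta> t" by blast
    then have "\<zeta> * of_real (tanh t) = 0" by (simp add: vert_def arch_def)
    then have "t = 0" using that by auto
    then show "p \<in> {(0, 1)}" using p(2) that by (simp add: arch_def)
  qed
  show "range vert \<inter> range (arch \<i>) \<subseteq> {(0, 1)}" "range vert \<inter> range (arch 1) \<subseteq> {(0, 1)}"
    by (intro *; simp)+
  moreover have "range (arch \<i>) \<inter> range (arch 1) \<subseteq> range vert"
    by (rule arch_inter_arch) simp_all
  ultimately show "range (arch \<i>) \<inter> range (arch 1) \<subseteq> {(0, 1)}" by blast
qed

lemma is_hyperelliptic_axisI:
  assumes "is_axis U (Line L)" "is_axis V (Line M)" "geodesic_line E"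
    "meet_orthogonally E L" "meet_orthogonally E M" "L \<inter> M \<subseteq> E"
  shows "is_hyperelliptic_axis U V E"
  unfolding is_hyperelliptic_axis_def
  by (intro conjI exI[of _ "Line L"] exI[of _ "Line M"]) (simp_all only: assms perpendicular_to_axis.simps axis_points.simps)

lemma quaternion_rep_BIP: "BIP p0 quaternion_rep"
  unfolding BIP_def
\<comment> \<open>All intersections happen at \<open>(0, 1)\<close>; the maximum with 1 only makes
  the bound positive.\<close>
proof (intro exI[of _ "max 1 (hdist (0, 1) p0)"] conjI ballI)
  have gens: "quaternion_rep gen_a = mJ" "quaternion_rep gen_b = mK"
    "quaternion_rep (gen_a \<otimes>\<^bsub>F2\<^esub> gen_b) = mI"
    by (simp_all add: quaternion_rep_def gen_a_def gen_b_def F2_simps ev_reduce ev_letter_def mat_mk)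
  have hyp: "\<exists>E. is_hyperelliptic_axis (quaternion_rep u) (quaternion_rep v) E \<and> (0, 1) \<in> E"
    if "(u, v) \<in> basic_pairs" for u v
  proof -
    note o = quaternion_orthogonal
    have 1: "is_hyperelliptic_axis mJ mK (range vert)"
      by (rule is_hyperelliptic_axisI[OF quaternion_axes(2) quaternion_axes(3) geodesic_lines(1) o(1) o(2)])
        (use quaternion_intersections(3) base_points(1) in auto)
    have 2: "is_hyperelliptic_axis mJ mI (range (arch 1))"
      by (rule is_hyperelliptic_axisI[OF quaternion_axes(2) quaternion_axes(1) geodesic_lines(2)
            o(3)[THEN meet_orthogonally_sym] o(2)[THEN meet_orthogonally_sym]])
        (use quaternion_intersections(1) base_points(2) in auto)
    have 3: "is_hyperelliptic_axis mK mI (range (arch \<i>))"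
      by (rule is_hyperelliptic_axisI[OF quaternion_axes(3) quaternion_axes(1) geodesic_lines(2)
            o(3) o(1)[THEN meet_orthogonally_sym]])
        (use quaternion_intersections(2) base_points(3) in auto)
    from that consider "u = gen_a" "v = gen_b" | "u = gen_a" "v = gen_a \<otimes>\<^bsub>F2\<^esub> gen_b"
      | "u = gen_b" "v = gen_a \<otimes>\<^bsub>F2\<^esub> gen_b" unfolding basic_pairs_def by blast
    then show ?thesis
    proof cases
      case 1
      show ?thesis unfolding 1 gens using \<open>is_hyperelliptic_axis mJ mK _\<close> base_points(1) by blast
    next
      case 2
      show ?thesis unfolding 2 gens using \<open>is_hyperelliptic_axis mJ mI _\<close> base_points(2) by blast
    next
      case 3
      show ?thesis unfolding 3 gens using \<open>is_hyperelliptic_axis mK mI _\<close> base_points(3) by blast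
    qed
  qed
  have ax: "\<exists>L. is_axis (quaternion_rep w) (Line L) \<and> (0, 1) \<in> L" if "w \<in> primitives" for w
  proof -
    from quaternion_rep_primitive[OF that] consider "quaternion_rep w \<in> {mI, - mI}"
      | "quaternion_rep w \<in> {mJ, - mJ}" | "quaternion_rep w \<in> {mK, - mK}" by blast
    then show ?thesis
    proof cases
      case 1
      show ?thesis using quaternion_axes(1)[OF 1] base_points(1) by blast
    next
      case 2
      show ?thesis using quaternion_axes(2)[OF 2] base_points(3) by blast
    next
      case 3
      show ?thesis using quaternion_axes(3)[OF 3] base_points(2) by blast
    qed
  qed
  fix p assume p: "p \<in> basic_pairs"
  obtain u v where uv: "p = (u, v)" by (cases p)
  obtain E where E: "is_hyperelliptic_axis (quaternion_rep u) (quaternion_rep v) E" "(0, 1) \<in> E"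
    using hyp p unfolding uv by blast
  have le: "hdist (0, 1) p0 \<le> max 1 (hdist (0, 1) p0)" by simp
  have "\<exists>L E. is_axis (quaternion_rep w) (Line L) \<and> is_hyperelliptic_axis (quaternion_rep u) (quaternion_rep v) E \<and>
      (\<exists>q\<in>L \<inter> E. hdist q p0 \<le> max 1 (hdist (0, 1) p0))" if "w \<in> primitives" for w
    using ax[OF that] E le by blast
  then show "case p of (u, v) \<Rightarrow> \<forall>w\<in>primitives. palindromic u v w \<longrightarrow>
      (\<exists>L E. is_axis (quaternion_rep w) (Line L) \<and>
         is_hyperelliptic_axis (quaternion_rep u) (quaternion_rep v) E \<and>
         (\<exists>q\<in>L \<inter> E. hdist q p0 \<le> max 1 (hdist (0, 1) p0)))"
    unfolding uv by simp
qed simp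

lemma quaternion_rep_not_BQ: "\<not> BQ_conditions quaternion_rep"
proof
  assume BQ: "BQ_conditions quaternion_rep"
  have "gen_a \<in> primitives" using basis_primitives(1)[OF basis_std] by (simp add: gen_a_def reduce_reduced)
  then have "trace (quaternion_rep gen_a) \<notin> complex_of_real ` {-2..2}" using BQ by (simp add: BQ_conditions_def)
  moreover have "trace (quaternion_rep gen_a) = complex_of_real 0"
    by (simp add: quaternion_rep_def gen_a_def ev_letter_def mat_mk)
  ultimately show False by (metis atLeastAtMost_iff image_eqI neg_le_0_iff_le zero_le_numeral)
qed

theorem theorem2:
  fixes p0 :: point and u v :: "letter list"
  assumes "p0 \<in> H3" and "generating_pair u v"
  shows "(\<forall>\<rho>\<in>hom F2 SL2C. irreducible_rep \<rho> \<longrightarrow> BQ_conditions \<rho> \<longrightarrow> BIP p0 \<rho>) \<and>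
    (\<forall>\<rho>\<in>hom F2 SL2C. irreducible_rep \<rho> \<longrightarrow> primitive_stable p0 u v \<rho> \<longrightarrow> BIP p0 \<rho>) \<and>
    (\<exists>\<rho>\<in>hom F2 SL2C. irreducible_rep \<rho> \<and> BIP p0 \<rho> \<and> \<not> BQ_conditions \<rho>) \<and>
    (\<exists>\<rho>\<in>hom F2 SL2C. irreducible_rep \<rho> \<and> BIP p0 \<rho> \<and> \<not> primitive_stable p0 u v \<rho>)"
proof (intro conjI ballI impI)
  fix \<rho> assume \<rho>: "\<rho> \<in> hom F2 SL2C" "irreducible_rep \<rho>"
  show "BIP p0 \<rho>" if "BQ_conditions \<rho>"
    using BQ_imp_BIP[OF \<rho> that assms(1)] .
  show "BIP p0 \<rho>" if "primitive_stable p0 u v \<rho>"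
    using BQ_imp_BIP[OF \<rho> primitive_stable_imp_BQ[OF \<rho>(1) assms(2,1) that] assms(1)] .
next
  show "\<exists>\<rho>\<in>hom F2 SL2C. irreducible_rep \<rho> \<and> BIP p0 \<rho> \<and> \<not> BQ_conditions \<rho>"
    using quaternion_rep_hom quaternion_rep_irreducible quaternion_rep_BIP quaternion_rep_not_BQ by blast
  show "\<exists>\<rho>\<in>hom F2 SL2C. irreducible_rep \<rho> \<and> BIP p0 \<rho> \<and> \<not> primitive_stable p0 u v \<rho>"
    using quaternion_rep_hom quaternion_rep_irreducible quaternion_rep_BIP quaternion_rep_not_BQ
      primitive_stable_imp_BQ[OF quaternion_rep_hom assms(2,1)] by blast
qed

end
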